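(* Let $U\subseteq\mathbb{C}$ be a bounded domain, that is, $U$ is non-empty, open, connected and bounded. The following are equivalent: (a) $U$ is regular, i.e. $\operatorname{int}(\overline{U})=U$; (b) there is a meromorphic function $f\colon\mathbb{C}\to\widehat{\mathbb{C}}$ such that $U$ is a Fatou component of $f$.
   Context: $\widehat{\mathbb{C}}=\mathbb{C}\cup\{\infty\}$ is the Riemann sphere. For a meromorphic function $f\colon\mathbb{C}\to\widehat{\mathbb{C}}$ (rational or transcendental), the Fatou set $F(f)$ is the largest open set on which all iterates $f^n$ are defined and form a normal family (with respect to the spherical metric). When $f$ is rational it is regarded as a self-map of $\widehat{\mathbb{C}}$, so all iterates are defined everywhere; when $f$ is transcendental, $f$ is not defined at $\infty$. A Fatou component of $f$ is a connected component of $F(f)$. A domain $U\subseteq\mathbb{C}$ is called regular if $\operatorname{int}(\overline{U})=U$. *)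

theory Defs
  imports "HOL-Complex_Analysis.Complex_Analysis"
begin

datatype riemann_sphere = Fin complex | Infty

text \<open>Inverse stereographic projection onto the unit sphere of \<open>\<complex> \<times> \<real>\<close>; the north pole is
  the image of the point at infinity.\<close>

fun stereo :: "riemann_sphere \<Rightarrow> complex \<times> real" where
  "stereo (Fin z) = ((2 / (1 + (cmod z)\<^sup>2)) *\<^sub>R z, ((cmod z)\<^sup>2 - 1) / (1 + (cmod z)\<^sup>2))"
| "stereo Infty = (0, 1)"

lemma stereo_inner_self: "stereo x \<bullet> stereo x = 1"
proof (cases x)
  case (Fin z)
  define r where "r = (cmod z)\<^sup>2"
  have r: "0 \<le> r" by (simp add: r_def)
  have "stereo x \<bullet> stereo x = (2 / (1 + r))\<^sup>2 * r + ((r - 1) / (1 + r))\<^sup>2"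
  proof -
    have "z \<bullet> z = r" by (simp add: r_def dot_square_norm)
    then show ?thesis
      unfolding Fin stereo.simps inner_Pair r_def[symmetric]
      by (simp add: power2_eq_square)
  qed
  also have "\<dots> = (4 * r + (r - 1)\<^sup>2) / (1 + r)\<^sup>2"
    by (simp add: power_divide add_divide_distrib)
  also have "4 * r + (r - 1)\<^sup>2 = (1 + r)\<^sup>2"
    by (simp add: power2_eq_square algebra_simps)
  finally show ?thesis using r by simp
qed (simp add: inner_Pair)

lemma norm_stereo: "norm (stereo x) = 1"
  by (simp add: norm_eq_sqrt_inner stereo_inner_self)

lemma inj_stereo:
  assumes "stereo x = stereo y"
  shows "x = y"
proof -
  have snd_ne: "snd (stereo (Fin z)) \<noteq> 1" for z
  proof -
    have "1 + (cmod z)\<^sup>2 > 0" by (simp add: add_pos_nonneg)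
    then show ?thesis by (simp add: divide_eq_eq)
  qed
  show ?thesis
  proof (cases x; cases y)
    fix z w assume xy: "x = Fin z" "y = Fin w"
    define r s where "r = (cmod z)\<^sup>2" and "s = (cmod w)\<^sup>2"
    have pos: "1 + r > 0" "1 + s > 0" by (simp_all add: r_def s_def add_pos_nonneg)
    have "(r - 1) / (1 + r) = (s - 1) / (1 + s)"
      using assms by (simp add: xy r_def s_def)
    then have "(r - 1) * (1 + s) = (s - 1) * (1 + r)"
      using pos by (simp add: frac_eq_eq)
    then have rs: "r = s" by (simp add: algebra_simps)
    have "(2 / (1 + r)) *\<^sub>R z = (2 / (1 + s)) *\<^sub>R w"
      using assms by (simp add: xy r_def s_def)
    then have "z = w" using rs pos by simp
    then show "x = y" by (simp add: xy)
  qed (use assms snd_ne in \<open>metis snd_conv stereo.simps(2)\<close>)+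
qed

lemma arccos_inner_triangle:
  fixes a b c :: "'a :: real_inner"
  assumes "norm a = 1" "norm b = 1" "norm c = 1"
  shows "arccos (a \<bullet> c) \<le> arccos (a \<bullet> b) + arccos (b \<bullet> c)"
proof -
  have bnd: "\<bar>u \<bullet> v\<bar> \<le> 1" if "norm u = 1" "norm v = 1" for u v :: 'a
    using Cauchy_Schwarz_ineq2[of u v] that by simp
  define p q where "p = a \<bullet> b" and "q = b \<bullet> c"
  have p: "\<bar>p\<bar> \<le> 1" and q: "\<bar>q\<bar> \<le> 1" and ac: "\<bar>a \<bullet> c\<bar> \<le> 1"
    using bnd assms by (simp_all add: p_def q_def)
  have sq: "a \<bullet> a = 1" "b \<bullet> b = 1" "c \<bullet> c = 1"
    using assms by (simp_all add: dot_square_norm)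
  define u v where "u = a - p *\<^sub>R b" and "v = c - q *\<^sub>R b"
  have uv: "u \<bullet> v = a \<bullet> c - p * q"
    by (simp add: u_def v_def p_def q_def inner_diff sq inner_commute)
  have nu: "norm u = sqrt (1 - p\<^sup>2)"
    by (simp add: norm_eq_sqrt_inner u_def p_def inner_diff sq inner_commute power2_eq_square)
  have nv: "norm v = sqrt (1 - q\<^sup>2)"
    by (simp add: norm_eq_sqrt_inner v_def q_def inner_diff sq inner_commute power2_eq_square)
  have le: "p * q - sqrt (1 - p\<^sup>2) * sqrt (1 - q\<^sup>2) \<le> a \<bullet> c"
    using Cauchy_Schwarz_ineq2[of u v] by (simp add: uv nu nv)
  have bp: "0 \<le> arccos p" "0 \<le> arccos q" "arccos (a \<bullet> c) \<le> pi"
    using p q ac by (auto intro!: arccos_lbound arccos_ubound)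
  have "arccos (a \<bullet> c) \<le> arccos p + arccos q"
  proof (cases "arccos p + arccos q \<le> pi")
    case True
    have "cos (arccos p + arccos q) = p * q - sqrt (1 - p\<^sup>2) * sqrt (1 - q\<^sup>2)"
      using p q by (simp add: cos_add cos_arccos_abs sin_arccos_abs)
    then have "arccos (a \<bullet> c) \<le> arccos (cos (arccos p + arccos q))"
      using le ac by (intro arccos_le_arccos) (auto simp flip: \<open>cos _ = _\<close>)
    also have "\<dots> = arccos p + arccos q"
      using True bp by (intro arccos_cos) auto
    finally show ?thesis .
  qed (use bp in linarith)
  then show ?thesis by (simp add: p_def q_def)
qed

text \<open>The distance is the spherical one, i.e. the great-circle distance of the stereographic
  images (the geodesic distance of the metric \<open>2 |dz| / (1 + |z|\<^sup>2)\<close>).\<close>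

instantiation riemann_sphere :: metric_space
begin

definition dist_riemann_sphere :: "riemann_sphere \<Rightarrow> riemann_sphere \<Rightarrow> real" where
  "dist_riemann_sphere x y = arccos (stereo x \<bullet> stereo y)"

definition uniformity_riemann_sphere :: "(riemann_sphere \<times> riemann_sphere) filter" where
  "uniformity_riemann_sphere = (INF e\<in>{0 <..}. principal {(x, y). dist x y < e})"

definition open_riemann_sphere :: "riemann_sphere set \<Rightarrow> bool" where
  "open_riemann_sphere S \<longleftrightarrow> (\<forall>x\<in>S. \<forall>\<^sub>F (x', y) in uniformity. x' = x \<longrightarrow> y \<in> S)"

instance
proof
  fix x y z :: riemann_sphere
  show "(dist x y = 0) = (x = y)"
  proof
    assume "dist x y = 0"
    moreover have "\<bar>stereo x \<bullet> stereo y\<bar> \<le> 1"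
      using Cauchy_Schwarz_ineq2[of "stereo x" "stereo y"] by (simp add: norm_stereo)
    ultimately have "stereo x \<bullet> stereo y = 1"
      by (metis dist_riemann_sphere_def cos_arccos_abs cos_zero)
    then have "(stereo x - stereo y) \<bullet> (stereo x - stereo y) = 0"
      by (simp add: inner_diff inner_commute stereo_inner_self)
    then show "x = y" by (simp add: inj_stereo)
  qed (simp add: dist_riemann_sphere_def stereo_inner_self)
  show "dist x y \<le> dist x z + dist y z"
    using arccos_inner_triangle[of "stereo x" "stereo z" "stereo y"]
    by (simp add: dist_riemann_sphere_def norm_stereo inner_commute)
qed (fact uniformity_riemann_sphere_def open_riemann_sphere_def)+

end

text \<open>Library meromorphic functions are complex-valued; a \<open>nicely\<close> meromorphic function has all
  its removable singularities removed, so that it becomes a holomorphic map to the sphere once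
  its (dummy) value at each pole is replaced by infinity. The constant map with value infinity
  is not of this form.\<close>

definition meromorphic_map :: "(complex \<Rightarrow> riemann_sphere) \<Rightarrow> bool" where
  "meromorphic_map f \<longleftrightarrow>
     (\<exists>g. g nicely_meromorphic_on UNIV \<and> f = (\<lambda>z. if is_pole g z then Infty else Fin (g z)))"

definition rational_map :: "(complex \<Rightarrow> riemann_sphere) \<Rightarrow> bool" where
  "rational_map f \<longleftrightarrow> meromorphic_map f \<and>
     (\<exists>p q. q \<noteq> 0 \<and> (\<forall>z. poly q z \<noteq> 0 \<longrightarrow> f z = Fin (poly p z / poly q z)))"

definition map_domain :: "(complex \<Rightarrow> riemann_sphere) \<Rightarrow> riemann_sphere set" where
  "map_domain f = (if rational_map f then UNIV else range Fin)"

text \<open>The map as a function on the sphere. It is meaningful on \<open>map_domain f\<close> only: the value at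
  infinity of a transcendental map is a junk value.\<close>

definition sphere_map :: "(complex \<Rightarrow> riemann_sphere) \<Rightarrow> riemann_sphere \<Rightarrow> riemann_sphere" where
  "sphere_map f x =
     (case x of Fin z \<Rightarrow> f z
      | Infty \<Rightarrow> (if rational_map f then Lim at_infinity f else undefined))"

definition all_iterates_defined :: "(complex \<Rightarrow> riemann_sphere) \<Rightarrow> riemann_sphere \<Rightarrow> bool" where
  "all_iterates_defined f x \<longleftrightarrow> (\<forall>n. (sphere_map f ^^ n) x \<in> map_domain f)"

definition normal_family_on ::
    "'a::topological_space set \<Rightarrow> ('a \<Rightarrow> 'b::metric_space) set \<Rightarrow> bool" where
  "normal_family_on W \<F> \<longleftrightarrow>
     (\<forall>h :: nat \<Rightarrow> 'a \<Rightarrow> 'b. range h \<subseteq> \<F> \<longrightarrow>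
        (\<exists>r l. strict_mono r \<and>
           (\<forall>K. compact K \<longrightarrow> K \<subseteq> W \<longrightarrow> uniform_limit K (h \<circ> r) l sequentially)))"

text \<open>Normality is a local property, so the union of all open sets with the required properties
  is the largest one.\<close>

definition fatou_set :: "(complex \<Rightarrow> riemann_sphere) \<Rightarrow> riemann_sphere set" where
  "fatou_set f = \<Union>{W. open W \<and> (\<forall>x\<in>W. all_iterates_defined f x) \<and>
                        normal_family_on W (range (\<lambda>n. sphere_map f ^^ n))}"

definition fatou_component :: "(complex \<Rightarrow> riemann_sphere) \<Rightarrow> riemann_sphere set \<Rightarrow> bool" where
  "fatou_component f V \<longleftrightarrow> V \<in> components (fatou_set f)"

definition regular_domain :: "complex set \<Rightarrow> bool" where
  "regular_domain U \<longleftrightarrow> interior (closure U) = U"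

end

theory Submission
  imports Defs
begin

text \<open>Two independent arguments prove the two implications.

  A bounded Fatou component \<open>U\<close> is regular. The Fatou set of a constant map is the whole sphere, so \<open>f\<close> is not
  constant and its iterates are open maps. Let \<open>V\<close> be the interior of the closure of \<open>U\<close>, so that
  \<open>U\<close> is dense in \<open>V\<close>. The Fatou set is forward invariant, so the connected set \<open>f\<^sup>n(U)\<close> is contained in
  \<open>U\<close> as soon as it meets \<open>U\<close>; in particular it never meets both \<open>U\<close> and the exterior of \<open>U\<close>.
  Suppose that \<open>f\<^sup>n\<close> is defined on \<open>V\<close> and takes there a value in the frontier of \<open>V\<close>. Since
  \<open>f\<^sup>n(V)\<close> is open, it meets \<open>U\<close> and the exterior of \<open>U\<close>, and by density so does \<open>f\<^sup>n(U)\<close>, which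
  is impossible. If \<open>f\<close> is transcendental and \<open>f\<^sup>n\<close> takes the value infinity on \<open>V\<close>, then
  \<open>f\<^sup>n(V)\<close> contains a punctured neighbourhood of infinity, on which \<open>f\<close> has dense image by the
  theorem of Casorati and Weierstrass (\<open>transcendental_dense_near_infinity\<close>), and the same contradiction arises
  for the next image of \<open>U\<close>. Therefore all iterates are defined on \<open>V\<close> and omit the frontier of \<open>V\<close>.
  That frontier has at least three points because \<open>V\<close> is bounded, so Montel's theorem
  (\<open>sphere_Montel\<close>) puts \<open>V\<close> inside the Fatou set; as \<open>V\<close> is connected and contains \<open>U\<close>, it is \<open>U\<close>.

  Every bounded regular domain \<open>U\<close> is a wandering Fatou component. The map
  \<open>z \<mapsto> 2 z + c\<close> with a large constant \<open>c\<close> carries the closure \<open>K\<close> of \<open>U\<close> off to infinity through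
  pairwise disjoint regions. Poles are added to it one after another
  to give \<open>f(z) = 2 z + c + (\<Sum>n. s_n(z))\<close>,
  where \<open>s_n\<close> is rational with its only pole at \<open>p_n\<close> and extremely small away from \<open>p_n\<close>, and where
  \<open>p_n = f_n\<^sup>n(q_n)\<close> is the image under the \<open>n\<close>-th partial sum of a point \<open>q_n\<close> outside \<open>K\<close>. Regularity of
  \<open>U\<close> says precisely that such points \<open>q_n\<close> can be made to accumulate at every frontier point of \<open>U\<close>.
  The partial sum \<open>f_n\<close> is injective along the relevant orbits, hence \<open>p_n\<close> lies at a positive distance from
  \<open>f_n\<^sup>n(K)\<close>, and all later perturbations can be made too small to close this gap. So no orbit of \<open>K\<close> meets a pole,
  and the iterates converge to infinity uniformly on \<open>K\<close>: \<open>U\<close> lies in the Fatou set. The functions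
  \<open>s_k\<close> with \<open>k \<ge> n\<close> vanish at the first \<open>n\<close> points of the orbit of \<open>q_n\<close>, so that
  \<open>f\<^sup>n(q_n) = p_n\<close> holds exactly and \<open>q_n\<close> is a preimage of infinity. Such points are not in the Fatou set, and they
  accumulate at every frontier point of \<open>U\<close>. Hence \<open>U\<close> is a component of the Fatou set.\<close>

section \<open>The topology of the Riemann sphere\<close>

text \<open>This weak form of Jordan's inequality makes the great-circle distance comparable with the chordal one.\<close>

lemma sin_ge_half: 
  fixes y :: real assumes "0 \<le> y" "y \<le> pi / 2" shows "y / 2 \<le> sin y"
proof (cases "y \<le> pi / 3")
  case True
  have "\<exists>\<xi>. \<xi> \<in> {0..y} \<and> sin y = y * cos \<xi>" 
  proof (cases "y = 0")
    case False
    then have "\<exists>z>0. z < y \<and> sin y - sin 0 = (y - 0) * cos z"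
      using assms by (intro MVT2) (auto intro!: derivative_eq_intros)
    then show ?thesis by (auto intro: less_imp_le)
  qed (auto intro: exI[of _ 0])
  then obtain \<xi> where x: "0 \<le> \<xi>" "\<xi> \<le> y" "sin y = y * cos \<xi>" by auto
  have "cos (pi / 3) \<le> cos \<xi>"
    using x True pi_gt_zero by (intro cos_monotone_0_pi_le) auto
  then show ?thesis using x assms mult_left_mono[of "1/2" "cos \<xi>" y] by (simp add: cos_60)
next
  case False
  have "sin (pi / 3) \<le> sin y"
    using False assms by (intro sin_monotone_2pi_le) auto
  moreover have "8 / 5 \<le> sqrt 3" by (rule real_le_rsqrt) (simp add: power2_eq_square)
  moreover have "pi \<le> 16 / 5" using pi_approx by simp
  ultimately show ?thesis using assms unfolding sin_60 by linarith
qed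

lemma dist_stereo: "dist (stereo x) (stereo y) = 2 * sin (dist x y / 2)"
proof -
  define t where "t = stereo x \<bullet> stereo y"
  have t: "\<bar>t\<bar> \<le> 1"
    using Cauchy_Schwarz_ineq2[of "stereo x" "stereo y"] by (simp add: norm_stereo t_def)
  define d where "d = dist x y"
  have d: "cos d = t" "0 \<le> d" "d \<le> pi"
    using t arccos_lbound[of t] arccos_ubound[of t] by (auto simp: d_def dist_riemann_sphere_def t_def[symmetric] cos_arccos_abs)
  have "(dist (stereo x) (stereo y))\<^sup>2 = 2 - 2 * t"
    unfolding dist_norm power2_norm_eq_inner
    by (simp add: inner_diff inner_commute stereo_inner_self t_def)
  also have "\<dots> = (2 * sin (d / 2))\<^sup>2"
    using cos_double_sin[of "d / 2"] d by (simp add: power2_eq_square)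
  finally have "(dist (stereo x) (stereo y))\<^sup>2 = (2 * sin (d / 2))\<^sup>2" .
  moreover have "0 \<le> sin (d / 2)" using d by (intro sin_ge_zero) linarith+
  ultimately show ?thesis
    unfolding d_def[symmetric] by (subst (asm) power2_eq_iff_nonneg) auto
qed

lemma dist_sphere_le_pi: "dist (x::riemann_sphere) y \<le> pi"
proof -
  have "\<bar>stereo x \<bullet> stereo y\<bar> \<le> 1"
    using Cauchy_Schwarz_ineq2[of "stereo x" "stereo y"] by (simp add: norm_stereo)
  then show ?thesis by (auto simp: dist_riemann_sphere_def intro: arccos_ubound)
qed

lemma dist_stereo_le: "dist (stereo x) (stereo y) \<le> dist x y"
  using sin_x_le_x[of "dist x y / 2"] by (simp add: dist_stereo)

lemma dist_le_stereo: "dist x y \<le> 2 * dist (stereo x) (stereo y)"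
  using sin_ge_half[of "dist x y / 2"] dist_sphere_le_pi[of x y] by (simp add: dist_stereo)

text \<open>Both distances define the same topology, so limits on the sphere can be computed in
  \<open>\<complex> \<times> \<real>\<close>.\<close>

lemma tendsto_stereo_iff:
  "((\<lambda>x. stereo (f x)) \<longlongrightarrow> stereo l) F \<longleftrightarrow> (f \<longlongrightarrow> l) F"
proof
  assume "((\<lambda>x. stereo (f x)) \<longlongrightarrow> stereo l) F"
  then have "((\<lambda>x. 2 * dist (stereo (f x)) (stereo l)) \<longlongrightarrow> 0) F"
    by (auto simp: tendsto_dist_iff[of _ "stereo l"] intro!: tendsto_mult_right_zero)
  then show "(f \<longlongrightarrow> l) F" unfolding tendsto_dist_iff[of f]
    by (rule Lim_null_comparison[rotated]) (auto intro!: always_eventually dist_le_stereo)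
next
  assume "(f \<longlongrightarrow> l) F"
  then have "((\<lambda>x. dist (f x) l) \<longlongrightarrow> 0) F" by (simp add: tendsto_dist_iff[symmetric])
  then show "((\<lambda>x. stereo (f x)) \<longlongrightarrow> stereo l) F" unfolding tendsto_dist_iff[of _ "stereo l"]
    by (rule Lim_null_comparison[rotated]) (auto intro!: always_eventually dist_stereo_le)
qed

lemma tendsto_Fin:
  assumes "(f \<longlongrightarrow> z) F" shows "((\<lambda>x. Fin (f x)) \<longlongrightarrow> Fin z) F"
  unfolding tendsto_stereo_iff[symmetric] stereo.simps
  by (intro tendsto_intros assms) (auto simp: add_nonneg_eq_0_iff)

fun sphere_inverse :: "riemann_sphere \<Rightarrow> riemann_sphere" where
  "sphere_inverse (Fin z) = (if z = 0 then Infty else Fin (inverse z))"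
| "sphere_inverse Infty = Fin 0"

lemma sphere_inverse_sphere_inverse [simp]: "sphere_inverse (sphere_inverse x) = x"
  by (cases x) auto

text \<open>Inversion rotates the sphere by a half turn about the real axis; it is therefore an isometry.
  It serves as the second chart, which carries a neighbourhood of \<open>0\<close> to one of infinity.\<close>

lemma stereo_sphere_inverse: "stereo (sphere_inverse x) = (cnj (fst (stereo x)), - snd (stereo x))"
proof (cases x)
  case (Fin z)
  show ?thesis
  proof (cases "z = 0")
    case False
    define r where "r = (cmod z)\<^sup>2"
    have r: "r > 0" using False by (simp add: r_def)
    have inv: "inverse z = inverse r *\<^sub>R cnj z"
      using False by (simp add: r_def complex_eq_iff cmod_power2 divide_inverse)
    have nrm: "(cmod (inverse z))\<^sup>2 = inverse r"
      by (simp add: r_def norm_inverse power_inverse)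
    have r': "1 + r \<noteq> 0" "1 + inverse r \<noteq> 0" "r \<noteq> 0"
      using r positive_imp_inverse_positive[OF r] by linarith+
    have e1: "2 / (1 + inverse r) * inverse r = 2 / (1 + r)"
      "(inverse r - 1) / (1 + inverse r) = - ((r - 1) / (1 + r))"
      using r' by (auto simp: divide_simps)
    have "stereo (sphere_inverse x) = ((2 / (1 + inverse r) * inverse r) *\<^sub>R cnj z, (inverse r - 1) / (1 + inverse r))"
      using False by (simp add: Fin nrm flip: inv del: inverse_eq_divide) (simp add: inv)
    then show ?thesis
      unfolding e1 Fin stereo.simps r_def[symmetric] by simp
  qed (simp add: Fin)
qed auto

lemma dist_sphere_inverse [simp]: "dist (sphere_inverse x) (sphere_inverse y) = dist x y"
proof -
  have "cnj a \<bullet> cnj b = a \<bullet> b" for a b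
    by (simp add: inner_complex_def)
  then have "stereo (sphere_inverse x) \<bullet> stereo (sphere_inverse y) = stereo x \<bullet> stereo y"
    unfolding stereo_sphere_inverse by (cases "stereo x"; cases "stereo y") (simp only: inner_Pair fst_conv snd_conv, simp)
  then show ?thesis by (simp only: dist_riemann_sphere_def)
qed

lemma tendsto_sphere_inverse_iff: "((\<lambda>x. sphere_inverse (f x)) \<longlongrightarrow> sphere_inverse l) F \<longleftrightarrow> (f \<longlongrightarrow> l) F"
  unfolding tendsto_dist_iff[of _ "sphere_inverse l"] tendsto_dist_iff[of _ l] by simp

lemma tendsto_sphere_inverse: "(f \<longlongrightarrow> l) F \<Longrightarrow> ((\<lambda>x. sphere_inverse (f x)) \<longlongrightarrow> sphere_inverse l) F"
  by (simp add: tendsto_sphere_inverse_iff)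

lemma tendsto_Infty:
  assumes "filterlim f at_infinity F" shows "((\<lambda>x. Fin (f x)) \<longlongrightarrow> Infty) F"
proof -
  have "((\<lambda>x. sphere_inverse (Fin (inverse (f x)))) \<longlongrightarrow> sphere_inverse (Fin 0)) F"
    by (intro tendsto_sphere_inverse tendsto_Fin filterlim_compose[OF tendsto_inverse_0 assms])
  moreover have "\<forall>\<^sub>F x in F. sphere_inverse (Fin (inverse (f x))) = Fin (f x)"
    using eventually_compose_filterlim[OF eventually_not_equal_at_infinity assms, of 0]
    by eventually_elim simp
  ultimately show ?thesis by (simp add: filterlim_cong)
qed

definition the_Fin :: "riemann_sphere \<Rightarrow> complex" where
  "the_Fin x = (case x of Fin z \<Rightarrow> z | Infty \<Rightarrow> 0)"

lemma the_Fin_Fin [simp]: "the_Fin (Fin z) = z" by (simp add: the_Fin_def)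

lemma Fin_the_Fin: "x \<noteq> Infty \<Longrightarrow> Fin (the_Fin x) = x" by (cases x) auto

lemma range_Fin: "range Fin = - {Infty}"
  by (auto simp: image_iff) (metis riemann_sphere.exhaust)

lemma the_Fin_stereo: "x \<noteq> Infty \<Longrightarrow> the_Fin x = fst (stereo x) /\<^sub>R (1 - snd (stereo x))"
proof (cases x)
  case (Fin z)
  define r where "r = (cmod z)\<^sup>2"
  have "1 + r > 0" by (simp add: r_def add_pos_nonneg)
  then have "2 / (1 + r) \<noteq> 0" "1 - (r - 1) / (1 + r) = 2 / (1 + r)" by (simp_all add: field_simps)
  then show ?thesis unfolding Fin stereo.simps fst_conv snd_conv r_def[symmetric] the_Fin_Fin scaleR_scaleR
    by (metis left_inverse scaleR_one)
qed simp

lemma snd_stereo_eq_1: "snd (stereo x) = 1 \<longleftrightarrow> x = Infty"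
proof (cases x)
  case (Fin z)
  have "1 + (cmod z)\<^sup>2 > 0" by (simp add: add_pos_nonneg)
  then show ?thesis by (simp add: Fin divide_eq_eq)
qed auto

lemma tendsto_the_Fin:
  assumes "(f \<longlongrightarrow> Fin z) F" shows "((\<lambda>x. the_Fin (f x)) \<longlongrightarrow> z) F"
proof -
  have st: "((\<lambda>x. stereo (f x)) \<longlongrightarrow> stereo (Fin z)) F" using assms by (simp only: tendsto_stereo_iff)
  have "((\<lambda>x. fst (stereo (f x)) /\<^sub>R (1 - snd (stereo (f x)))) \<longlongrightarrow> the_Fin (Fin z)) F"
    unfolding the_Fin_stereo[OF riemann_sphere.distinct(1)]
    by (intro tendsto_intros st) (use snd_stereo_eq_1[of "Fin z"] in auto)
  moreover have "\<forall>\<^sub>F x in F. f x \<noteq> Infty"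
    using tendsto_imp_eventually_ne[OF assms, of Infty] by simp
  then have "\<forall>\<^sub>F x in F. fst (stereo (f x)) /\<^sub>R (1 - snd (stereo (f x))) = the_Fin (f x)"
    by eventually_elim (simp add: the_Fin_stereo)
  ultimately show ?thesis by (simp add: filterlim_cong)
qed

text \<open>The two charts describe all neighbourhood filters, which reduces continuity and openness on the sphere to
  the plane.\<close>

lemma nhds_Fin: "nhds (Fin z) = filtermap Fin (nhds z)"
proof (rule antisym)
  have "\<forall>\<^sub>F x in nhds (Fin z). x \<noteq> Infty"
    by (rule tendsto_imp_eventually_ne[OF filterlim_ident]) simp
  then have ev: "\<forall>\<^sub>F x in nhds (Fin z). Fin (the_Fin x) = x"
    by eventually_elim (rule Fin_the_Fin)
  have lim: "filterlim the_Fin (nhds z) (nhds (Fin z))"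
    by (rule tendsto_the_Fin) (rule filterlim_ident)
  show "nhds (Fin z) \<le> filtermap Fin (nhds z)"
  proof (rule filter_leI)
    fix P assume "eventually P (filtermap Fin (nhds z))"
    then have "\<forall>\<^sub>F x in nhds (Fin z). P (Fin (the_Fin x))"
      unfolding eventually_filtermap by (rule eventually_compose_filterlim[OF _ lim])
    with ev show "eventually P (nhds (Fin z))" by eventually_elim simp
  qed
  show "filtermap Fin (nhds z) \<le> nhds (Fin z)"
    using tendsto_Fin[OF filterlim_ident] by (simp add: filterlim_def)
qed

lemma nhds_sphere_inverse: "nhds (sphere_inverse x) = filtermap sphere_inverse (nhds x)"
proof -
  have le: "filtermap sphere_inverse (nhds y) \<le> nhds (sphere_inverse y)" for y
    using tendsto_sphere_inverse[OF filterlim_ident] by (simp add: filterlim_def)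
  have "filtermap sphere_inverse (filtermap sphere_inverse (nhds (sphere_inverse x))) \<le> filtermap sphere_inverse (nhds x)"
    by (rule filtermap_mono) (use le[of "sphere_inverse x"] in simp)
  then show ?thesis using le[of x] by (simp add: filtermap_filtermap antisym)
qed

lemma nhds_Infty: "nhds Infty = filtermap (\<lambda>w. sphere_inverse (Fin w)) (nhds 0)"
  using nhds_sphere_inverse[of "Fin 0"] by (simp add: nhds_Fin filtermap_filtermap)

lemma open_sphere_iff:
  "open W \<longleftrightarrow> open {z. Fin z \<in> W} \<and> open {w. sphere_inverse (Fin w) \<in> W}"
proof -
  have "open W \<longleftrightarrow> (\<forall>x\<in>W. \<forall>\<^sub>F y in nhds x. y \<in> W)"
    by (metis eventually_nhds open_subopen subset_eq)
  also have "\<dots> \<longleftrightarrow> (\<forall>z. Fin z \<in> W \<longrightarrow> (\<forall>\<^sub>F w in nhds z. Fin w \<in> W)) \<and>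
      (\<forall>z. sphere_inverse (Fin z) \<in> W \<longrightarrow> (\<forall>\<^sub>F w in nhds z. sphere_inverse (Fin w) \<in> W))"
  proof safe
    fix z assume "\<forall>x\<in>W. \<forall>\<^sub>F y in nhds x. y \<in> W" "Fin z \<in> W"
    then show "\<forall>\<^sub>F w in nhds z. Fin w \<in> W" by (auto simp: nhds_Fin eventually_filtermap)
  next
    fix z assume "\<forall>x\<in>W. \<forall>\<^sub>F y in nhds x. y \<in> W" "sphere_inverse (Fin z) \<in> W"
    then show "\<forall>\<^sub>F w in nhds z. sphere_inverse (Fin w) \<in> W" 
      by (auto simp only: nhds_sphere_inverse nhds_Fin eventually_filtermap)
  next
    fix x assume "\<forall>z. Fin z \<in> W \<longrightarrow> (\<forall>\<^sub>F w in nhds z. Fin w \<in> W)"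
      "\<forall>z. sphere_inverse (Fin z) \<in> W \<longrightarrow> (\<forall>\<^sub>F w in nhds z. sphere_inverse (Fin w) \<in> W)" "x \<in> W"
    then show "\<forall>\<^sub>F y in nhds x. y \<in> W"
      by (cases x) (auto simp: nhds_Fin nhds_Infty eventually_filtermap dest!: spec[of _ 0])
  qed
  also have "\<dots> \<longleftrightarrow> open {z. Fin z \<in> W} \<and> open {w. sphere_inverse (Fin w) \<in> W}"
    by (simp add: eventually_nhds open_subopen[of "{z. _ z}"] subset_eq)
  finally show ?thesis .
qed

lemma open_Fin_image [simp]: "open (Fin ` A) \<longleftrightarrow> open A"
proof
  assume "open (Fin ` A)"
  then show "open A" by (simp add: open_sphere_iff image_iff)
next
  assume A: "open A"
  have "open (- {0} \<inter> inverse -` A)"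
    using A by (intro continuous_open_preimage continuous_intros) auto
  also have "- {0} \<inter> inverse -` A = {w. sphere_inverse (Fin w) \<in> Fin ` A}" by auto
  finally show "open (Fin ` A)" using A by (simp add: open_sphere_iff image_iff)
qed

lemma continuous_on_Fin [continuous_intros]: 
  "continuous_on A f \<Longrightarrow> continuous_on A (\<lambda>x. Fin (f x))"
  by (simp add: continuous_on_def tendsto_Fin)

lemma continuous_on_the_Fin: "continuous_on (- {Infty}) the_Fin"
  unfolding continuous_on_def
proof
  fix x assume "x \<in> - {Infty}"
  then obtain z where "x = Fin z" by (cases x) auto
  then show "(the_Fin \<longlongrightarrow> the_Fin x) (at x within - {Infty})"
    by (auto intro!: tendsto_the_Fin tendsto_ident_at)
qed

lemma continuous_on_sphere_inverse: "continuous_on A sphere_inverse"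
  by (auto simp: continuous_on_def intro: tendsto_sphere_inverse tendsto_ident_at)

text \<open>The two charts map the closed unit disc onto the two closed hemispheres.\<close>

lemma compact_UNIV_sphere: "compact (UNIV :: riemann_sphere set)"
proof -
  have c: "compact (Fin ` cball 0 1)"
    by (intro compact_continuous_image continuous_intros) auto
  then have "compact (Fin ` cball 0 1 \<union> sphere_inverse ` Fin ` cball 0 1)"
    by (intro compact_Un c compact_continuous_image[OF continuous_on_sphere_inverse])
  also have "Fin ` cball 0 1 \<union> sphere_inverse ` Fin ` cball 0 1 = UNIV"
  proof -
    have "x \<in> Fin ` cball 0 1 \<union> sphere_inverse ` Fin ` cball 0 1" for x
    proof (cases x)
      case (Fin z)
      show ?thesis
      proof (cases "cmod z \<le> 1")
        case False
        then have "x = sphere_inverse (Fin (inverse z))" "cmod (inverse z) \<le> 1" 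
          by (auto simp: Fin norm_inverse inverse_le_1_iff)
        then show ?thesis by (intro UnI2) (metis image_eqI mem_cball_0)
      qed (auto simp: Fin)
    next
      case Infty
      then have "x = sphere_inverse (Fin 0)" by simp
      then show ?thesis by (intro UnI2) (metis image_eqI mem_cball_0 norm_zero zero_le_one)
    qed
    then show ?thesis by auto
  qed
  finally show ?thesis .
qed

section \<open>Holomorphic maps into the sphere\<close>

text \<open>From here on the chart at infinity is kept folded unless its argument is known to be zero or nonzero.\<close>

declare sphere_inverse.simps(1) [simp del]

lemma sphere_inverse_Fin_0 [simp]: "sphere_inverse (Fin 0) = Infty" by (simp add: sphere_inverse.simps)

lemma sphere_inverse_Fin_nz [simp]: "z \<noteq> 0 \<Longrightarrow> sphere_inverse (Fin z) = Fin (inverse z)" by (simp add: sphere_inverse.simps)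

lemma continuous_onI_nhds:
  assumes "\<And>x. x \<in> A \<Longrightarrow> (f \<longlongrightarrow> f x) (nhds x)" shows "continuous_on A f"
  unfolding continuous_on_def
  unfolding at_within_def by (intro ballI tendsto_mono[OF inf_le1] assms)

fun sphere_affine :: "complex \<Rightarrow> complex \<Rightarrow> riemann_sphere \<Rightarrow> riemann_sphere" where
  "sphere_affine a b (Fin z) = Fin (a * z + b)"
| "sphere_affine a b Infty = Infty"

lemma sphere_affine_sphere_inverse:
  assumes "a + b * w \<noteq> 0" shows "sphere_affine a b (sphere_inverse (Fin w)) = sphere_inverse (Fin (w / (a + b * w)))"
  using assms by (cases "w = 0") (auto simp: field_simps)

lemma eventually_affine_ne_0: "a \<noteq> 0 \<Longrightarrow> \<forall>\<^sub>F w in nhds 0. a + b * w \<noteq> (0::complex)"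
proof (rule tendsto_imp_eventually_ne)
  show "((\<lambda>w. a + b * w) \<longlongrightarrow> a + b * 0) (nhds 0)"
    by (intro tendsto_intros filterlim_ident)
qed simp

lemma tendsto_sphere_affine:
  assumes "a \<noteq> 0" shows "(sphere_affine a b \<longlongrightarrow> sphere_affine a b x) (nhds x)"
proof (cases x)
  case (Fin z)
  show ?thesis 
    unfolding Fin nhds_Fin[of z] filterlim_filtermap sphere_affine.simps
    by (intro tendsto_Fin tendsto_intros filterlim_ident)
next
  case Infty
  have "((\<lambda>w. sphere_inverse (Fin (w / (a + b * w)))) \<longlongrightarrow> sphere_inverse (Fin (0 / (a + b * 0)))) (nhds 0)"
    by (intro tendsto_sphere_inverse tendsto_Fin tendsto_intros filterlim_ident) (use assms in auto)
  moreover have "\<forall>\<^sub>F w in nhds 0. sphere_inverse (Fin (w / (a + b * w))) = sphere_affine a b (sphere_inverse (Fin w))"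
    using eventually_affine_ne_0[OF assms, of b] by eventually_elim (rule sphere_affine_sphere_inverse[symmetric])
  ultimately show ?thesis
    unfolding Infty nhds_Infty filterlim_filtermap by (simp add: filterlim_cong)
qed

lemma continuous_on_sphere_affine: "a \<noteq> 0 \<Longrightarrow> continuous_on A (sphere_affine a b)"
  by (intro continuous_onI_nhds tendsto_sphere_affine)

text \<open>Near each point a holomorphic map into the sphere is read in one of the two charts. An analytic representative in
  the second chart vanishes exactly where the map takes the value infinity, so poles and regular points are
  treated alike, and so is the constant map with value infinity.\<close>

definition sphere_holomorphic_at :: "(complex \<Rightarrow> riemann_sphere) \<Rightarrow> complex \<Rightarrow> bool" where
  "sphere_holomorphic_at F z \<longleftrightarrow> (\<exists>g. g analytic_on {z} \<and>
     ((\<forall>\<^sub>F w in nhds z. F w = Fin (g w)) \<or> (\<forall>\<^sub>F w in nhds z. F w = sphere_inverse (Fin (g w)))))"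

lemma sphere_holomorphic_at_Fin: "g analytic_on {z} \<Longrightarrow> sphere_holomorphic_at (\<lambda>w. Fin (g w)) z"
  unfolding sphere_holomorphic_at_def by auto

lemma sphere_holomorphic_at_cong:
  assumes "\<forall>\<^sub>F w in nhds z. F w = G w" shows "sphere_holomorphic_at F z \<longleftrightarrow> sphere_holomorphic_at G z"
proof -
  have "(\<forall>\<^sub>F w in nhds z. F w = h w) \<longleftrightarrow> (\<forall>\<^sub>F w in nhds z. G w = h w)" for h
    by (intro eventually_cong) (use assms in \<open>auto elim: eventually_mono\<close>)
  then show ?thesis unfolding sphere_holomorphic_at_def by simp
qed

lemma sphere_holomorphic_at_transform:
  "sphere_holomorphic_at G z \<Longrightarrow> \<forall>\<^sub>F w in nhds z. F w = G w \<Longrightarrow> sphere_holomorphic_at F z"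
  using sphere_holomorphic_at_cong[of F G z] by simp

lemma sphere_holomorphic_at_sphere_inverse:
  assumes "sphere_holomorphic_at F z" shows "sphere_holomorphic_at (\<lambda>w. sphere_inverse (F w)) z"
proof -
  obtain g where g: "g analytic_on {z}"
    "(\<forall>\<^sub>F w in nhds z. F w = Fin (g w)) \<or> (\<forall>\<^sub>F w in nhds z. F w = sphere_inverse (Fin (g w)))"
    using assms unfolding sphere_holomorphic_at_def by blast
  from g(2) have "(\<forall>\<^sub>F w in nhds z. sphere_inverse (F w) = sphere_inverse (Fin (g w))) \<or> (\<forall>\<^sub>F w in nhds z. sphere_inverse (F w) = Fin (g w))"
    by (elim disj_forward eventually_mono) (simp_all)
  with g(1) show ?thesis unfolding sphere_holomorphic_at_def by blast
qed

lemma tendsto_nhds_analytic: "g analytic_on {z} \<Longrightarrow> (g \<longlongrightarrow> g z) (nhds z)"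
  by (simp add: tendsto_nhds_iff isContD analytic_at_imp_isCont)

lemma sphere_holomorphic_at_finiteE:
  assumes "sphere_holomorphic_at F z" "F z \<noteq> Infty"
  obtains g where "g analytic_on {z}" "\<forall>\<^sub>F w in nhds z. F w = Fin (g w)"
proof -
  obtain g where g: "g analytic_on {z}"
    "(\<forall>\<^sub>F w in nhds z. F w = Fin (g w)) \<or> (\<forall>\<^sub>F w in nhds z. F w = sphere_inverse (Fin (g w)))"
    using assms unfolding sphere_holomorphic_at_def by blast
  from g(2) show ?thesis
  proof
    assume ev: "\<forall>\<^sub>F w in nhds z. F w = sphere_inverse (Fin (g w))"
    then have "g z \<noteq> 0" using eventually_nhds_x_imp_x[OF ev] assms(2) by auto
    then have "\<forall>\<^sub>F w in nhds z. g w \<noteq> 0"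
      by (rule tendsto_imp_eventually_ne[OF tendsto_nhds_analytic[OF g(1)]])
    with ev have "\<forall>\<^sub>F w in nhds z. F w = Fin (inverse (g w))" by eventually_elim simp
    moreover have "(\<lambda>w. inverse (g w)) analytic_on {z}"
      using g(1) \<open>g z \<noteq> 0\<close> by (auto intro!: analytic_intros)
    ultimately show ?thesis using that by blast
  qed (use g(1) that in blast)
qed

lemma sphere_holomorphic_at_the_Fin:
  assumes "sphere_holomorphic_at F z" "F z \<noteq> Infty" shows "(\<lambda>w. the_Fin (F w)) analytic_on {z}"
proof -
  obtain g where g: "g analytic_on {z}" "\<forall>\<^sub>F w in nhds z. F w = Fin (g w)"
    using sphere_holomorphic_at_finiteE[OF assms] .
  have ev: "\<forall>\<^sub>F w in nhds z. the_Fin (F w) = g w" using g(2) by eventually_elim simp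
  show ?thesis by (rule iffD2[OF analytic_at_cong[OF ev refl] g(1)])
qed

lemma sphere_holomorphic_at_imp_tendsto:
  assumes "sphere_holomorphic_at F z" shows "(F \<longlongrightarrow> F z) (nhds z)"
proof -
  have *: "(F \<longlongrightarrow> F z) (nhds z)" if F: "sphere_holomorphic_at F z" "F z \<noteq> Infty" for F
  proof -
    obtain g where g: "g analytic_on {z}" "\<forall>\<^sub>F w in nhds z. F w = Fin (g w)"
      using sphere_holomorphic_at_finiteE[OF F] .
    have "((\<lambda>w. Fin (g w)) \<longlongrightarrow> Fin (g z)) (nhds z)"
      by (intro tendsto_Fin tendsto_nhds_analytic g)
    then show ?thesis using g(2) eventually_nhds_x_imp_x[OF g(2)] by (simp add: filterlim_cong)
  qed
  show ?thesis
  proof (cases "F z = Infty")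
    case True
    then have "((\<lambda>w. sphere_inverse (F w)) \<longlongrightarrow> sphere_inverse (F z)) (nhds z)"
      by (intro * sphere_holomorphic_at_sphere_inverse assms) simp
    then show ?thesis by (simp only: tendsto_sphere_inverse_iff)
  qed (use * assms in blast)
qed

lemma sphere_holomorphic_at_compose_analytic:
  assumes "g analytic_on {z}" "sphere_holomorphic_at G (g z)" shows "sphere_holomorphic_at (\<lambda>w. G (g w)) z"
proof -
  obtain k where k: "k analytic_on {g z}"
    "(\<forall>\<^sub>F w in nhds (g z). G w = Fin (k w)) \<or> (\<forall>\<^sub>F w in nhds (g z). G w = sphere_inverse (Fin (k w)))"
    using assms unfolding sphere_holomorphic_at_def by blast
  have "(\<lambda>w. k (g w)) analytic_on {z}"
    using analytic_on_compose[OF assms(1), of k] k(1) by (simp add: o_def)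
  moreover have "(\<forall>\<^sub>F w in nhds z. G (g w) = Fin (k (g w))) \<or> (\<forall>\<^sub>F w in nhds z. G (g w) = sphere_inverse (Fin (k (g w))))"
    using k(2) eventually_compose_filterlim[OF _ tendsto_nhds_analytic[OF assms(1)]] by fast
  ultimately show ?thesis unfolding sphere_holomorphic_at_def by blast
qed

lemma sphere_holomorphic_at_compose:
  assumes F: "sphere_holomorphic_at F z"
    and fin: "\<And>w. F z = Fin w \<Longrightarrow> sphere_holomorphic_at (\<lambda>w. S (Fin w)) w"
    and inf: "F z = Infty \<Longrightarrow> sphere_holomorphic_at (\<lambda>w. S (sphere_inverse (Fin w))) 0"
  shows "sphere_holomorphic_at (\<lambda>w. S (F w)) z"
proof (cases "F z = Infty")
  case False
  then obtain g where g: "g analytic_on {z}" "\<forall>\<^sub>F w in nhds z. F w = Fin (g w)"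
    using sphere_holomorphic_at_finiteE[OF F] by blast
  then have "sphere_holomorphic_at (\<lambda>w. S (Fin (g w))) z"
    using sphere_holomorphic_at_compose_analytic[where G = "\<lambda>w. S (Fin w)", OF g(1) fin] eventually_nhds_x_imp_x[OF g(2)] by simp
  moreover have "\<forall>\<^sub>F w in nhds z. S (F w) = S (Fin (g w))" using g(2) by eventually_elim simp
  ultimately show ?thesis by (rule sphere_holomorphic_at_transform)
next
  case True
  then have "sphere_inverse (F z) \<noteq> Infty" by simp
  then obtain g where g: "g analytic_on {z}" "\<forall>\<^sub>F w in nhds z. sphere_inverse (F w) = Fin (g w)"
    using sphere_holomorphic_at_finiteE[OF sphere_holomorphic_at_sphere_inverse[OF F]] by blast
  then have "g z = 0" using eventually_nhds_x_imp_x[OF g(2)] True by simp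
  with g have "sphere_holomorphic_at (\<lambda>w. S (sphere_inverse (Fin (g w)))) z"
    using sphere_holomorphic_at_compose_analytic[where G = "\<lambda>w. S (sphere_inverse (Fin w))", OF g(1)] inf[OF True] by simp
  moreover have "\<forall>\<^sub>F w in nhds z. S (F w) = S (sphere_inverse (Fin (g w)))" 
    using g(2) by eventually_elim (metis sphere_inverse_sphere_inverse)
  ultimately show ?thesis by (rule sphere_holomorphic_at_transform)
qed

lemma sphere_holomorphic_at_sphere_affine:
  assumes "sphere_holomorphic_at F z" "a \<noteq> 0" shows "sphere_holomorphic_at (\<lambda>w. sphere_affine a b (F w)) z"
proof (rule sphere_holomorphic_at_compose[OF assms(1)])
  show "sphere_holomorphic_at (\<lambda>w. sphere_affine a b (Fin w)) w" for w
    unfolding sphere_affine.simps by (intro sphere_holomorphic_at_Fin analytic_intros)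
  have *: "sphere_holomorphic_at (\<lambda>w. sphere_inverse (Fin (w / (a + b * w)))) 0"
    by (intro sphere_holomorphic_at_sphere_inverse sphere_holomorphic_at_Fin analytic_intros) (use assms in auto)
  have ev: "\<forall>\<^sub>F w in nhds 0. sphere_affine a b (sphere_inverse (Fin w)) = sphere_inverse (Fin (w / (a + b * w)))"
    using eventually_affine_ne_0[OF assms(2), of b] by eventually_elim (rule sphere_affine_sphere_inverse)
  show "sphere_holomorphic_at (\<lambda>w. sphere_affine a b (sphere_inverse (Fin w))) 0" by (rule sphere_holomorphic_at_transform[OF * ev])
qed

text \<open>An isolated singularity that is not essential is removable in one of the two charts: the first if the limit is finite,
  the second if it is infinite.\<close>

lemma sphere_holomorphic_at_meromorphic:
  assumes R: "R meromorphic_on {z}" and ev: "\<forall>\<^sub>F w in at z. F w = Fin (R w)"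
    and lim: "(F \<longlongrightarrow> F z) (at z)"
  shows "sphere_holomorphic_at F z"
proof -
  have iso: "isolated_singularity_at R z" and ne: "not_essential R z"
    using R by (auto simp: meromorphic_at_iff)
  have lim': "((\<lambda>w. Fin (R w)) \<longlongrightarrow> F z) (at z)" using lim ev by (simp add: filterlim_cong)
  from ne consider c where "R \<midarrow>z\<rightarrow> c" | "is_pole R z" unfolding not_essential_def by blast
  then show ?thesis
  proof cases
    case 1
    define R' where "R' = (\<lambda>y. if y = z then c else R y)"
    have "R' analytic_on {z}" unfolding R'_def by (rule removable_singularity'[OF iso 1])
    moreover have "F z = Fin c"
      using tendsto_unique[OF _ lim' tendsto_Fin[OF 1]] by simp
    then have "\<forall>\<^sub>F w in nhds z. F w = Fin (R' w)"
      unfolding eventually_nhds_conv_at using ev by (auto simp: R'_def elim: eventually_mono)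
    ultimately show ?thesis unfolding sphere_holomorphic_at_def by blast
  next
    case 2
    define R' where "R' = (\<lambda>y. if y = z then 0 else inverse (R y))"
    have lim0: "(\<lambda>w. inverse (R w)) \<midarrow>z\<rightarrow> 0"
      using 2 unfolding is_pole_def by (rule filterlim_compose[OF tendsto_inverse_0])
    have "R' analytic_on {z}" unfolding R'_def
      by (rule removable_singularity'[OF isolated_singularity_at_inverse[OF iso ne] lim0])
    have Fz: "F z = Infty"
      using tendsto_unique[OF _ lim' tendsto_Infty] 2 by (simp add: is_pole_def)
    have nz: "\<forall>\<^sub>F w in at z. R w \<noteq> 0"
      using 2 unfolding is_pole_def by (rule eventually_compose_filterlim[OF eventually_not_equal_at_infinity])
    have "\<forall>\<^sub>F w in at z. F w = sphere_inverse (Fin (R' w))"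
      using ev nz eventually_neq_at_within[of z z UNIV] by eventually_elim (simp add: R'_def)
    then have "\<forall>\<^sub>F w in nhds z. F w = sphere_inverse (Fin (R' w))"
      unfolding eventually_nhds_conv_at using Fz by (simp add: R'_def)
    with \<open>R' analytic_on {z}\<close> show ?thesis unfolding sphere_holomorphic_at_def by blast
  qed
qed

lemma sphere_holomorphic_at_ballE:
  assumes "sphere_holomorphic_at F z" "open V" "z \<in> V"
  obtains r g \<phi> where "r > 0" "ball z r \<subseteq> V" "g holomorphic_on ball z r" "\<phi> = id \<or> \<phi> = sphere_inverse"
    "\<And>w. w \<in> ball z r \<Longrightarrow> F w = \<phi> (Fin (g w))"
proof -
  obtain g where g: "g analytic_on {z}"
    "(\<forall>\<^sub>F w in nhds z. F w = id (Fin (g w))) \<or> (\<forall>\<^sub>F w in nhds z. F w = sphere_inverse (Fin (g w)))"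
    using assms(1) unfolding sphere_holomorphic_at_def id_apply by blast
  then obtain \<phi> where \<phi>: "\<phi> = id \<or> \<phi> = sphere_inverse" "\<forall>\<^sub>F w in nhds z. F w = \<phi> (Fin (g w))"
    by blast
  obtain e where e: "e > 0" "g holomorphic_on ball z e" using g(1) unfolding analytic_on_def by auto
  have "\<forall>\<^sub>F w in nhds z. F w = \<phi> (Fin (g w)) \<and> w \<in> V"
    using \<phi>(2) eventually_nhds_in_open[OF assms(2,3)] by eventually_elim simp
  then obtain d where d: "d > 0" "\<And>w. dist w z < d \<Longrightarrow> F w = \<phi> (Fin (g w)) \<and> w \<in> V"
    unfolding eventually_nhds_metric by blast
  show ?thesis
  proof (rule that[of "min d e" g \<phi>])
    show "g holomorphic_on ball z (min d e)" using e(2) by (rule holomorphic_on_subset) auto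
  qed (use d e \<phi> in \<open>auto simp: dist_commute\<close>)
qed

lemma sphere_inverse_eq_iff: "sphere_inverse x = sphere_inverse y \<longleftrightarrow> x = y"
  by (metis sphere_inverse_sphere_inverse)

lemma inj_chart: "\<phi> = id \<or> \<phi> = sphere_inverse \<Longrightarrow> \<phi> (Fin z) = \<phi> (Fin w) \<longleftrightarrow> z = w"
  by (auto simp: sphere_inverse_eq_iff)

text \<open>The set of points near which \<open>F\<close> is constantly \<open>c\<close> is open, and by the identity theorem in a chart so is its
  complement in \<open>V\<close>.\<close>

lemma sphere_holomorphic_identity:
  assumes V: "open V" "connected V" and F: "\<And>z. z \<in> V \<Longrightarrow> sphere_holomorphic_at F z"
    and z0: "z0 \<in> V" "\<forall>\<^sub>F w in nhds z0. F w = c" and z: "z \<in> V"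
  shows "F z = c"
proof -
  define A where "A = {z \<in> V. \<forall>\<^sub>F w in nhds z. F w = c}"
  have "open A"
    unfolding open_subopen[of A]
  proof
    fix x assume "x \<in> A"
    then have "\<forall>\<^sub>F y in nhds x. y \<in> A"
      using eventually_eventually[of "\<lambda>w. F w = c" x] eventually_nhds_in_open[OF V(1), of x] 
      by (auto simp: A_def elim: eventually_elim2)
    then show "\<exists>T. open T \<and> x \<in> T \<and> T \<subseteq> A" by (auto simp: eventually_nhds)
  qed
  moreover have "open (V - A)"
    unfolding open_subopen[of "V - A"]
  proof
    fix x assume x: "x \<in> V - A"
    obtain r g \<phi> where r: "r > 0" "ball x r \<subseteq> V" "g holomorphic_on ball x r" "\<phi> = id \<or> \<phi> = sphere_inverse"
      "\<And>w. w \<in> ball x r \<Longrightarrow> F w = \<phi> (Fin (g w))"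
      using sphere_holomorphic_at_ballE[OF F V(1)] x by (metis DiffD1)
    have "ball x r \<inter> A = {}"
    proof (rule ccontr)
      assume "ball x r \<inter> A \<noteq> {}"
      then obtain y where y: "y \<in> ball x r" "\<forall>\<^sub>F w in nhds y. F w = c" by (auto simp: A_def)
      then obtain T where T: "open T" "y \<in> T" "\<And>w. w \<in> T \<Longrightarrow> F w = c" unfolding eventually_nhds by blast
      have c: "c = \<phi> (Fin (g y))" using T(3)[OF T(2)] r(5)[OF y(1)] by simp
      have "g w = g y" if "w \<in> ball x r" for w
      proof (rule analytic_continuation_open[of "T \<inter> ball x r" "ball x r" g "\<lambda>_. g y"])
        show "g v = g y" if "v \<in> T \<inter> ball x r" for v
          using T(3)[of v] r(5)[of v] that c inj_chart[OF r(4)] by auto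
      qed (use T y r that in auto)
      then have "F w = c" if "w \<in> ball x r" for w using that r(5) c by simp
      then have "\<forall>\<^sub>F w in nhds x. F w = c"
        using eventually_nhds_in_open[of "ball x r" x] r(1) by (auto elim: eventually_mono)
      then show False using x by (simp add: A_def)
    qed
    then show "\<exists>T. open T \<and> x \<in> T \<and> T \<subseteq> V - A" using r(1,2) by (intro exI[of _ "ball x r"]) auto
  qed
  ultimately have "V - A = {} \<or> A = {}"
    using connectedD[OF V(2), of A "V - A"] by (auto simp: A_def)
  moreover have "z0 \<in> A" using z0 by (simp add: A_def)
  ultimately have "z \<in> A" using z by auto
  then show ?thesis by (auto simp: A_def dest: eventually_nhds_x_imp_x)
qed

lemma open_sphere_inverse_image: "open A \<Longrightarrow> open (sphere_inverse ` A)"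
proof -
  assume "open A"
  then have "open (sphere_inverse -` A)" by (intro open_vimage continuous_on_sphere_inverse)
  also have "sphere_inverse -` A = sphere_inverse ` A" by (auto simp: image_iff) (metis sphere_inverse_sphere_inverse)
  finally show ?thesis .
qed

text \<open>The identity theorem rules out that the chart representative is constant, so the classical open mapping theorem
  applies to it.\<close>

lemma sphere_holomorphic_open_mapping:
  assumes V: "open V" "connected V" and F: "\<And>z. z \<in> V \<Longrightarrow> sphere_holomorphic_at F z"
    and nc: "\<not> F constant_on V" and B: "open B" "B \<subseteq> V"
  shows "open (F ` B)"
proof (subst open_subopen, intro ballI)
  fix y assume "y \<in> F ` B"
  then obtain z where z: "z \<in> B" and y: "y = F z" by blast
  obtain r g \<phi> where r: "r > 0" "ball z r \<subseteq> B" "g holomorphic_on ball z r" "\<phi> = id \<or> \<phi> = sphere_inverse"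
      "\<And>w. w \<in> ball z r \<Longrightarrow> F w = \<phi> (Fin (g w))"
    using sphere_holomorphic_at_ballE[OF F[OF subsetD[OF B(2) z]] B(1) z] by blast
  have "\<not> g constant_on ball z r"
  proof
    assume "g constant_on ball z r"
    then obtain k where "\<And>w. w \<in> ball z r \<Longrightarrow> F w = \<phi> (Fin k)" unfolding constant_on_def using r(5) by auto
    then have "\<forall>\<^sub>F w in nhds z. F w = \<phi> (Fin k)"
      using eventually_nhds_in_open[of "ball z r" z] r(1) by (auto elim: eventually_mono)
    then have "\<And>w. w \<in> V \<Longrightarrow> F w = \<phi> (Fin k)" using sphere_holomorphic_identity[OF V F] z B(2) by blast
    then show False using nc by (auto simp: constant_on_def)
  qed
  then have "open (g ` ball z r)" by (intro open_mapping_thm[OF r(3)]) auto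
  then have "open (\<phi> ` Fin ` g ` ball z r)" using r(4) by (auto intro: open_sphere_inverse_image)
  moreover have "\<phi> ` Fin ` g ` ball z r = F ` ball z r" 
    unfolding image_image by (intro image_cong refl) (simp add: r(5))
  ultimately show "\<exists>T. open T \<and> y \<in> T \<and> T \<subseteq> F ` B"
    unfolding y using r(1,2) by (intro exI[of _ "F ` ball z r"]) auto
qed

section \<open>Montel's theorem for maps into the sphere\<close>

lemma sphere_affine_sphere_affine: "sphere_affine a b (sphere_affine a' b' x) = sphere_affine (a * a') (a * b' + b) x"
  by (cases x) (auto simp: algebra_simps)

lemma sphere_affine_1_0 [simp]: "sphere_affine 1 0 x = x"
  by (cases x) auto

text \<open>Here \<open>\<mu>\<close> is the Moebius transformation taking the three given points to \<open>0\<close>, \<open>1\<close> and infinity, built from an inversion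
  between two affine maps, and \<open>\<nu>\<close> is its inverse.\<close>

lemma moebius_normalisation:
  assumes "a \<noteq> c" "b \<noteq> c" "a \<noteq> (b::complex)"
  obtains \<mu> \<nu> where "continuous_on UNIV \<nu>" "\<And>x. \<nu> (\<mu> x) = x"
    "\<mu> (Fin a) = Fin 0" "\<mu> (Fin b) = Fin 1" "\<mu> (Fin c) = Infty"
    "\<And>F z. sphere_holomorphic_at F z \<Longrightarrow> sphere_holomorphic_at (\<lambda>w. \<mu> (F w)) z"
proof -
  define u v where "u = inverse (a - c)" and "v = inverse (b - c)"
  have uv: "v - u \<noteq> 0" using assms by (auto simp: u_def v_def)
  define \<mu> where "\<mu> x = sphere_affine (1 / (v - u)) (- u / (v - u)) (sphere_inverse (sphere_affine 1 (- c) x))" for x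
  define \<nu> where "\<nu> y = sphere_affine 1 c (sphere_inverse (sphere_affine (v - u) u y))" for y
  show ?thesis
  proof (rule that[of \<nu> \<mu>])
    have "continuous_on UNIV (sphere_affine 1 c \<circ> (sphere_inverse \<circ> sphere_affine (v - u) u))"
      by (intro continuous_on_compose continuous_on_sphere_affine continuous_on_sphere_inverse) (use uv in auto)
    then show "continuous_on UNIV \<nu>" by (simp add: o_def \<nu>_def[abs_def])
    show "\<nu> (\<mu> x) = x" for x
      using uv by (simp add: \<nu>_def \<mu>_def sphere_affine_sphere_affine)
    show "\<mu> (Fin a) = Fin 0" "\<mu> (Fin b) = Fin 1" "\<mu> (Fin c) = Infty"
      using uv assms by (auto simp: \<mu>_def u_def v_def divide_simps)
    show "sphere_holomorphic_at (\<lambda>w. \<mu> (F w)) z" if "sphere_holomorphic_at F z" for F z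
      unfolding \<mu>_def by (intro sphere_holomorphic_at_sphere_affine sphere_holomorphic_at_sphere_inverse that) (use uv in auto)
  qed
qed

text \<open>The limit function is bounded on a compact set, so eventually all values stay in a compact disc, on which
  \<open>\<phi>\<close> after the finite chart is uniformly continuous.\<close>

lemma uniform_limit_compose_Fin:
  assumes \<phi>: "continuous_on UNIV \<phi>" and K: "compact K" and g: "continuous_on K g"
    and lim: "uniform_limit K k g sequentially"
  shows "uniform_limit K (\<lambda>n z. \<phi> (Fin (k n z))) (\<lambda>z. \<phi> (Fin (g z))) sequentially"
proof -
  obtain B where B: "\<And>z. z \<in> K \<Longrightarrow> norm (g z) \<le> B"
    using compact_imp_bounded[OF compact_continuous_image[OF g K]] unfolding bounded_iff by auto
  have "continuous_on (cball 0 (B + 1)) (\<phi> \<circ> (\<lambda>z. Fin z))"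
    by (intro continuous_on_compose continuous_on_Fin continuous_on_subset[OF \<phi>] continuous_on_id) auto
  then have uc: "uniformly_continuous_on (cball 0 (B + 1)) (\<lambda>z. \<phi> (Fin z))"
    unfolding o_def by (intro compact_uniformly_continuous) auto
  have "\<forall>\<^sub>F n in sequentially. \<forall>z\<in>K. dist (k n z) (g z) < 1"
    using lim by (intro uniform_limitD) auto
  then have ev: "\<forall>\<^sub>F n in sequentially. k n ` K \<subseteq> cball 0 (B + 1)"
  proof eventually_elim
    case (elim n)
    have "norm (k n z) \<le> B + 1" if "z \<in> K" for z
      using elim that B[OF that] norm_triangle_ineq2[of "k n z" "g z"] by (fastforce simp: dist_norm)
    then show ?case by auto
  qed
  have "g ` K \<subseteq> cball 0 (B + 1)" using B by fastforce
  from uniform_limit_compose[OF lim uc ev this] show ?thesis by (simp add: o_def)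
qed

text \<open>Schottky's theorem propagates a bound at one point to all compact subsets; the elementary theorem of Montel for
  locally bounded families then applies.\<close>

lemma Montel_omitting_0_1_bounded_at:
  assumes S: "open S" "connected S" "w \<in> S" and hol: "\<And>n::nat. k n holomorphic_on S"
    and omit: "\<And>n z. z \<in> S \<Longrightarrow> k n z \<noteq> 0 \<and> k n z \<noteq> 1"
    and inf: "infinite {n. norm (k n w) \<le> 1}"
  obtains r g where "strict_mono (r :: nat \<Rightarrow> nat)" "g holomorphic_on S"
    "\<And>K. compact K \<Longrightarrow> K \<subseteq> S \<Longrightarrow> uniform_limit K (k \<circ> r) g sequentially"
proof -
  obtain r :: "nat \<Rightarrow> nat" where r: "strict_mono r" "\<And>n. norm (k (r n) w) \<le> 1"
    using infinite_enumerate[OF inf] unfolding mem_Collect_eq by blast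
  obtain g s where g: "g holomorphic_on S" "strict_mono (s :: nat \<Rightarrow> nat)"
    "\<And>K. compact K \<Longrightarrow> K \<subseteq> S \<Longrightarrow> uniform_limit K ((k \<circ> r) \<circ> s) g sequentially"
  proof (rule Montel[of S "range (k \<circ> r)" "k \<circ> r"])
    fix K assume K: "compact K" "K \<subseteq> S"
    obtain B where "\<And>h z. h \<in> range (k \<circ> r) \<Longrightarrow> z \<in> K \<Longrightarrow> norm (h z) \<le> B"
    proof (rule GPicard3[of S w "range (k \<circ> r)" "range (k \<circ> r)" K])
      show "h holomorphic_on S" if "h \<in> range (k \<circ> r)" for h using that hol by auto
      show "h z \<noteq> 0 \<and> h z \<noteq> 1" if "h \<in> range (k \<circ> r)" "z \<in> S" for h z using that omit by auto
      show "norm (h w) \<le> 1" if "h \<in> range (k \<circ> r)" for h using that r(2) by auto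
    qed (use S K in auto)
    then show "\<exists>B. \<forall>h\<in>range (k \<circ> r). \<forall>z\<in>K. norm (h z) \<le> B" by blast
  qed (use S hol in auto)
  show ?thesis
    by (rule that[of "r \<circ> s" g]) (use r g in \<open>auto simp: strict_mono_o o_assoc\<close>)
qed

text \<open>After normalising the omitted values to \<open>0\<close>, \<open>1\<close> and infinity, infinitely many of the functions or infinitely many of
  their reciprocals are bounded by \<open>1\<close> at a base point. Since the reciprocals omit the same values, both cases are
  covered by the preceding lemma, and the limit is transported back to the sphere.\<close>

theorem sphere_Montel:
  assumes V: "open V" "connected V" and F: "\<And>n z. z \<in> V \<Longrightarrow> sphere_holomorphic_at (F n) z"
    and abc: "a \<noteq> c" "b \<noteq> c" "a \<noteq> (b::complex)"
    and omit: "\<And>n z. z \<in> V \<Longrightarrow> F n z \<noteq> Fin a \<and> F n z \<noteq> Fin b \<and> F n z \<noteq> Fin c"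
  shows "\<exists>r l. strict_mono (r :: nat \<Rightarrow> nat) \<and>
    (\<forall>K. compact K \<longrightarrow> K \<subseteq> V \<longrightarrow> uniform_limit K (F \<circ> r) l sequentially)"
proof (cases "V = {}")
  case True
  then show ?thesis by (intro exI[of _ id] exI[of _ undefined]) (auto simp: strict_mono_id)
next
  case False
  then obtain w where w: "w \<in> V" by auto
  obtain \<nu> \<mu> where \<nu>: "continuous_on UNIV \<nu>" and \<nu>\<mu>: "\<And>x. \<nu> (\<mu> x) = x"
    and \<mu>: "\<mu> (Fin a) = Fin 0" "\<mu> (Fin b) = Fin 1" "\<mu> (Fin c) = Infty"
    and hol\<mu>: "\<And>F z. sphere_holomorphic_at F z \<Longrightarrow> sphere_holomorphic_at (\<lambda>w. \<mu> (F w)) z"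
    by (rule moebius_normalisation[OF abc]) (rule that)
  define h where "h n z = the_Fin (\<mu> (F n z))" for n z
  have ne: "\<mu> (F n z) \<noteq> Fin 0 \<and> \<mu> (F n z) \<noteq> Fin 1 \<and> \<mu> (F n z) \<noteq> Infty" if "z \<in> V" for n z
    using omit[OF that, of n] \<mu> \<nu>\<mu> by metis
  have h: "\<mu> (F n z) = Fin (h n z)" if "z \<in> V" for n z
    using ne[OF that] by (simp add: h_def Fin_the_Fin)
  have holh: "h n holomorphic_on V" for n
  proof -
    have "h n analytic_on {z}" if "z \<in> V" for z
      unfolding h_def by (intro sphere_holomorphic_at_the_Fin hol\<mu> F that) (use ne that in auto)
    then show ?thesis by (intro analytic_imp_holomorphic) (use analytic_on_analytic_at in blast)
  qed
  have h01: "h n z \<noteq> 0 \<and> h n z \<noteq> 1" if "z \<in> V" for n z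
    using ne[OF that, of n] h[OF that, of n] by auto
  have "infinite ({n. norm (h n w) \<le> 1} \<union> {n. norm (inverse (h n w)) \<le> 1})"
  proof -
    have "norm (h n w) \<le> 1 \<or> norm (inverse (h n w)) \<le> 1" for n
      using h01[OF w, of n] by (cases "norm (h n w) \<le> 1") (auto simp: norm_inverse inverse_le_1_iff)
    then have "{n. norm (h n w) \<le> 1} \<union> {n. norm (inverse (h n w)) \<le> 1} = UNIV" by auto
    then show ?thesis by simp
  qed
  then consider "infinite {n. norm (h n w) \<le> 1}" | "infinite {n. norm (inverse (h n w)) \<le> 1}" by auto
  then show ?thesis
  proof cases
    case 1
    obtain r g where r: "strict_mono (r :: nat \<Rightarrow> nat)" and g: "g holomorphic_on V"
      "\<And>K. compact K \<Longrightarrow> K \<subseteq> V \<Longrightarrow> uniform_limit K (h \<circ> r) g sequentially"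
      using Montel_omitting_0_1_bounded_at[OF V w holh h01 1] by blast
    have "uniform_limit K (F \<circ> r) (\<lambda>z. \<nu> (Fin (g z))) sequentially" if K: "compact K" "K \<subseteq> V" for K
    proof -
      have "uniform_limit K (\<lambda>n z. \<nu> (Fin ((h \<circ> r) n z))) (\<lambda>z. \<nu> (Fin (g z))) sequentially"
        by (intro uniform_limit_compose_Fin \<nu> K g continuous_on_subset[OF holomorphic_on_imp_continuous_on[OF g(1)]])
      moreover have "\<nu> (Fin ((h \<circ> r) n z)) = (F \<circ> r) n z" if "z \<in> K" for n z
        using h[of z "r n"] \<nu>\<mu>[of "F (r n) z"] K(2) that by (auto simp flip: h)
      ultimately show ?thesis by (subst (asm) uniform_limit_cong') auto
    qed
    then show ?thesis using r by blast
  next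
    case 2
    obtain r g where r: "strict_mono (r :: nat \<Rightarrow> nat)" and g: "g holomorphic_on V"
      "\<And>K. compact K \<Longrightarrow> K \<subseteq> V \<Longrightarrow> uniform_limit K ((\<lambda>n z. inverse (h n z)) \<circ> r) g sequentially"
    proof (rule Montel_omitting_0_1_bounded_at[of V w "\<lambda>n z. inverse (h n z)", OF V w _ _ 2])
      show "(\<lambda>z. inverse (h n z)) holomorphic_on V" for n
        by (intro holomorphic_intros holh) (use h01 in auto)
      show "inverse (h n z) \<noteq> 0 \<and> inverse (h n z) \<noteq> 1" if "z \<in> V" for n z
        using h01[OF that, of n] by simp
    qed blast
    have cont: "continuous_on UNIV (\<lambda>x. \<nu> (sphere_inverse x))"
      using continuous_on_compose[OF continuous_on_sphere_inverse[of UNIV], of \<nu>] \<nu> continuous_on_subset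
      by (auto simp: o_def)
    have "uniform_limit K (F \<circ> r) (\<lambda>z. \<nu> (sphere_inverse (Fin (g z)))) sequentially" if K: "compact K" "K \<subseteq> V" for K
    proof -
      have "uniform_limit K (\<lambda>n z. \<nu> (sphere_inverse (Fin (((\<lambda>n z. inverse (h n z)) \<circ> r) n z)))) (\<lambda>z. \<nu> (sphere_inverse (Fin (g z)))) sequentially"
        by (intro uniform_limit_compose_Fin[OF cont] K g continuous_on_subset[OF holomorphic_on_imp_continuous_on[OF g(1)]])
      moreover have "\<nu> (sphere_inverse (Fin (((\<lambda>n z. inverse (h n z)) \<circ> r) n z))) = (F \<circ> r) n z" if "z \<in> K" for n z
        using h[of z "r n"] \<nu>\<mu>[of "F (r n) z"] h01[of z "r n"] K(2) that by (auto simp flip: h)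
      ultimately show ?thesis by (subst (asm) uniform_limit_cong') auto
    qed
    then show ?thesis using r by blast
  qed
qed

section \<open>Rational functions and the behaviour near infinity\<close>

lemma norm_poly_le_power:
  fixes Q :: "complex poly"
  shows "\<exists>C\<ge>0. \<forall>z. norm z \<ge> 1 \<longrightarrow> norm (poly Q z) \<le> C * norm z ^ degree Q"
proof (intro exI[of _ "\<Sum>i\<le>degree Q. norm (coeff Q i)"] conjI allI impI)
  fix z :: complex assume z: "norm z \<ge> 1"
  have "norm (poly Q z) \<le> (\<Sum>i\<le>degree Q. norm (coeff Q i * z ^ i))"
    unfolding poly_altdef by (rule norm_sum)
  also have "\<dots> \<le> (\<Sum>i\<le>degree Q. norm (coeff Q i) * norm z ^ degree Q)"
    using z by (intro sum_mono) (auto simp: norm_mult norm_power intro!: mult_left_mono power_increasing)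
  finally show "norm (poly Q z) \<le> (\<Sum>i\<le>degree Q. norm (coeff Q i)) * norm z ^ degree Q"
    by (simp add: sum_distrib_right)
qed (auto intro: sum_nonneg)

text \<open>The poles lie in a compact disc, so there are finitely many. Multiplying by a polynomial \<open>Q\<close> removes them and leaves an
  entire function of polynomial growth, which is a polynomial by Liouville's theorem.\<close>

lemma rational_if_bounded_at_infinity:
  assumes h: "h nicely_meromorphic_on UNIV" and bnd: "\<And>z. norm z > \<rho> \<Longrightarrow> norm (h z) \<le> B"
  obtains P Q where "Q \<noteq> 0" "\<And>z. poly Q z \<noteq> 0 \<Longrightarrow> h z = poly P z / poly Q z"
proof -
  define X where "X = {z. is_pole h z}"
  have mero: "h meromorphic_on {z}" for z
    using h by (auto simp: nicely_meromorphic_on_def intro: meromorphic_on_subset)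
  have iso: "isolated_singularity_at h z" for z
    using mero by (simp add: meromorphic_at_iff)
  have ana: "h analytic_on {z}" if "z \<notin> X" for z
    using nicely_meromorphic_on_imp_analytic_at[OF h] that by (simp add: X_def)
  have nlim: "\<not> z islimpt X" for z
    unfolding X_def by (rule not_islimpt_poles[OF iso])
  have Xsub: "X \<subseteq> cball 0 \<rho>"
  proof
    fix p assume p: "p \<in> X"
    show "p \<in> cball 0 \<rho>"
    proof (rule ccontr)
      assume "p \<notin> cball 0 \<rho>"
      then have "open (- cball (0::complex) \<rho>)" "p \<in> - cball 0 \<rho>" by auto
      then have "\<forall>\<^sub>F w in at p. w \<in> - cball 0 \<rho>" by (rule eventually_at_in_open')
      moreover have "\<forall>\<^sub>F w in at p. norm (h w) > B"
        using p unfolding X_def is_pole_def mem_Collect_eq filterlim_at_infinity_conv_norm_at_top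
        by (auto simp: filterlim_at_top_dense)
      ultimately have "\<forall>\<^sub>F w in at p. False"
        by eventually_elim (use bnd in \<open>force simp: not_le\<close>)
      then show False by simp
    qed
  qed
  have fin: "finite X"
    using finite_not_islimpt_in_compact[OF compact_cball[of 0 \<rho>], of X] nlim Xsub by (simp add: Int_absorb1)
  have "\<exists>n>0. (\<lambda>w. (w - p) ^ n * h w) \<in> O[at p](\<lambda>_. 1)" if p: "p \<in> X" for p
  proof -
    have pole: "is_pole h p" using p by (simp add: X_def)
    have opn: "open (- (X - {p}))" using fin by (intro open_Compl finite_imp_closed) simp
    have "h holomorphic_on - (X - {p}) - {p}"
      by (intro analytic_imp_holomorphic) (subst analytic_on_analytic_at, use ana in auto)
    from zorder_exist_pole[OF this opn _ pole] obtain r where r: "zorder h p < 0" "r > 0"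
      "zor_poly h p holomorphic_on cball p r"
      "\<And>w. w \<in> cball p r - {p} \<Longrightarrow> h w = zor_poly h p w / (w - p) ^ nat (- zorder h p)"
      by auto
    define n where "n = nat (- zorder h p)"
    have ev: "\<forall>\<^sub>F w in at p. w \<in> ball p r - {p}" using r by (intro eventually_at_in_open) auto
    have "zor_poly h p \<midarrow>p\<rightarrow> zor_poly h p p"
      using continuous_on_interior[OF holomorphic_on_imp_continuous_on[OF r(3)], of p] r(2)
      by (simp add: isCont_def)
    then have "zor_poly h p \<in> O[at p](\<lambda>_. 1)"
      by (intro bigoI_tendsto) auto
    moreover have ev': "\<forall>\<^sub>F w in at p. (w - p) ^ n * h w = zor_poly h p w"
      using ev
    proof eventually_elim
      case (elim w)
      then show ?case using r(4)[of w] by (simp add: n_def)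
    qed
    ultimately have "(\<lambda>w. (w - p) ^ n * h w) \<in> O[at p](\<lambda>_. 1)"
      unfolding landau_o.big.in_cong[OF ev'] by blast
    then show ?thesis using r(1) by (intro exI[of _ n]) (auto simp: n_def)
  qed
  then obtain n where n: "\<And>p. p \<in> X \<Longrightarrow> n p > (0::nat)"
    "\<And>p. p \<in> X \<Longrightarrow> (\<lambda>w. (w - p) ^ n p * h w) \<in> O[at p](\<lambda>_. 1)" by metis
  define Q where "Q = (\<Prod>p\<in>X. [:- p, 1:] ^ n p)"
  have Q: "poly Q z = (\<Prod>p\<in>X. (z - p) ^ n p)" for z
    by (simp add: Q_def poly_prod)
  have Q0: "Q \<noteq> 0" unfolding Q_def using fin by (simp add: prod_zero_iff)
  have QX: "poly Q z = 0" if "z \<in> X" for z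
    unfolding Q using that fin n(1)[OF that] by (auto simp: prod_zero_iff)
  obtain e where e: "e holomorphic_on UNIV" "\<And>z. z \<notin> X \<Longrightarrow> e z = poly Q z * h z"
  proof -
    have "\<exists>e. e holomorphic_on UNIV \<and> (\<forall>z\<in>UNIV - X. e z = poly Q z * h z)"
    proof (rule removable_singularities[OF fin])
      show "(\<lambda>z. poly Q z * h z) holomorphic_on UNIV - X"
        by (intro holomorphic_intros analytic_imp_holomorphic) (subst analytic_on_analytic_at, use ana in auto)
      fix p assume p: "p \<in> X"
      have "((\<lambda>z. \<Prod>q\<in>X-{p}. (z - q) ^ n q) \<longlongrightarrow> (\<Prod>q\<in>X-{p}. (p - q) ^ n q)) (at p)"
        by (intro tendsto_intros)
      then have "(\<lambda>z. \<Prod>q\<in>X-{p}. (z - q) ^ n q) \<in> O[at p](\<lambda>_. 1)"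
        by (intro bigoI_tendsto) auto
      from landau_o.big.mult[OF this n(2)[OF p]]
      show "(\<lambda>z. poly Q z * h z) \<in> O[at p](\<lambda>_. 1)"
        unfolding Q prod.remove[OF fin p] by (simp add: mult_ac)
    qed auto
    then show ?thesis using that by auto
  qed
  obtain C where C: "C \<ge> 0" "\<And>z. norm z \<ge> 1 \<Longrightarrow> norm (poly Q z) \<le> C * norm z ^ degree Q"
    using norm_poly_le_power[of Q] by blast
  have grow: "norm (e z) \<le> C * B * norm z ^ degree Q" if "max 1 (\<rho> + 1) \<le> norm z" for z
  proof -
    have "z \<notin> X" using Xsub that by auto
    then have "norm (e z) = norm (poly Q z) * norm (h z)" by (simp add: e(2) norm_mult)
    also have "\<dots> \<le> (C * norm z ^ degree Q) * B"
      using C bnd[of z] that by (intro mult_mono) auto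
    finally show ?thesis by (simp add: mult_ac)
  qed
  define P where "P = (\<Sum>k\<le>degree Q. monom ((deriv ^^ k) e 0 / fact k) k)"
  have P: "e z = poly P z" for z
    using Liouville_polynomial[where A = "max 1 (\<rho> + 1)" and \<xi> = z, OF e(1) grow] by (simp add: P_def poly_sum poly_monom)
  show ?thesis
  proof (rule that[OF Q0])
    fix z assume z: "poly Q z \<noteq> 0"
    then have "z \<notin> X" using QX by blast
    then have "poly P z = poly Q z * h z" using e(2) P by simp
    then show "h z = poly P z / poly Q z" using z by simp
  qed
qed

text \<open>If \<open>g\<close> stays away from \<open>a\<close> near infinity, then \<open>1/(g - a)\<close> is bounded there, hence rational, and so is \<open>g\<close>.\<close>

lemma rational_if_omits_disc_near_infinity:
  assumes g: "g nicely_meromorphic_on UNIV" and \<epsilon>: "\<epsilon> > 0"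
    and avoid: "\<And>z. norm z > \<rho> \<Longrightarrow> \<not> is_pole g z \<Longrightarrow> \<epsilon> \<le> norm (g z - a)"
  obtains P Q where "Q \<noteq> 0" "\<And>z. poly Q z \<noteq> 0 \<Longrightarrow> \<not> is_pole g z \<and> g z = poly P z / poly Q z"
proof -
  define k where "k z = inverse (g z - a)" for z
  define h where "h = remove_sings k"
  have mg: "g meromorphic_on {z}" for z
    using g by (auto simp: nicely_meromorphic_on_def intro: meromorphic_on_subset)
  have mk: "k meromorphic_on UNIV"
    unfolding k_def by (intro meromorphic_intros) (use g in \<open>auto simp: nicely_meromorphic_on_def\<close>)
  have isok: "isolated_singularity_at k z" for z
    using meromorphic_on_subset[OF mk, of "{z}"] by (simp add: meromorphic_at_iff)
  have h: "h nicely_meromorphic_on UNIV"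
    unfolding h_def by (rule remove_sings_nicely_meromorphic[OF mk])
  have hk: "\<forall>\<^sub>F w in at z. h w = k w" for z
    unfolding h_def by (rule eventually_remove_sings_eq_at[OF isok])
  have far: "\<forall>\<^sub>F w in at z. norm w > \<rho> \<and> \<epsilon> \<le> norm (g w - a)" if "norm z > \<rho>" for z
  proof -
    have "open (- cball (0::complex) \<rho>)" "z \<in> - cball 0 \<rho>" using that by auto
    then have "\<forall>\<^sub>F w in at z. w \<in> - cball 0 \<rho>" by (rule eventually_at_in_open')
    moreover have "\<forall>\<^sub>F w in at z. \<not> is_pole g w"
      using mg[of z] by (intro eventually_not_pole) (simp add: meromorphic_at_iff)
    ultimately show ?thesis by eventually_elim (use avoid in auto)
  qed
  have bnd: "norm (h z) \<le> 1 / \<epsilon>" if "norm z > \<rho>" for z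
  proof -
    have ev: "\<forall>\<^sub>F w in at z. norm (h w) \<le> 1 / \<epsilon>"
      using hk[of z] far[OF that]
    proof eventually_elim
      case (elim w)
      have "norm (h w) = inverse (norm (g w - a))" using elim(1) by (simp add: k_def norm_inverse)
      also have "\<dots> \<le> inverse \<epsilon>" by (rule le_imp_inverse_le) (use elim(2) \<epsilon> in auto)
      also have "\<dots> = 1 / \<epsilon>" by (rule inverse_eq_divide)
      finally show ?case .
    qed
    have "\<not> is_pole h z"
    proof
      assume "is_pole h z"
      then have "\<forall>\<^sub>F w in at z. norm (h w) > 1 / \<epsilon>"
        unfolding is_pole_def filterlim_at_infinity_conv_norm_at_top
        by (auto simp: filterlim_at_top_dense)
      with ev have "\<forall>\<^sub>F w in at z. False" by eventually_elim simp
      then show False by simp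
    qed
    then have "h \<midarrow>z\<rightarrow> h z" using h by (auto simp: nicely_meromorphic_on_def)
    then have "((\<lambda>w. norm (h w)) \<longlongrightarrow> norm (h z)) (at z)" by (rule tendsto_norm)
    then show ?thesis using ev by (rule tendsto_upperbound) simp
  qed
  obtain P Q where PQ: "Q \<noteq> 0" "\<And>z. poly Q z \<noteq> 0 \<Longrightarrow> h z = poly P z / poly Q z"
    by (rule rational_if_bounded_at_infinity[OF h bnd]) (assumption, rule that)
  have evnz: "\<forall>\<^sub>F w in at z. poly R w \<noteq> 0" if "R \<noteq> 0" for R :: "complex poly" and z
    using poly_roots_finite[OF that] islimpt_finite[of "{w. poly R w = 0}" z]
    by (simp add: islimpt_iff_eventually)
  \<comment> \<open>Otherwise \<open>g\<close> would be equal to \<open>a\<close> near a point at which it keeps the distance \<open>\<epsilon>\<close> from \<open>a\<close>.\<close>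
  have P0: "P \<noteq> 0"
  proof
    assume "P = 0"
    define z where "z = complex_of_real (\<bar>\<rho>\<bar> + 1)"
    have z: "norm z > \<rho>" by (simp add: z_def del: of_real_add)
    have "\<forall>\<^sub>F w in at z. False"
      using hk[of z] far[OF z] evnz[OF PQ(1), of z]
    proof eventually_elim
      case (elim w)
      then have "inverse (g w - a) = 0" using PQ(2)[of w] \<open>P = 0\<close> by (simp add: k_def)
      then show False using elim \<epsilon> by simp
    qed
    then show False by simp
  qed
  \<comment> \<open>The factor \<open>Q\<close> in the denominator excludes the points at which \<open>1/(g - a) = P/Q\<close> has no meaning.\<close>
  show ?thesis
  proof (rule that[of "P * Q" "(smult a P + Q) * Q"])
    show "P * Q \<noteq> 0" using P0 PQ(1) by simp
    fix z assume "poly (P * Q) z \<noteq> 0"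
    then have z: "poly P z \<noteq> 0" "poly Q z \<noteq> 0" by simp_all
    define L where "L = a + poly Q z / poly P z"
    have "((\<lambda>w. a + poly Q w / poly P w) \<longlongrightarrow> L) (at z)"
      unfolding L_def by (intro tendsto_intros z)
    moreover have ev: "\<forall>\<^sub>F w in at z. a + poly Q w / poly P w = g w"
      using hk[of z] evnz[OF PQ(1), of z] evnz[OF P0, of z]
    proof eventually_elim
      case (elim w)
      then have "inverse (g w - a) = poly P w / poly Q w" using PQ(2)[of w] by (simp add: k_def)
      then have "g w - a = poly Q w / poly P w" by (metis inverse_divide inverse_inverse_eq)
      then show ?case by (simp add: algebra_simps)
    qed
    ultimately have lim: "g \<midarrow>z\<rightarrow> L" by (simp add: filterlim_cong)
    then have np: "\<not> is_pole g z"
      unfolding is_pole_def using not_tendsto_and_filterlim_at_infinity[of "at z" g L] by auto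
    then have "g \<midarrow>z\<rightarrow> g z" using g by (auto simp: nicely_meromorphic_on_def)
    then have "g z = L" using lim LIM_unique by blast
    then show "\<not> is_pole g z \<and> g z = poly ((smult a P + Q) * Q) z / poly (P * Q) z"
      using np z by (simp add: L_def add_divide_distrib)
  qed
qed

section \<open>The map of the sphere induced by a meromorphic function\<close>

lemma meromorphic_map_sphere_holomorphic:
  assumes "meromorphic_map f" shows "sphere_holomorphic_at f z"
proof -
  obtain g where g: "g nicely_meromorphic_on UNIV" 
    and f: "\<And>z. f z = (if is_pole g z then Infty else Fin (g z))"
    using assms unfolding meromorphic_map_def by metis
  have mg: "g meromorphic_on {z}"
    using g by (auto simp: nicely_meromorphic_on_def intro: meromorphic_on_subset)
  have ev: "\<forall>\<^sub>F w in at z. f w = Fin (g w)"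
    using eventually_not_pole[of g z] mg by (auto simp: meromorphic_at_iff f elim: eventually_mono)
  have "((\<lambda>w. Fin (g w)) \<longlongrightarrow> f z) (at z)"
  proof (cases "is_pole g z")
    case True
    then show ?thesis using tendsto_Infty[of g "at z"] by (simp add: f is_pole_def)
  next
    case False
    then have "g \<midarrow>z\<rightarrow> g z" using g by (auto simp: nicely_meromorphic_on_def)
    then show ?thesis using False by (simp add: f tendsto_Fin)
  qed
  then have "(f \<longlongrightarrow> f z) (at z)" using ev by (simp add: filterlim_cong)
  then show ?thesis by (rule sphere_holomorphic_at_meromorphic[OF mg ev])
qed

lemma sphere_map_Fin [simp]: "sphere_map f (Fin z) = f z"
  by (simp add: sphere_map_def)

lemma at_infinity_filtermap: "(at_infinity :: complex filter) = filtermap inverse (at 0)"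
  unfolding at_to_infinity filtermap_filtermap by (simp add: filtermap_ident)

lemma at_infinity_neq_bot: "(at_infinity :: complex filter) \<noteq> bot"
  by (simp add: at_infinity_filtermap filtermap_bot_iff)

text \<open>In the chart at infinity a rational function is again a quotient of polynomials in \<open>1/w\<close>, so its singularity at \<open>0\<close>
  is not essential. The limit on the sphere then exists and is the value that the map has at infinity.\<close>

lemma rational_map_sphere_holomorphic_Infty:
  assumes "rational_map f" shows "sphere_holomorphic_at (\<lambda>w. sphere_map f (sphere_inverse (Fin w))) 0"
proof -
  obtain p q where q: "q \<noteq> 0" and pq: "\<And>z. poly q z \<noteq> 0 \<Longrightarrow> f z = Fin (poly p z / poly q z)"
    using assms unfolding rational_map_def by blast
  define R where "R w = poly p (inverse w) / poly q (inverse w)" for w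
  have mR: "R meromorphic_on {0}"
    unfolding R_def poly_altdef by (intro meromorphic_intros)
  have "\<forall>\<^sub>F z in at_infinity. poly q z \<noteq> 0"
  proof -
    have "bounded {z. poly q z = 0}" by (intro finite_imp_bounded poly_roots_finite q)
    then obtain B where B: "\<And>z. poly q z = 0 \<Longrightarrow> norm z \<le> B" unfolding bounded_iff by auto
    then show ?thesis unfolding eventually_at_infinity by (intro exI[of _ "B + 1"]) force
  qed
  then have "\<forall>\<^sub>F w in at (0::complex). poly q (inverse w) \<noteq> 0"
    by (simp add: at_infinity_filtermap eventually_filtermap)
  then have ev: "\<forall>\<^sub>F w in at 0. f (inverse w) = Fin (R w)"
    by eventually_elim (simp add: pq R_def)
  have "\<exists>L. ((\<lambda>w. Fin (R w)) \<longlongrightarrow> L) (at 0)"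
    using mR tendsto_Infty[of R "at 0"] tendsto_Fin[of R _ "at 0"]
    unfolding meromorphic_at_iff not_essential_def is_pole_def by blast
  then obtain L where L: "((\<lambda>w. Fin (R w)) \<longlongrightarrow> L) (at 0)" by blast
  then have "((\<lambda>w. f (inverse w)) \<longlongrightarrow> L) (at 0)" using ev by (simp add: filterlim_cong)
  then have "(f \<longlongrightarrow> L) at_infinity" by (simp add: at_infinity_filtermap filterlim_filtermap)
  then have SI: "sphere_map f Infty = L"
    using assms tendsto_Lim[OF at_infinity_neq_bot, of f L] by (simp add: sphere_map_def)
  have ev': "\<forall>\<^sub>F w in at 0. sphere_map f (sphere_inverse (Fin w)) = Fin (R w)"
    using ev eventually_neq_at_within[of 0 0 UNIV] by eventually_elim simp
  show ?thesis
  proof (rule sphere_holomorphic_at_meromorphic[OF mR ev'])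
    show "((\<lambda>w. sphere_map f (sphere_inverse (Fin w))) \<longlongrightarrow> sphere_map f (sphere_inverse (Fin 0))) (at 0)"
      using L ev' SI by (simp add: filterlim_cong)
  qed
qed

lemma map_domain_Infty: "Infty \<in> map_domain f \<longleftrightarrow> rational_map f"
  by (auto simp: map_domain_def range_Fin)

lemma sphere_map_sphere_holomorphic:
  assumes "meromorphic_map f" "sphere_holomorphic_at F z" "F z \<in> map_domain f"
  shows "sphere_holomorphic_at (\<lambda>w. sphere_map f (F w)) z"
proof (rule sphere_holomorphic_at_compose[OF assms(2)])
  show "sphere_holomorphic_at (\<lambda>w. sphere_map f (Fin w)) w" for w
    using meromorphic_map_sphere_holomorphic[OF assms(1)] by simp
  show "sphere_holomorphic_at (\<lambda>w. sphere_map f (sphere_inverse (Fin w))) 0" if "F z = Infty"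
    using that assms(3) by (intro rational_map_sphere_holomorphic_Infty) (simp add: map_domain_Infty)
qed

lemma tendsto_sphere_map:
  assumes f: "meromorphic_map f" and x: "x \<in> map_domain f"
  shows "(sphere_map f \<longlongrightarrow> sphere_map f x) (nhds x)"
proof (cases x)
  case (Fin z)
  show ?thesis
    unfolding Fin nhds_Fin[of z] filterlim_filtermap
    using sphere_holomorphic_at_imp_tendsto[OF meromorphic_map_sphere_holomorphic[OF f, of z]] by simp
next
  case Infty
  then have "rational_map f" using x by (simp add: map_domain_Infty)
  from sphere_holomorphic_at_imp_tendsto[OF rational_map_sphere_holomorphic_Infty[OF this]]
  show ?thesis
    unfolding Infty nhds_Infty filterlim_filtermap by simp
qed

lemma continuous_on_sphere_map:
  assumes "meromorphic_map f" "A \<subseteq> map_domain f" shows "continuous_on A (sphere_map f)"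
  by (intro continuous_onI_nhds tendsto_sphere_map) (use assms in auto)

text \<open>An open set is covered by its parts in the two charts; the second one is needed only if the set contains infinity, and
  then the map is rational.\<close>

lemma open_sphere_map_image:
  assumes f: "meromorphic_map f" and nc: "\<not> f constant_on UNIV"
    and W: "open W" "W \<subseteq> map_domain f"
  shows "open (sphere_map f ` W)"
proof -
  have op: "open {z. Fin z \<in> W}" "open {w. sphere_inverse (Fin w) \<in> W}" using W(1) by (simp_all add: open_sphere_iff)
  have o1: "open (f ` {z. Fin z \<in> W})"
    by (rule sphere_holomorphic_open_mapping[OF open_UNIV connected_UNIV meromorphic_map_sphere_holomorphic[OF f] nc op(1)]) simp
  show ?thesis
  proof (cases "Infty \<in> W")
    case False
    then have "W = Fin ` {z. Fin z \<in> W}"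
    proof (intro equalityI subsetI)
      fix x assume "x \<in> W"
      then show "x \<in> Fin ` {z. Fin z \<in> W}" using False by (cases x) auto
    qed auto
    then have "sphere_map f ` W = f ` {z. Fin z \<in> W}"
      by (metis (no_types, lifting) image_cong image_image sphere_map_Fin)
    then show ?thesis using o1 by simp
  next
    case True
    then have rat: "rational_map f" using W(2) by (auto simp flip: map_domain_Infty)
    define T where "T w = sphere_map f (sphere_inverse (Fin w))" for w
    have T: "sphere_holomorphic_at T w" for w
      unfolding T_def
      by (intro sphere_map_sphere_holomorphic f sphere_holomorphic_at_sphere_inverse sphere_holomorphic_at_Fin analytic_intros) (simp add: map_domain_def rat)
    have "\<not> T constant_on UNIV"
    proof
      assume "T constant_on UNIV"
      then obtain c where c: "\<And>w. T w = c" by (auto simp: constant_on_def)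
      have "f z = c" if "z \<noteq> 0" for z using c[of "inverse z"] that by (simp add: T_def)
      moreover have "\<forall>\<^sub>F w in nhds 1. w \<in> - {0 :: complex}" by (rule eventually_nhds_in_open) auto
      ultimately have "\<forall>\<^sub>F w in nhds 1. f w = c" by (auto elim: eventually_mono)
      then have "f z = c" for z
        using sphere_holomorphic_identity[OF open_UNIV connected_UNIV meromorphic_map_sphere_holomorphic[OF f]] by blast
      then show False using nc by (auto simp: constant_on_def)
    qed
    then have o2: "open (T ` {w. sphere_inverse (Fin w) \<in> W})"
      by (intro sphere_holomorphic_open_mapping[OF open_UNIV connected_UNIV T _ op(2) subset_UNIV])
    have "sphere_map f ` W = f ` {z. Fin z \<in> W} \<union> T ` {w. sphere_inverse (Fin w) \<in> W}"
    proof (intro equalityI subsetI)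
      fix y assume "y \<in> sphere_map f ` W"
      then obtain x where x: "x \<in> W" "y = sphere_map f x" by blast
      show "y \<in> f ` {z. Fin z \<in> W} \<union> T ` {w. sphere_inverse (Fin w) \<in> W}"
      proof (cases x)
        case Infty
        then have "y = T 0" "sphere_inverse (Fin 0) \<in> W" using x by (auto simp: T_def)
        then show ?thesis by blast
      qed (use x in auto)
    next
      fix y assume "y \<in> f ` {z. Fin z \<in> W} \<union> T ` {w. sphere_inverse (Fin w) \<in> W}"
      then show "y \<in> sphere_map f ` W"
        unfolding T_def by (auto intro: rev_image_eqI[of "Fin _"])
    qed
    then show ?thesis using o1 o2 by auto
  qed
qed

text \<open>This is the theorem of Casorati and Weierstrass for a meromorphic function whose poles may accumulate at
  infinity.\<close>

lemma transcendental_dense_near_infinity: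
  assumes f: "meromorphic_map f" "\<not> rational_map f" and B: "open B" "B \<noteq> {}"
  shows "\<exists>z. norm z > \<rho> \<and> f z \<in> Fin ` B"
proof (rule ccontr)
  assume "\<nexists>z. norm z > \<rho> \<and> f z \<in> Fin ` B"
  then have no: "\<And>z. norm z > \<rho> \<Longrightarrow> f z \<notin> Fin ` B" by blast
  obtain g where g: "g nicely_meromorphic_on UNIV" 
    and fg: "\<And>z. f z = (if is_pole g z then Infty else Fin (g z))"
    using f(1) unfolding meromorphic_map_def by metis
  obtain a \<epsilon> where a: "\<epsilon> > 0" "ball a \<epsilon> \<subseteq> B" using B openE by blast
  have "\<epsilon> \<le> norm (g z - a)" if "norm z > \<rho>" "\<not> is_pole g z" for z
  proof -
    have "g z \<notin> B" using no[OF that(1)] that(2) fg by auto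
    then have "g z \<notin> ball a \<epsilon>" using a(2) by blast
    then show ?thesis by (simp add: dist_norm norm_minus_commute not_less)
  qed
  then show False
  proof (rule rational_if_omits_disc_near_infinity[OF g a(1)])
    fix P Q :: "complex poly"
    assume Q: "Q \<noteq> 0" and PQ: "\<And>z. poly Q z \<noteq> 0 \<Longrightarrow> \<not> is_pole g z \<and> g z = poly P z / poly Q z"
    have "\<forall>z. poly Q z \<noteq> 0 \<longrightarrow> f z = Fin (poly P z / poly Q z)" using PQ by (simp add: fg)
    then have "rational_map f" unfolding rational_map_def using f(1) Q by blast
    then show False using f(2) by simp
  qed
qed

section \<open>Invariance of the Fatou set\<close>

lemma fatou_setE:
  assumes "x \<in> fatou_set f"
  obtains W where "open W" "x \<in> W" "W \<subseteq> map_domain f" "\<And>y. y \<in> W \<Longrightarrow> all_iterates_defined f y"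
    "normal_family_on W (range (\<lambda>n. sphere_map f ^^ n))"
proof -
  obtain W where W: "open W" "x \<in> W" "\<forall>y\<in>W. all_iterates_defined f y"
    "normal_family_on W (range (\<lambda>n. sphere_map f ^^ n))"
    using assms unfolding fatou_set_def by blast
  moreover have "W \<subseteq> map_domain f"
  proof
    fix y assume "y \<in> W"
    then have "(sphere_map f ^^ 0) y \<in> map_domain f" using W(3) unfolding all_iterates_defined_def by blast
    then show "y \<in> map_domain f" by simp
  qed
  ultimately show ?thesis using that by blast
qed

lemma fatou_setI:
  assumes "open W" "\<And>y. y \<in> W \<Longrightarrow> all_iterates_defined f y"
    "normal_family_on W (range (\<lambda>n. sphere_map f ^^ n))"
  shows "W \<subseteq> fatou_set f"
  using assms unfolding fatou_set_def by blast

lemma open_fatou_set: "open (fatou_set f)"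
  unfolding fatou_set_def by (intro open_Union) auto

text \<open>Normality at \<open>f x\<close> is obtained from normality at \<open>x\<close> applied to the iterates with one more step. On the image of a compact
  ball \<open>B\<close> uniform convergence is checked by choosing, for every point, a preimage in \<open>B\<close>.\<close>

lemma fatou_set_forward_invariant:
  assumes f: "meromorphic_map f" "\<not> f constant_on UNIV" and x: "x \<in> fatou_set f"
  shows "sphere_map f x \<in> fatou_set f"
proof -
  let ?S = "sphere_map f"
  obtain W where W: "open W" "x \<in> W" "W \<subseteq> map_domain f"
    "\<And>y. y \<in> W \<Longrightarrow> all_iterates_defined f y" "normal_family_on W (range (\<lambda>n. ?S ^^ n))"
    by (rule fatou_setE[OF x]) (rule that)
  obtain e where e: "e > 0" "cball x e \<subseteq> W" using open_contains_cball W(1,2) by blast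
  have comp: "compact (cball x e)"
    using closed_Int_compact[OF closed_cball compact_UNIV_sphere] by simp
  have bW: "ball x e \<subseteq> W" using e(2) by (meson ball_subset_cball order_trans)
  have "?S ` ball x e \<subseteq> fatou_set f"
  proof (rule fatou_setI)
    show "open (?S ` ball x e)"
      by (rule open_sphere_map_image[OF f]) (use bW W(3) in auto)
    show "all_iterates_defined f y" if y: "y \<in> ?S ` ball x e" for y
      unfolding all_iterates_defined_def
    proof
      fix n
      obtain x' where x': "x' \<in> W" "y = ?S x'" using y bW by blast
      have "(?S ^^ Suc n) x' \<in> map_domain f" using W(4)[OF x'(1)] unfolding all_iterates_defined_def by blast
      then show "(?S ^^ n) y \<in> map_domain f" by (simp add: x'(2) funpow_swap1)
    qed
    show "normal_family_on (?S ` ball x e) (range (\<lambda>n. ?S ^^ n))"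
      unfolding normal_family_on_def
    proof (intro allI impI)
      fix h :: "nat \<Rightarrow> riemann_sphere \<Rightarrow> riemann_sphere"
      assume "range h \<subseteq> range (\<lambda>n. ?S ^^ n)"
      then have "\<forall>i. \<exists>k. h i = ?S ^^ k" by blast
      from choice[OF this] obtain k where "\<forall>i. h i = ?S ^^ k i" ..
      then have k: "h i = ?S ^^ k i" for i by (rule spec)
      define h' where "h' i = ?S ^^ Suc (k i)" for i
      have "h' i \<in> range (\<lambda>n. ?S ^^ n)" for i unfolding h'_def by (rule rangeI)
      then have "range h' \<subseteq> range (\<lambda>n. ?S ^^ n)" by (rule image_subsetI)
      from W(5)[unfolded normal_family_on_def, THEN spec, THEN mp, OF this]
      obtain r l where r: "strict_mono (r :: nat \<Rightarrow> nat)"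
        and l0: "\<forall>K. compact K \<longrightarrow> K \<subseteq> W \<longrightarrow> uniform_limit K (h' \<circ> r) l sequentially"
        by (elim exE conjE) (rule that)
      have l: "uniform_limit K (h' \<circ> r) l sequentially" if "compact K" "K \<subseteq> W" for K
        using l0 that by simp
      define s where "s y = (SOME x'. x' \<in> cball x e \<and> ?S x' = y)" for y
      have s: "s y \<in> cball x e \<and> ?S (s y) = y" if "y \<in> ?S ` ball x e" for y
        unfolding s_def by (rule someI_ex) (use that ball_subset_cball[of x e] in blast)
      have "uniform_limit K (h \<circ> r) (\<lambda>y. l (s y)) sequentially" if K: "K \<subseteq> ?S ` ball x e" for K
      proof -
        have "uniform_limit K (\<lambda>n y. (h' \<circ> r) n (s y)) (\<lambda>y. l (s y)) sequentially"
          by (rule uniform_limit_compose'[OF l[OF comp e(2)]]) (use s K in blast)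
        moreover have "(h' \<circ> r) n (s y) = (h \<circ> r) n y" if "y \<in> K" for n y
          using s[of y] that K by (auto simp: h'_def k funpow_swap1)
        ultimately show ?thesis by (subst (asm) uniform_limit_cong') auto
      qed
      with r show "\<exists>r l. strict_mono r \<and> (\<forall>K. compact K \<longrightarrow> K \<subseteq> ?S ` ball x e \<longrightarrow> uniform_limit K (h \<circ> r) l sequentially)"
        by blast
    qed
  qed
  then show ?thesis using e(1) by auto
qed

lemma funpow_fatou_set:
  assumes f: "meromorphic_map f" "\<not> f constant_on UNIV" and x: "x \<in> fatou_set f"
  shows "(sphere_map f ^^ n) x \<in> fatou_set f"
  using x by (induction n) (auto intro: fatou_set_forward_invariant[OF f])

lemma fatou_set_subset_map_domain: "fatou_set f \<subseteq> map_domain f"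
proof
  fix x assume "x \<in> fatou_set f"
  then show "x \<in> map_domain f" by (rule fatou_setE) auto
qed

text \<open>A small disc around a frontier point in the Fatou set would be connected, meet the component and thus be part of it.\<close>

lemma fatou_component_frontier:
  assumes U: "open U" and comp: "fatou_component f (Fin ` U)" and b: "b \<in> frontier U"
  shows "Fin b \<notin> fatou_set f"
proof
  assume "Fin b \<in> fatou_set f"
  moreover have "open {z. Fin z \<in> fatou_set f}" using open_fatou_set[of f] by (simp add: open_sphere_iff)
  ultimately obtain r where r: "r > 0" "ball b r \<subseteq> {z. Fin z \<in> fatou_set f}"
    by (meson mem_Collect_eq openE)
  have "ball b r \<inter> U \<noteq> {}"
  proof -
    have "b \<in> ball b r \<inter> closure U" using b r(1) by (simp add: frontier_def)
    then show ?thesis using open_Int_closure_eq_empty[OF open_ball, of b r U] by blast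
  qed
  then have "Fin ` ball b r \<subseteq> Fin ` U"
    using comp r(2) unfolding fatou_component_def
    by (intro components_maximal[of "Fin ` U" "fatou_set f"] connected_continuous_image continuous_on_Fin) auto
  moreover have "Fin b \<in> Fin ` ball b r" using r(1) by simp
  ultimately have "Fin b \<in> Fin ` U" by (rule subsetD)
  then have "b \<in> U" by auto
  then show False using b U by (simp add: frontier_def interior_open)
qed

lemma finite_imp_normal_family:
  assumes "finite \<F>" shows "normal_family_on W \<F>"
  unfolding normal_family_on_def
proof (intro allI impI)
  fix h :: "nat \<Rightarrow> 'a \<Rightarrow> 'b" assume "range h \<subseteq> \<F>"
  then have "finite (range h)" using assms finite_subset by blast
  then obtain a where a: "infinite {i. h i = h a}"
    using pigeonhole_infinite[of "UNIV :: nat set" h] by auto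
  obtain r :: "nat \<Rightarrow> nat" where r: "strict_mono r" "\<And>n. h (r n) = h a"
    using infinite_enumerate[OF a] unfolding mem_Collect_eq by blast
  then have "h \<circ> r = (\<lambda>_. h a)" by auto
  then show "\<exists>r l. strict_mono r \<and> (\<forall>K. compact K \<longrightarrow> K \<subseteq> W \<longrightarrow> uniform_limit K (h \<circ> r) l sequentially)"
    using r(1) by (intro exI[of _ r] exI[of _ "h a"]) (simp add: uniform_limit_const)
qed

text \<open>Only two maps occur as iterates, the identity and the constant itself.\<close>

lemma fatou_set_constant:
  assumes f: "meromorphic_map f" "f constant_on UNIV" shows "fatou_set f = UNIV"
proof -
  obtain g where g: "g nicely_meromorphic_on UNIV" 
    and fg: "\<And>z. f z = (if is_pole g z then Infty else Fin (g z))"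
    using f(1) unfolding meromorphic_map_def by metis
  obtain c where c: "\<And>z. f z = c" using f(2) unfolding constant_on_def by auto
  have "g meromorphic_on {0}"
    using g by (auto simp: nicely_meromorphic_on_def intro: meromorphic_on_subset)
  then have "\<forall>\<^sub>F w in at 0. \<not> is_pole g w" by (intro eventually_not_pole) (simp add: meromorphic_at_iff)
  then have "\<exists>w. \<not> is_pole g w" using eventually_happens'[of "at (0::complex)"] by auto
  then obtain c' where c': "c = Fin c'" using fg c by metis
  have rat: "rational_map f"
    unfolding rational_map_def using f(1) by (intro conjI exI[of _ "[:c':]"] exI[of _ 1]) (auto simp: c c')
  have "f = (\<lambda>_. c)" using c by auto
  then have "Lim at_infinity f = c" by (simp add: tendsto_Lim at_infinity_neq_bot)
  then have S: "sphere_map f = (\<lambda>_. c)"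
    using rat c by (auto simp: sphere_map_def fun_eq_iff split: riemann_sphere.split)
  have "sphere_map f ^^ n \<in> {id, \<lambda>_. c}" for n by (cases n) (auto simp: S)
  then have "range (\<lambda>n. sphere_map f ^^ n) \<subseteq> {id, \<lambda>_. c}" by blast
  then have "finite (range (\<lambda>n. sphere_map f ^^ n))" by (rule finite_subset) auto
  then have "UNIV \<subseteq> fatou_set f"
    by (intro fatou_setI finite_imp_normal_family) (auto simp: all_iterates_defined_def map_domain_def rat)
  then show ?thesis by auto
qed

section \<open>Bounded Fatou components are regular\<close>

lemma iterates_sphere_holomorphic:
  assumes f: "meromorphic_map f" and dom: "\<And>m z. m < n \<Longrightarrow> z \<in> V \<Longrightarrow> (sphere_map f ^^ m) (Fin z) \<in> map_domain f"
    and z: "z \<in> V"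
  shows "sphere_holomorphic_at (\<lambda>z. (sphere_map f ^^ n) (Fin z)) z"
  using dom
proof (induction n)
  case 0
  show ?case using sphere_holomorphic_at_Fin[of "\<lambda>z. z" z] by (simp add: analytic_on_ident)
next
  case (Suc n)
  have "sphere_holomorphic_at (\<lambda>z. sphere_map f ((sphere_map f ^^ n) (Fin z))) z"
    by (rule sphere_map_sphere_holomorphic[OF f Suc.IH]) (use Suc.prems z in auto)
  then show ?case by simp
qed

lemma continuous_on_sphere_holomorphic:
  assumes "\<And>z. z \<in> A \<Longrightarrow> sphere_holomorphic_at F z" shows "continuous_on A F"
  by (intro continuous_onI_nhds sphere_holomorphic_at_imp_tendsto assms)

lemma iterates_open_image:
  assumes f: "meromorphic_map f" "\<not> f constant_on UNIV"
    and dom: "\<And>m z. m < n \<Longrightarrow> z \<in> V \<Longrightarrow> (sphere_map f ^^ m) (Fin z) \<in> map_domain f"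
    and V: "open V"
  shows "open ((\<lambda>z. (sphere_map f ^^ n) (Fin z)) ` V)"
  using dom
proof (induction n)
  case 0
  then show ?case using V by simp
next
  case (Suc n)
  have "open (sphere_map f ` ((\<lambda>z. (sphere_map f ^^ n) (Fin z)) ` V))"
    by (rule open_sphere_map_image[OF f Suc.IH]) (use Suc.prems in auto)
  then show ?case by (simp add: image_image)
qed

text \<open>Every ray from an interior point leaves a bounded set; three directions give three points.\<close>

lemma three_frontier_points:
  fixes V :: "complex set"
  assumes "bounded V" "open V" "V \<noteq> {}"
  obtains a b c where "a \<in> frontier V" "b \<in> frontier V" "c \<in> frontier V" "a \<noteq> c" "b \<noteq> c" "a \<noteq> b"
proof -
  obtain z where z: "z \<in> interior V" using assms by (auto simp: interior_open)
  obtain s where s: "0 < s" "z + s *\<^sub>R 1 \<in> frontier V" 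
    by (rule ray_to_frontier[OF assms(1) z, of 1]) auto
  obtain t where t: "0 < t" "z + t *\<^sub>R (-1) \<in> frontier V" 
    by (rule ray_to_frontier[OF assms(1) z, of "-1"]) auto
  obtain u where u: "0 < u" "z + u *\<^sub>R \<i> \<in> frontier V" 
    by (rule ray_to_frontier[OF assms(1) z, of \<i>]) auto
  show ?thesis
    by (rule that[OF s(2) t(2) u(2)]) (use s t u in \<open>auto simp: complex_eq_iff\<close>)
qed

text \<open>The step \<open>trap\<close> is the consequence of forward invariance on which everything rests, and \<open>no_crossing\<close> is its negative
  form. The step \<open>TD\<close> excludes values outside the domain of \<open>f\<close>, the step \<open>omit\<close> excludes frontier values; both contradict
  \<open>no_crossing\<close>.\<close>

theorem bounded_fatou_component_regular:
  assumes U: "U \<noteq> {}" "open U" "connected U" "bounded U"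
    and f: "meromorphic_map f" and comp: "fatou_component f (Fin ` U)"
  shows "regular_domain U"
proof -
  let ?S = "sphere_map f" and ?F = "fatou_set f" and ?D = "map_domain f"
  define T where "T n z = (?S ^^ n) (Fin z)" for n z
  define V where "V = interior (closure U)"
  have V: "open V" "U \<subseteq> V" "V \<subseteq> closure U"
    using U(2) by (auto simp: V_def interior_subset interior_maximal closure_subset)
  have FU: "Fin ` U \<subseteq> ?F" using comp unfolding fatou_component_def by (rule in_components_subset)
  have bV: "bounded V" using V(3) U(4) by (meson bounded_closure bounded_subset)
  have cV: "connected V" using connected_intermediate_closure[OF U(3) V(2,3)] .
  have ext: "- closure U \<noteq> {}"
  proof
    assume "- closure U = {}"
    then have "closure U = UNIV" by blast
    then show False using bounded_closure[OF U(4)] not_bounded_UNIV[where 'a = complex] by simp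
  qed
  have "frontier U \<noteq> {}"
    using U by (metis frontier_eq_empty not_bounded_UNIV)
  then have nc: "\<not> f constant_on UNIV"
    using fatou_component_frontier[OF U(2) comp] fatou_set_constant[OF f] by blast
  have TF: "T n u \<in> ?F" if "u \<in> U" for n u
    unfolding T_def using FU that by (intro funpow_fatou_set f nc) auto
  have T_sphere_holomorphic: "sphere_holomorphic_at (T n) z" if "\<And>m z. m < n \<Longrightarrow> z \<in> A \<Longrightarrow> T m z \<in> ?D" "z \<in> A" for A n z
    using iterates_sphere_holomorphic[OF f, of n A z] that unfolding T_def[abs_def] by blast
  have T_contU: "continuous_on U (T n)" for n
    using TF fatou_set_subset_map_domain by (intro continuous_on_sphere_holomorphic T_sphere_holomorphic[where A = U]) auto
  have trap: "T n ` U \<subseteq> Fin ` U" if "u \<in> U" "T n u \<in> Fin ` U" for n u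
    using comp that TF unfolding fatou_component_def
    by (intro components_maximal[of "Fin ` U" ?F] connected_continuous_image[OF T_contU U(3)]) auto
  have no_crossing: False if "u \<in> U" "T n u \<in> Fin ` U" "v \<in> U" "T n v \<in> Fin ` (- closure U)" for n u v
  proof -
    have "T n v \<in> Fin ` U" using trap[OF that(1,2)] that(3) by blast
    then show False using that(4) closure_subset[of U] by auto
  qed
  have dense: "\<exists>u\<in>U. H u \<in> G" if "continuous_on V H" "open G" "v \<in> V" "H v \<in> G" 
    for H :: "complex \<Rightarrow> riemann_sphere" and G v
  proof -
    have "open (V \<inter> H -` G)" by (rule continuous_open_preimage[OF that(1) V(1) that(2)])
    moreover have "v \<in> (V \<inter> H -` G) \<inter> closure U" using that V by auto
    ultimately have "(V \<inter> H -` G) \<inter> U \<noteq> {}" using open_Int_closure_eq_empty by blast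
    then show ?thesis by auto
  qed
  have TD: "\<forall>z\<in>V. T n z \<in> ?D" for n
  proof (induction n rule: less_induct)
    case (less n)
    have sph: "sphere_holomorphic_at (T n) z" if "z \<in> V" for z by (rule T_sphere_holomorphic[where A = V]) (use less that in auto)
    then have cont: "continuous_on V (T n)" by (rule continuous_on_sphere_holomorphic)
    show ?case
    proof (rule ccontr)
      assume "\<not> (\<forall>z\<in>V. T n z \<in> ?D)"
      then obtain z where z: "z \<in> V" "T n z \<notin> ?D" by blast
      then have nrat: "\<not> rational_map f" by (auto simp: map_domain_def)
      then have D: "?D = range Fin" by (simp add: map_domain_def)
      then have zI: "T n z = Infty" using z(2) by (simp add: range_Fin)
      have "open (T n ` V)"
        using iterates_open_image[OF f nc, of n V] less V(1) unfolding T_def[abs_def] by blast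
      then have "open {w. sphere_inverse (Fin w) \<in> T n ` V}" by (simp add: open_sphere_iff)
      moreover have "0 \<in> {w. sphere_inverse (Fin w) \<in> T n ` V}" using z(1) zI by force
      ultimately obtain r where r: "r > 0" "ball 0 r \<subseteq> {w. sphere_inverse (Fin w) \<in> T n ` V}"
        by (meson openE)
      \<comment> \<open>The open set \<open>T n ` V\<close> contains infinity, hence all finite points of large modulus.\<close>
      have big: "Fin y \<in> T n ` V" if "norm y > inverse r" for y
      proof -
        have "y \<noteq> 0" using that r(1) by auto
        have "inverse (norm y) < inverse (inverse r)"
          by (rule less_imp_inverse_less) (use that r(1) in auto)
        then have "norm (inverse y) < r" by (simp only: norm_inverse inverse_inverse_eq)
        then have "inverse y \<in> ball 0 r" by (simp only: mem_ball_0)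
        then have "sphere_inverse (Fin (inverse y)) \<in> T n ` V" using r(2) by blast
        then show ?thesis using \<open>y \<noteq> 0\<close> by simp
      qed
      have hit: "\<exists>u\<in>U. T (Suc n) u \<in> Fin ` B" if B: "open B" "B \<noteq> {}" for B
      proof -
        obtain y where y: "norm y > inverse r" "f y \<in> Fin ` B"
          using transcendental_dense_near_infinity[OF f nrat B] by blast
        obtain v where v: "v \<in> V" "T n v = Fin y" using big[OF y(1)] by (metis imageE)
        define G where "G = range Fin \<inter> ?S -` (Fin ` B)"
        have "open G" unfolding G_def
          by (intro continuous_open_preimage continuous_on_sphere_map[OF f]) (use D B in auto)
        moreover have "T n v \<in> G" using y(2) v(2) by (simp add: G_def)
        ultimately obtain u where "u \<in> U" "T n u \<in> G" using dense[OF cont _ v(1)] by blast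
        then show ?thesis by (intro bexI[of _ u]) (auto simp: G_def T_def)
      qed
      show False
        using hit[OF U(2,1)] hit[OF open_Compl[OF closed_closure] ext] no_crossing by blast
    qed
  qed
  have sph: "sphere_holomorphic_at (T n) z" if "z \<in> V" for n z by (rule T_sphere_holomorphic[where A = V]) (use TD that in auto)
  have omit: "T n z \<noteq> Fin b" if z: "z \<in> V" and b: "b \<in> frontier V" for n z b
  proof
    assume eq: "T n z = Fin b"
    have "open (T n ` V)"
      using iterates_open_image[OF f nc, of n V] TD V(1) unfolding T_def[abs_def] by blast
    then have N: "open {y. Fin y \<in> T n ` V}" "b \<in> {y. Fin y \<in> T n ` V}"
      using z eq by (auto simp: open_sphere_iff) (metis image_eqI)
    have bU: "b \<in> closure U" 
      using b V(3) closure_minimal[OF V(3)] by (auto simp: frontier_def)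
    have "b \<notin> interior (closure U)"
      using b V(1) by (simp add: frontier_def interior_open flip: V_def)
    then have "\<not> {y. Fin y \<in> T n ` V} \<subseteq> closure U" using N interior_maximal by blast
    then obtain y where y: "Fin y \<in> T n ` V" "y \<in> - closure U" by blast
    have "{y. Fin y \<in> T n ` V} \<inter> U \<noteq> {}"
      using N bU open_Int_closure_eq_empty by blast
    then obtain x where x: "Fin x \<in> T n ` V" "x \<in> U" by blast
    have cont: "continuous_on V (T n)" by (rule continuous_on_sphere_holomorphic[OF sph])
    have hit: "\<exists>u\<in>U. T n u \<in> Fin ` B" if B: "open B" "y \<in> B" "Fin y \<in> T n ` V" for B y
    proof -
      obtain v where "v \<in> V" "T n v = Fin y" using B(3) by (metis imageE)
      then show ?thesis using dense[OF cont, of "Fin ` B" v] B by auto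
    qed
    show False
      using hit[OF U(2) x(2,1)] hit[OF open_Compl[OF closed_closure] y(2,1)] no_crossing by blast
  qed
  obtain a b c where abc: "a \<in> frontier V" "b \<in> frontier V" "c \<in> frontier V" "a \<noteq> c" "b \<noteq> c" "a \<noteq> b"
    using three_frontier_points[OF bV V(1)] U(1) V(2) by blast
  have "Fin ` V \<subseteq> ?F"
  proof (rule fatou_setI)
    show "open (Fin ` V)" using V(1) by simp
    show "all_iterates_defined f y" if "y \<in> Fin ` V" for y
      using that TD unfolding all_iterates_defined_def T_def by auto
    show "normal_family_on (Fin ` V) (range (\<lambda>n. ?S ^^ n))"
      unfolding normal_family_on_def
    proof (intro allI impI)
      fix h :: "nat \<Rightarrow> riemann_sphere \<Rightarrow> riemann_sphere"
      assume "range h \<subseteq> range (\<lambda>n. ?S ^^ n)"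
      then have "\<forall>i. \<exists>k. h i = ?S ^^ k" by blast
      from choice[OF this] obtain k where "\<forall>i. h i = ?S ^^ k i" ..
      then have k: "h i = ?S ^^ k i" for i by (rule spec)
      have "\<exists>r l. strict_mono (r :: nat \<Rightarrow> nat) \<and>
        (\<forall>K. compact K \<longrightarrow> K \<subseteq> V \<longrightarrow> uniform_limit K ((\<lambda>i. T (k i)) \<circ> r) l sequentially)"
        by (rule sphere_Montel[OF V(1) cV sph abc(4-6)]) (use omit abc in auto)
      then obtain r l where r: "strict_mono (r :: nat \<Rightarrow> nat)" 
        and l: "\<And>K. compact K \<Longrightarrow> K \<subseteq> V \<Longrightarrow> uniform_limit K ((\<lambda>i. T (k i)) \<circ> r) l sequentially"
        by blast
      have "uniform_limit K (h \<circ> r) (\<lambda>x. l (the_Fin x)) sequentially" 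
        if K: "compact K" "K \<subseteq> Fin ` V" for K
      proof -
        have "compact (the_Fin ` K)"
          by (intro compact_continuous_image continuous_on_subset[OF continuous_on_the_Fin] K(1)) (use K(2) in auto)
        moreover have KV: "the_Fin ` K \<subseteq> V" using K(2) by auto
        ultimately have "uniform_limit (the_Fin ` K) ((\<lambda>i. T (k i)) \<circ> r) l sequentially" by (rule l)
        then have "uniform_limit K (\<lambda>n x. ((\<lambda>i. T (k i)) \<circ> r) n (the_Fin x)) (\<lambda>x. l (the_Fin x)) sequentially"
          by (rule uniform_limit_compose') auto
        moreover have "((\<lambda>i. T (k i)) \<circ> r) n (the_Fin x) = (h \<circ> r) n x" if "x \<in> K" for n x
          using K(2) that by (auto simp: T_def k)
        ultimately show ?thesis by (subst (asm) uniform_limit_cong') auto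
      qed
      with r show "\<exists>r l. strict_mono r \<and> (\<forall>K. compact K \<longrightarrow> K \<subseteq> Fin ` V \<longrightarrow> uniform_limit K (h \<circ> r) l sequentially)"
        by blast
    qed
  qed
  then have "Fin ` V \<subseteq> Fin ` U"
    using comp U(1) V(2) cV unfolding fatou_component_def
    by (intro components_maximal[of "Fin ` U" ?F] connected_continuous_image continuous_on_Fin) auto
  then have "V = U" using V(2) by auto
  then show ?thesis by (simp add: regular_domain_def V_def)
qed

section \<open>Rational functions with one pole, small away from it\<close>

text \<open>Smallness is measured by a supremum bound together with a Lipschitz bound. On the complement of a disc, which is not
  convex, a bound for the derivative would not yield the Lipschitz estimate directly, whereas this class of functions
  is closed under sums and products by elementary algebra.\<close>

definition small_off :: "(complex \<Rightarrow> complex) \<Rightarrow> complex \<Rightarrow> real \<Rightarrow> real \<Rightarrow> bool" where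
  "small_off s p \<delta> \<eta> \<longleftrightarrow> (\<forall>z w. \<delta> \<le> norm (z - p) \<and> \<delta> \<le> norm (w - p) \<longrightarrow>
     norm (s z) \<le> \<eta> \<and> norm (s z - s w) \<le> \<eta> * norm (z - w))"

lemma small_off_mono: "small_off s p \<delta> \<eta> \<Longrightarrow> \<eta> \<le> \<eta>' \<Longrightarrow> small_off s p \<delta> \<eta>'"
  unfolding small_off_def by (meson mult_right_mono norm_ge_zero order_trans)

lemma small_off_nonneg: "small_off s p \<delta> \<eta> \<Longrightarrow> 0 \<le> \<eta>"
proof -
  assume "small_off s p \<delta> \<eta>"
  then have "norm (s (p + of_real \<delta>)) \<le> \<eta>" unfolding small_off_def by (metis add_diff_cancel_left' norm_of_real abs_ge_self)
  then show ?thesis using norm_ge_zero order_trans by blast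
qed

lemma small_off_const: "small_off (\<lambda>_. c) p \<delta> (norm c)"
  by (auto simp: small_off_def)

lemma small_off_add:
  assumes "small_off s p \<delta> \<eta>" "small_off t p \<delta> \<theta>"
  shows "small_off (\<lambda>z. s z + t z) p \<delta> (\<eta> + \<theta>)"
  unfolding small_off_def
proof (intro allI impI conjI)
  fix z w assume h: "\<delta> \<le> norm (z - p) \<and> \<delta> \<le> norm (w - p)"
  then have b: "norm (s z) \<le> \<eta>" "norm (t z) \<le> \<theta>" "norm (s z - s w) \<le> \<eta> * norm (z - w)"
    "norm (t z - t w) \<le> \<theta> * norm (z - w)" using assms unfolding small_off_def by blast+
  show "norm (s z + t z) \<le> \<eta> + \<theta>" using norm_triangle_mono[OF b(1,2)] .
  have "s z + t z - (s w + t w) = (s z - s w) + (t z - t w)" by simp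
  then show "norm (s z + t z - (s w + t w)) \<le> (\<eta> + \<theta>) * norm (z - w)"
    using norm_triangle_mono[OF b(3,4)] by (simp only: distrib_right)
qed

lemma small_off_mult:
  assumes "small_off s p \<delta> \<eta>" "small_off t p \<delta> \<theta>"
  shows "small_off (\<lambda>z. s z * t z) p \<delta> (\<eta> * \<theta> + \<eta> * \<theta>)"
  unfolding small_off_def
proof (intro allI impI conjI)
  have nn: "0 \<le> \<eta>" "0 \<le> \<theta>" using assms small_off_nonneg by blast+
  fix z w assume h: "\<delta> \<le> norm (z - p) \<and> \<delta> \<le> norm (w - p)"
  then have b: "norm (s z) \<le> \<eta>" "norm (t z) \<le> \<theta>" "norm (s w) \<le> \<eta>" "norm (s z - s w) \<le> \<eta> * norm (z - w)"
    "norm (t z - t w) \<le> \<theta> * norm (z - w)" using assms unfolding small_off_def by blast+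
  have "norm (s z * t z) \<le> \<eta> * \<theta>" unfolding norm_mult by (intro mult_mono b nn) simp
  then show "norm (s z * t z) \<le> \<eta> * \<theta> + \<eta> * \<theta>" using nn mult_nonneg_nonneg[OF nn] by linarith
  have "s z * t z - s w * t w = (s z - s w) * t z + s w * (t z - t w)" by (simp add: algebra_simps)
  also have "norm \<dots> \<le> norm (s z - s w) * norm (t z) + norm (s w) * norm (t z - t w)"
    by (rule order_trans[OF norm_triangle_ineq]) (simp add: norm_mult)
  also have "\<dots> \<le> (\<eta> * norm (z - w)) * \<theta> + \<eta> * (\<theta> * norm (z - w))"
    by (intro add_mono mult_mono b) (use nn in auto)
  finally show "norm (s z * t z - s w * t w) \<le> (\<eta> * \<theta> + \<eta> * \<theta>) * norm (z - w)"
    by (simp add: algebra_simps)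
qed

lemma small_off_reciprocal:
  assumes "\<delta> > 0" shows "small_off (\<lambda>z. inverse (z - p)) p \<delta> (1 / \<delta> + 1 / \<delta>\<^sup>2)"
  unfolding small_off_def
proof (intro allI impI conjI)
  fix z w assume h: "\<delta> \<le> norm (z - p) \<and> \<delta> \<le> norm (w - p)"
  then have ne: "z - p \<noteq> 0" "w - p \<noteq> 0" using assms by auto
  have i: "norm (inverse (z - p)) \<le> 1 / \<delta>" "norm (inverse (w - p)) \<le> 1 / \<delta>"
    unfolding norm_inverse inverse_eq_divide[of \<delta>, symmetric] using h assms
    by (auto intro!: le_imp_inverse_le simp del: inverse_eq_divide)
  show "norm (inverse (z - p)) \<le> 1 / \<delta> + 1 / \<delta>\<^sup>2" using i(1) assms by (simp add: add_increasing2)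
  have "inverse (z - p) - inverse (w - p) = (w - z) * (inverse (z - p) * inverse (w - p))"
    using ne by (simp add: field_simps)
  then have "norm (inverse (z - p) - inverse (w - p)) = norm (z - w) * (norm (inverse (z - p)) * norm (inverse (w - p)))"
    by (simp only: norm_mult norm_minus_commute)
  also have "\<dots> \<le> norm (z - w) * (1 / \<delta> * (1 / \<delta>))"
    using assms by (intro mult_left_mono mult_mono i) auto
  also have "\<dots> \<le> (1 / \<delta> + 1 / \<delta>\<^sup>2) * norm (z - w)"
    using assms by (simp add: power2_eq_square distrib_right)
  finally show "norm (inverse (z - p) - inverse (w - p)) \<le> (1 / \<delta> + 1 / \<delta>\<^sup>2) * norm (z - w)" .
qed

text \<open>The function is a small multiple of the product of all \<open>(z - w)/(z - p)\<close> with \<open>w\<close> in \<open>W\<close> and of \<open>1/(z - p)\<close>. Each factor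
  \<open>(z - w)/(z - p) = 1 + (p - w)/(z - p)\<close> is bounded and Lipschitz away from \<open>p\<close>, and the additional factor
  produces a pole even if \<open>W\<close> is empty.\<close>

lemma rational_pole_vanishing_on:
  assumes W: "finite W" "p \<notin> W" and \<delta>: "\<delta> > 0" and \<eta>: "\<eta> > 0"
  obtains s where "s holomorphic_on - {p}" "is_pole s p" "\<And>w. w \<in> W \<Longrightarrow> s w = 0" "small_off s p \<delta> \<eta>"
proof -
  define h where "h z = (\<Prod>w\<in>W. 1 + (p - w) * inverse (z - p))" for z
  have "\<exists>M. small_off h p \<delta> M"
    unfolding h_def using W(1)
  proof (induction rule: finite_induct)
    case empty
    then show ?case using small_off_const[of 1] by auto
  next
    case (insert w W)
    then obtain M where M: "small_off (\<lambda>z. \<Prod>w\<in>W. 1 + (p - w) * inverse (z - p)) p \<delta> M" by blast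
    show ?case
      using small_off_mult[OF small_off_add[OF small_off_const[of 1] small_off_mult[OF small_off_const[of "p - w"] small_off_reciprocal[OF \<delta>]]] M]
        insert.hyps by auto
  qed
  then obtain M where "small_off h p \<delta> M" by blast
  from small_off_mult[OF this small_off_reciprocal[OF \<delta>]]
  obtain N where N: "small_off (\<lambda>z. h z * inverse (z - p)) p \<delta> N" by blast
  define \<epsilon> where "\<epsilon> = \<eta> / (2 * (N + 1))"
  have N0: "0 \<le> N" using N by (rule small_off_nonneg)
  then have \<epsilon>: "\<epsilon> > 0" using \<eta> by (simp add: \<epsilon>_def)
  define s where "s z = of_real \<epsilon> * (h z * inverse (z - p))" for z
  show ?thesis
  proof (rule that[of s])
    show "s holomorphic_on - {p}"
      unfolding s_def h_def by (intro holomorphic_intros) auto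
    show "s w = 0" if "w \<in> W" for w
    proof -
      have "w - p \<noteq> 0" using W(2) that by auto
      then have "1 + (p - w) * inverse (w - p) = 0" by (simp add: field_simps)
      then have "h w = 0" unfolding h_def using that W(1) by (intro prod_zero) auto
      then show ?thesis by (simp add: s_def)
    qed
    have "\<epsilon> * N + \<epsilon> * N \<le> \<eta>"
    proof -
      have "\<epsilon> * (2 * (N + 1)) = \<eta>" using N0 by (simp add: \<epsilon>_def)
      moreover have "\<epsilon> * (2 * (N + 1)) = \<epsilon> * N + \<epsilon> * N + 2 * \<epsilon>" by (simp add: algebra_simps)
      ultimately show ?thesis using \<epsilon> by linarith
    qed
    then show "small_off s p \<delta> \<eta>"
      unfolding s_def using small_off_mono[OF small_off_mult[OF small_off_const[of "of_real \<epsilon>"] N]] \<epsilon> by simp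
    define k where "k z = of_real \<epsilon> * (\<Prod>w\<in>W. (z - p) + (p - w))" for z
    have "k p \<noteq> 0" using W \<epsilon> by (auto simp: k_def prod_zero_iff)
    moreover have "k holomorphic_on UNIV" unfolding k_def by (intro holomorphic_intros)
    ultimately have "is_pole (\<lambda>z. k z / (z - p) ^ Suc (card W)) p"
      by (intro is_pole_basic[of _ UNIV]) auto
    moreover have ev: "\<forall>\<^sub>F z in at p. k z / (z - p) ^ Suc (card W) = s z"
      using eventually_neq_at_within[of p p UNIV]
    proof eventually_elim
      case (elim z)
      then have zp: "z - p \<noteq> 0" by simp
      have "(\<Prod>w\<in>W. (z - p) + (p - w)) = (\<Prod>w\<in>W. (z - p) * (1 + (p - w) * inverse (z - p)))"
        using zp by (intro prod.cong refl) (simp add: field_simps)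
      also have "\<dots> = (z - p) ^ card W * h z" by (simp add: prod.distrib h_def)
      finally show ?case using zp by (simp add: k_def s_def field_simps)
    qed
    ultimately show "is_pole s p" using iffD1[OF is_pole_cong[OF ev refl]] by blast
  qed
qed

text \<open>Only the tail is required to be bounded on a disc of a fixed radius; the finitely many remaining terms may be
  singular at other points of this disc.\<close>

lemma series_analytic_at:
  fixes t :: "nat \<Rightarrow> complex \<Rightarrow> complex"
  assumes ana: "\<And>k. t k analytic_on {z0}"
    and tail: "\<And>k. k \<ge> N \<Longrightarrow> t k holomorphic_on ball z0 1"
      "\<And>k z. k \<ge> N \<Longrightarrow> z \<in> ball z0 1 \<Longrightarrow> norm (t k z) \<le> c k" and c: "summable c"
  shows "(\<lambda>z. \<Sum>k. t k z) analytic_on {z0}" "\<And>z. z \<in> ball z0 1 \<Longrightarrow> summable (\<lambda>k. t k z)"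
proof -
  have c': "summable (\<lambda>k. c (k + N))" using c by (simp add: summable_iff_shift)
  show sm: "summable (\<lambda>k. t k z)" if "z \<in> ball z0 1" for z
  proof (rule summable_comparison_test'[OF c, of N])
    show "norm (t k z) \<le> c k" if "k \<ge> N" for k using tail(2)[OF that \<open>z \<in> ball z0 1\<close>] .
  qed
  have ul: "uniform_limit (ball z0 1) (\<lambda>n z. \<Sum>k<n. t (k + N) z) (\<lambda>z. \<Sum>k. t (k + N) z) sequentially"
    by (rule Weierstrass_m_test[OF _ c']) (use tail in auto)
  have hol: "(\<lambda>z. \<Sum>k. t (k + N) z) holomorphic_on ball z0 1"
  proof (rule holomorphic_uniform_sequence[OF open_ball])
    show "(\<lambda>z. \<Sum>k<n. t (k + N) z) holomorphic_on ball z0 1" for n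
      by (intro holomorphic_intros tail(1)) simp
    fix x assume x: "x \<in> ball z0 1"
    obtain d where d: "d > 0" "cball x d \<subseteq> ball z0 1" using open_contains_cball x open_ball by blast
    then show "\<exists>d>0. cball x d \<subseteq> ball z0 1 \<and>
        uniform_limit (cball x d) (\<lambda>n z. \<Sum>k<n. t (k + N) z) (\<lambda>z. \<Sum>k. t (k + N) z) sequentially"
      using uniform_limit_on_subset[OF ul d(2)] by blast
  qed
  have "(\<lambda>z. (\<Sum>k. t (k + N) z) + (\<Sum>k<N. t k z)) analytic_on {z0}"
    by (intro analytic_on_add analytic_on_sum ana analytic_on_subset[OF hol[folded analytic_on_open[OF open_ball]]]) auto
  moreover have ev: "\<forall>\<^sub>F z in nhds z0. (\<Sum>k. t (k + N) z) + (\<Sum>k<N. t k z) = (\<Sum>k. t k z)"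
  proof -
    have "\<forall>\<^sub>F z in nhds z0. z \<in> ball z0 1" by (rule eventually_nhds_in_open) auto
    then show ?thesis by eventually_elim (rule suminf_split_initial_segment[OF sm, symmetric])
  qed
  ultimately show "(\<lambda>z. \<Sum>k. t k z) analytic_on {z0}"
    using iffD1[OF analytic_at_cong[OF ev refl]] by blast
qed

text \<open>For the exact doubling map the left-hand side vanishes. An error made at some step is doubled at each later step, so
  that relative to the scale \<open>2\<^sup>j\<close> all errors together stay bounded.\<close>

lemma doubling_orbit_drift:
  fixes F :: "complex \<Rightarrow> complex"
  assumes "\<And>i. i < j \<Longrightarrow> norm (F ((F ^^ i) z) - (2 * (F ^^ i) z + c)) \<le> 1"
  shows "norm ((F ^^ j) z + c - 2 ^ j * (z + c)) \<le> 2 ^ j - 1"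
  using assms
proof (induction j)
  case (Suc j)
  define y where "y = (F ^^ j) z"
  have "F y + c - 2 ^ Suc j * (z + c) = (F y - (2 * y + c)) + 2 * (y + c - 2 ^ j * (z + c))"
    by (simp add: algebra_simps)
  also have "norm \<dots> \<le> 1 + 2 * (2 ^ j - 1)"
  proof (rule norm_triangle_mono)
    show "norm (F y - (2 * y + c)) \<le> 1" using Suc.prems[of j] by (simp add: y_def)
    have "norm (y + c - 2 ^ j * (z + c)) \<le> 2 ^ j - 1" unfolding y_def using Suc by simp
    then show "norm (2 * (y + c - 2 ^ j * (z + c))) \<le> 2 * (2 ^ j - 1)" by (simp only: norm_mult norm_numeral) simp
  qed
  finally show ?case by (simp add: y_def)
qed simp

lemma sum_half_powers: "(\<Sum>k<n. (1/2) ^ Suc k :: real) = 1 - (1/2) ^ n"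
  by (induction n) (auto simp: field_simps)

lemma sum_half_powers_le: "(\<Sum>k\<in>{m..<n}. (1/2) ^ Suc k :: real) \<le> 1"
proof -
  have "(\<Sum>k\<in>{m..<n}. (1/2) ^ Suc k :: real) \<le> (\<Sum>k<n. (1/2) ^ Suc k)" by (rule sum_mono2) auto
  then show ?thesis unfolding sum_half_powers by (rule order_trans) simp
qed

section \<open>Placing the poles one after another\<close>

text \<open>One step of the construction records a point near the frontier of \<open>U\<close>, the pole that its orbit will hit, the radius
  of a disc around this pole which the orbit of \<open>U\<close> avoids, a bound for this and all later perturbations, and the
  perturbation itself.\<close>

datatype stage = Stage (start: complex) (pole: complex) (radius: real) (tol: real) (pert: "complex \<Rightarrow> complex")

text \<open>The open sets \<open>V n\<close> prescribe where the points near the frontier are to be chosen; they form a neighbourhood basis at every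
  frontier point.\<close>

locale regular_domain_construction =
  fixes U :: "complex set" and R :: real and V :: "nat \<Rightarrow> complex set"
  assumes U_ne: "U \<noteq> {}" and U_open: "open U" and U_conn: "connected U"
    and U_regular: "interior (closure U) = U"
    and R: "\<And>z. z \<in> closure U \<Longrightarrow> norm z \<le> R"
    and V_open: "\<And>n. open (V n)" and V_frontier: "\<And>n. V n \<inter> frontier U \<noteq> {}"
    and V_basis: "\<And>b T. b \<in> frontier U \<Longrightarrow> open T \<Longrightarrow> b \<in> T \<Longrightarrow> \<exists>n. V n \<subseteq> T"
begin

definition S :: real where "S = R + 2"

lemma R_nonneg: "0 \<le> R"
proof -
  obtain z where "z \<in> U" using U_ne by auto
  then have "norm z \<le> R" using R closure_subset by blast
  then show ?thesis using norm_ge_zero order_trans by blast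
qed

lemma S_ge: "2 \<le> S" using R_nonneg by (simp add: S_def)

lemma compact_closure: "compact (closure U)"
proof -
  have "bounded (closure U)" unfolding bounded_iff using R by blast
  then show ?thesis by (simp add: compact_eq_bounded_closed)
qed

definition shift :: complex where "shift = of_real (5 * S)"

text \<open>The \<open>j\<close>-th image of the exact doubling map \<open>z \<mapsto> 2 z + shift\<close> with fixed point \<open>- shift\<close> multiplies distances to this point
  by \<open>2\<^sup>j\<close>. The disc \<open>copy j\<close> contains the \<open>j\<close>-th image of the disc of radius \<open>R + 1\<close> together with the drift
  caused by perturbations. As \<open>shift\<close> is five times the radius \<open>S\<close>, different discs are far apart.\<close>

definition copy :: "nat \<Rightarrow> complex set" where
  "copy j = {y. norm (y + shift - 2 ^ j * shift) \<le> 2 ^ j * S}"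

definition approx :: "(nat \<Rightarrow> stage) \<Rightarrow> nat \<Rightarrow> complex \<Rightarrow> complex" where
  "approx x n z = 2 * z + shift + (\<Sum>m<n. pert (x m) z)"

definition good :: "(nat \<Rightarrow> stage) \<Rightarrow> nat set \<Rightarrow> complex set" where
  "good x I = {z. \<forall>m\<in>I. radius (x m) < norm (z - pole (x m))}"

text \<open>The factor \<open>3 ^ n\<close> in the distance of the pole from the \<open>n\<close>-th image of \<open>U\<close> is a bound for the growth of errors in \<open>n\<close>
  iterations of a map with Lipschitz constant at most \<open>3\<close>. As the tolerances decrease and the \<open>k\<close>-th perturbation is bounded by
  its tolerance times \<open>(1/2) ^ Suc k\<close>, the sum of all perturbations from the \<open>n\<close>-th on is at most \<open>tol r\<close>. The last two
  conditions keep the initial orbits of all points chosen so far unchanged.\<close>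

definition admissible :: "(nat \<Rightarrow> stage) \<Rightarrow> nat \<Rightarrow> stage \<Rightarrow> bool" where
  "admissible x n r \<longleftrightarrow>
     start r \<in> V n \<and> start r \<notin> closure U \<and> norm (start r) \<le> R + 1 \<and>
     (\<forall>j<n. (approx x n ^^ j) (start r) \<in> good x {..<n}) \<and>
     pole r = (approx x n ^^ n) (start r) \<and>
     0 < radius r \<and> radius r \<le> 1 \<and> 0 < tol r \<and> tol r \<le> 1/4 \<and> (\<forall>m<n. tol r \<le> tol (x m)) \<and>
     (\<forall>z\<in>closure U. radius r + 3 ^ n * tol r < norm ((approx x n ^^ n) z - pole r)) \<and>
     pert r holomorphic_on - {pole r} \<and> is_pole (pert r) (pole r) \<and>
     small_off (pert r) (pole r) (radius r) (tol r * (1/2) ^ Suc n) \<and>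
     (\<forall>m<n. \<forall>j<m. pert r ((approx x m ^^ j) (start (x m))) = 0) \<and>
     (\<forall>j<n. pert r ((approx x n ^^ j) (start r)) = 0)"

lemma copyI:
  assumes "\<And>i. i < j \<Longrightarrow> norm (F ((F ^^ i) z) - (2 * (F ^^ i) z + shift)) \<le> 1" and z: "norm z \<le> R + 1"
  shows "(F ^^ j) z \<in> copy j"
proof -
  have "norm ((F ^^ j) z + shift - 2 ^ j * (z + shift)) \<le> 2 ^ j - 1"
    by (rule doubling_orbit_drift) (rule assms)
  moreover have eq: "(F ^^ j) z + shift - 2 ^ j * shift = ((F ^^ j) z + shift - 2 ^ j * (z + shift)) + 2 ^ j * z"
    by (simp add: algebra_simps)
  moreover have "norm (2 ^ j * z) \<le> 2 ^ j * (R + 1)"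
    unfolding norm_mult norm_power norm_numeral by (rule mult_left_mono[OF z]) simp
  ultimately have "norm ((F ^^ j) z + shift - 2 ^ j * shift) \<le> (2 ^ j - 1) + 2 ^ j * (R + 1)"
    unfolding eq by (intro norm_triangle_mono)
  then show ?thesis by (simp add: copy_def S_def algebra_simps)
qed

text \<open>The centres of the discs have distance at least \<open>5 S (2\<^sup>k - 2\<^sup>j)\<close> while the radii add up to \<open>S (2\<^sup>k + 2\<^sup>j)\<close>; the
  difference is \<open>4 S 2\<^sup>k - 6 S 2\<^sup>j\<close>, which is at least \<open>2 S 2\<^sup>j\<close>.\<close>

lemma copy_separated_less:
  assumes "y \<in> copy j" "y' \<in> copy k" "j < k" shows "4 \<le> norm (y - y')"
proof -
  have "2 ^ k * shift - 2 ^ j * shift = of_real (2 ^ k * (5 * S) - 2 ^ j * (5 * S))"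
    by (simp add: shift_def)
  then have "norm (2 ^ k * shift - 2 ^ j * shift) = \<bar>2 ^ k * (5 * S) - 2 ^ j * (5 * S)\<bar>"
    by (simp only: norm_of_real)
  moreover have "2 ^ j * (5 * S) \<le> 2 ^ k * (5 * S)"
    using S_ge assms(3) by (intro mult_right_mono power_increasing) auto
  ultimately have 1: "norm (2 ^ k * shift - 2 ^ j * shift) = 2 ^ k * (5 * S) - 2 ^ j * (5 * S)" by simp
  define u v where "u = y + shift - 2 ^ j * shift" and "v = y' + shift - 2 ^ k * shift"
  have uv: "2 ^ k * shift - 2 ^ j * shift = u - v - (y - y')"
    by (simp add: u_def v_def)
  have "norm (u - v - (y - y')) \<le> norm u + norm v + norm (y - y')"
    using norm_triangle_ineq4[of "u - v" "y - y'"] norm_triangle_ineq4[of u v] by linarith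
  moreover have "norm u \<le> 2 ^ j * S" "norm v \<le> 2 ^ k * S" using assms(1,2) by (simp_all add: copy_def u_def v_def)
  ultimately have 2: "2 ^ k * (5 * S) - 2 ^ j * (5 * S) \<le> 2 ^ j * S + 2 ^ k * S + norm (y - y')"
    using 1 unfolding uv by linarith
  have "(2::real) ^ Suc j \<le> 2 ^ k" by (rule power_increasing) (use assms(3) in auto)
  then have "(2 * 2 ^ j) * S \<le> 2 ^ k * S" using S_ge by (intro mult_right_mono) auto
  moreover have "1 * 2 \<le> 2 ^ j * S" using S_ge by (intro mult_mono) auto
  ultimately show ?thesis using 2 by (simp add: algebra_simps)
qed

lemma copy_separated:
  assumes "y \<in> copy j" "y' \<in> copy k" "j \<noteq> k" shows "4 \<le> norm (y - y')"
  using copy_separated_less[of y j y' k] copy_separated_less[of y' k y j] assms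
  by (cases "j < k") (auto simp: norm_minus_commute)

lemma copy_far:
  assumes "y \<in> copy j" shows "2 ^ j - 5 * S \<le> norm y"
proof -
  have "norm (2 ^ j * shift) = 2 ^ j * (5 * S)"
    using S_ge by (simp add: norm_mult norm_power shift_def del: of_real_mult)
  moreover have "norm shift = 5 * S" using S_ge by (simp add: shift_def del: of_real_mult)
  moreover define u where "u = y + shift - 2 ^ j * shift"
  have "2 ^ j * shift = y + shift - u" by (simp add: u_def)
  then have "norm (2 ^ j * shift) \<le> norm y + norm shift + norm u"
    using norm_triangle_ineq4[of "y + shift" u] norm_triangle_ineq[of y shift] by simp
  moreover have "norm u \<le> 2 ^ j * S" using assms by (simp add: copy_def u_def)
  ultimately have "2 ^ j * (5 * S) \<le> norm y + 5 * S + 2 ^ j * S" by linarith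
  moreover have "2 ^ j \<le> 2 ^ j * S" using mult_left_mono[of 1 S "2 ^ j"] S_ge by simp
  moreover have "(0::real) \<le> 2 ^ j" by simp
  ultimately show ?thesis by linarith
qed

lemma approx_cong: "(\<And>m. m < n \<Longrightarrow> x m = x' m) \<Longrightarrow> approx x n = approx x' n"
  by (intro ext) (auto simp: approx_def intro!: sum.cong)

lemma good_cong: "(\<And>m. m \<in> I \<Longrightarrow> x m = x' m) \<Longrightarrow> good x I = good x' I"
  by (auto simp: good_def)

lemma admissible_cong:
  assumes "\<And>m. m < n \<Longrightarrow> x m = x' m" shows "admissible x n r \<longleftrightarrow> admissible x' n r"
proof -
  have a: "approx x n = approx x' n" by (rule approx_cong) (rule assms)
  have g: "good x {..<n} = good x' {..<n}" by (rule good_cong) (simp add: assms)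
  have m: "(\<forall>m<n. tol r \<le> tol (x m)) \<longleftrightarrow> (\<forall>m<n. tol r \<le> tol (x' m))" using assms by auto
  have "approx x m = approx x' m" if "m < n" for m by (rule approx_cong) (use that assms in auto)
  then have o: "(\<forall>m<n. \<forall>j<m. pert r ((approx x m ^^ j) (start (x m))) = 0) \<longleftrightarrow>
      (\<forall>m<n. \<forall>j<m. pert r ((approx x' m ^^ j) (start (x' m))) = 0)" using assms by auto
  show ?thesis unfolding admissible_def a g m o ..
qed

lemma admissibleD:
  assumes "admissible x n r"
  shows "start r \<in> V n" "start r \<notin> closure U" "norm (start r) \<le> R + 1"
    "\<And>j. j < n \<Longrightarrow> (approx x n ^^ j) (start r) \<in> good x {..<n}"
    "pole r = (approx x n ^^ n) (start r)"
    "0 < radius r" "radius r \<le> 1" "0 < tol r" "tol r \<le> 1/4" "\<And>m. m < n \<Longrightarrow> tol r \<le> tol (x m)"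
    "\<And>z. z \<in> closure U \<Longrightarrow> radius r + 3 ^ n * tol r < norm ((approx x n ^^ n) z - pole r)"
    "pert r holomorphic_on - {pole r}" "is_pole (pert r) (pole r)"
    "small_off (pert r) (pole r) (radius r) (tol r * (1/2) ^ Suc n)"
    "\<And>m j. m < n \<Longrightarrow> j < m \<Longrightarrow> pert r ((approx x m ^^ j) (start (x m))) = 0"
    "\<And>j. j < n \<Longrightarrow> pert r ((approx x n ^^ j) (start r)) = 0"
  using assms unfolding admissible_def by blast+

lemma pert_bound:
  assumes "admissible x k (x k)" "m \<le> k" "m = k \<or> tol (x k) \<le> tol (x m)" "radius (x k) < norm (z - pole (x k))"
  shows "norm (pert (x k) z) \<le> tol (x m) * (1/2) ^ Suc k"
proof -
  have "norm (pert (x k) z) \<le> tol (x k) * (1/2) ^ Suc k"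
    using admissibleD(14)[OF assms(1)] assms(4) unfolding small_off_def by (meson less_imp_le)
  also have "\<dots> \<le> tol (x m) * (1/2) ^ Suc k"
    using assms(3) by (intro mult_right_mono) auto
  finally show ?thesis .
qed

lemma approx_diff:
  assumes adm: "\<And>k. k < n \<Longrightarrow> admissible x k (x k)" and z: "z \<in> good x {..<n}" and m: "m < n"
  shows "norm (approx x n z - approx x m z) \<le> tol (x m)"
proof -
  have "{..<n} = {..<m} \<union> {m..<n}" using m by auto
  then have "(\<Sum>k<n. pert (x k) z) = (\<Sum>k<m. pert (x k) z) + (\<Sum>k\<in>{m..<n}. pert (x k) z)"
    by (simp only: sum.union_disjoint[of "{..<m}" "{m..<n}"] finite_lessThan finite_atLeastLessThan ivl_disj_int)
  then have "approx x n z - approx x m z = (\<Sum>k\<in>{m..<n}. pert (x k) z)" by (simp add: approx_def)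
  also have "norm \<dots> \<le> (\<Sum>k\<in>{m..<n}. tol (x m) * (1/2) ^ Suc k)"
  proof (rule sum_norm_le)
    fix k assume k: "k \<in> {m..<n}"
    have "m = k \<or> tol (x k) \<le> tol (x m)"
      using k admissibleD(10)[OF adm[of k], of m] by (cases "m = k") auto
    then show "norm (pert (x k) z) \<le> tol (x m) * (1/2) ^ Suc k"
      using k adm z by (intro pert_bound) (auto simp: good_def)
  qed
  also have "\<dots> = tol (x m) * (\<Sum>k\<in>{m..<n}. (1/2) ^ Suc k)" by (simp only: sum_distrib_left)
  also have "\<dots> \<le> tol (x m) * 1"
    using admissibleD(8)[OF adm[OF m]] by (intro mult_left_mono sum_half_powers_le) simp
  finally show ?thesis by simp
qed

lemma approx_doubling:
  assumes adm: "\<And>k. k < n \<Longrightarrow> admissible x k (x k)" and z: "z \<in> good x {..<n}"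
  shows "norm (approx x n z - (2 * z + shift)) \<le> 1/4"
proof (cases "n = 0")
  case False
  then have "norm (approx x n z - approx x 0 z) \<le> tol (x 0)" by (intro approx_diff adm z) auto
  moreover have "tol (x 0) \<le> 1/4" by (rule admissibleD(9)[OF adm]) (use False in simp)
  ultimately show ?thesis by (simp add: approx_def)
qed (simp add: approx_def)

lemma approx_Lipschitz:
  assumes adm: "\<And>k. k < n \<Longrightarrow> admissible x k (x k)" and z: "z \<in> good x {..<n}" "w \<in> good x {..<n}"
  shows "norm ((approx x n z - approx x n w) - 2 * (z - w)) \<le> norm (z - w)"
proof -
  have "(approx x n z - approx x n w) - 2 * (z - w) = (\<Sum>k<n. pert (x k) z - pert (x k) w)"
    by (simp add: approx_def sum_subtractf algebra_simps)
  also have "norm \<dots> \<le> (\<Sum>k<n. (1/2) ^ Suc k * norm (z - w))"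
  proof (rule sum_norm_le)
    fix k assume k: "k \<in> {..<n}"
    have a: "admissible x k (x k)" using adm k by simp
    have "radius (x k) \<le> norm (z - pole (x k))" "radius (x k) \<le> norm (w - pole (x k))"
      using z k by (auto simp: good_def intro: less_imp_le)
    then have "norm (pert (x k) z - pert (x k) w) \<le> tol (x k) * (1/2) ^ Suc k * norm (z - w)"
      using admissibleD(14)[OF a] unfolding small_off_def by blast
    also have "\<dots> \<le> 1 * (1/2) ^ Suc k * norm (z - w)"
      using admissibleD(9)[OF a] by (intro mult_right_mono) auto
    finally show "norm (pert (x k) z - pert (x k) w) \<le> (1/2) ^ Suc k * norm (z - w)" by simp
  qed
  also have "\<dots> = (1 - (1/2) ^ n) * norm (z - w)" by (simp only: sum_half_powers flip: sum_distrib_right)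
  also have "\<dots> \<le> 1 * norm (z - w)" by (intro mult_right_mono) auto
  finally show ?thesis by simp
qed

lemma approx_Lipschitz_upper:
  assumes "\<And>k. k < n \<Longrightarrow> admissible x k (x k)" "z \<in> good x {..<n}" "w \<in> good x {..<n}"
  shows "norm (approx x n z - approx x n w) \<le> 3 * norm (z - w)"
proof -
  define u where "u = approx x n z - approx x n w"
  have "norm u \<le> norm (u - 2 * (z - w)) + norm (2 * (z - w))"
    using norm_triangle_ineq[of "u - 2 * (z - w)" "2 * (z - w)"] by simp
  moreover have "norm (u - 2 * (z - w)) \<le> norm (z - w)" unfolding u_def by (rule approx_Lipschitz[OF assms])
  ultimately show ?thesis unfolding norm_mult norm_numeral u_def by linarith
qed

text \<open>The perturbations have total Lipschitz constant at most \<open>1\<close> while the main term doubles distances; this is what makes the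
  partial sums injective along good orbits.\<close>

lemma approx_expanding:
  assumes "\<And>k. k < n \<Longrightarrow> admissible x k (x k)" "z \<in> good x {..<n}" "w \<in> good x {..<n}"
  shows "norm (z - w) \<le> norm (approx x n z - approx x n w)"
proof -
  define u where "u = approx x n z - approx x n w"
  have "norm (2 * (z - w)) \<le> norm u + norm (u - 2 * (z - w))"
    using norm_triangle_ineq4[of u "u - 2 * (z - w)"] by simp
  moreover have "norm (u - 2 * (z - w)) \<le> norm (z - w)" unfolding u_def by (rule approx_Lipschitz[OF assms])
  ultimately show ?thesis unfolding norm_mult norm_numeral u_def by linarith
qed

lemma start_orbit_in_copy:
  assumes adm: "\<And>k. k < n \<Longrightarrow> admissible x k (x k)" and r: "norm q \<le> R + 1"
    "\<And>i. i < j \<Longrightarrow> (approx x n ^^ i) q \<in> good x {..<n}"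
  shows "(approx x n ^^ j) q \<in> copy j"
proof (rule copyI[OF _ r(1)])
  fix i assume "i < j"
  then have "norm (approx x n ((approx x n ^^ i) q) - (2 * (approx x n ^^ i) q + shift)) \<le> 1/4"
    by (intro approx_doubling[OF adm] r(2))
  then show "norm (approx x n ((approx x n ^^ i) q) - (2 * (approx x n ^^ i) q + shift)) \<le> 1" by simp
qed

lemma pole_in_copy:
  assumes adm: "\<And>k. k \<le> n \<Longrightarrow> admissible x k (x k)" shows "pole (x n) \<in> copy n"
  unfolding admissibleD(5)[OF adm[OF order_refl]]
  by (rule start_orbit_in_copy) (use adm admissibleD(3,4)[OF adm[OF order_refl]] in auto)

text \<open>Orbits of the closure of \<open>U\<close> stay away from all poles. The estimate is stated for an abstract map \<open>F\<close> close to all the partial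
  sums with index in \<open>I\<close>, so that it covers both a partial sum and the limit function. A pole \<open>p_m\<close> with \<open>m \<noteq> j\<close> lies in
  another disc than the \<open>j\<close>-th image. For \<open>m = j\<close> the orbit under \<open>F\<close> is compared with the orbit under the partial sum that
  was used to place the pole.\<close>

lemma closure_orbit_good:
  assumes down: "\<And>m k. m \<in> I \<Longrightarrow> k \<le> m \<Longrightarrow> k \<in> I" and adm: "\<And>m. m \<in> I \<Longrightarrow> admissible x m (x m)"
    and F2: "\<And>z. z \<in> good x I \<Longrightarrow> norm (F z - (2 * z + shift)) \<le> 1"
    and Fm: "\<And>z m. m \<in> I \<Longrightarrow> z \<in> good x I \<Longrightarrow> norm (F z - approx x m z) \<le> tol (x m)"
    and IH: "\<And>z m j. m \<in> I \<Longrightarrow> z \<in> closure U \<Longrightarrow> (approx x m ^^ j) z \<in> good x {..<m}"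
    and z: "z \<in> closure U"
  shows "(F ^^ j) z \<in> good x I"
proof (induction j rule: less_induct)
  case (less j)
  have cj: "(F ^^ j) z \<in> copy j"
    by (rule copyI) (use F2 less R[OF z] in auto)
  show ?case
    unfolding good_def mem_Collect_eq
  proof
    fix m assume m: "m \<in> I"
    note a = adm[OF m]
    have admm: "\<And>k. k < m \<Longrightarrow> admissible x k (x k)" using down[OF m] adm by simp
    have p: "pole (x m) \<in> copy m" by (rule pole_in_copy) (use down[OF m] adm in simp)
    show "radius (x m) < norm ((F ^^ j) z - pole (x m))"
    proof (cases "m = j")
      case False
      then have "4 \<le> norm ((F ^^ j) z - pole (x m))" using copy_separated[OF cj p] by simp
      then show ?thesis using admissibleD(7)[OF a] by simp
    next
      case True
      define A where "A = approx x m"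
      \<comment> \<open>Each step multiplies the old deviation by at most \<open>3\<close> and adds at most \<open>tol (x m)\<close>.\<close>
      have "norm ((F ^^ i) z - (A ^^ i) z) \<le> (3 ^ i - 1) * tol (x m)" if "i \<le> m" for i
        using that
      proof (induction i)
        case (Suc i)
        define y y' where "y = (F ^^ i) z" and "y' = (A ^^ i) z"
        have y: "y \<in> good x I" using less[of i] Suc.prems True by (simp add: y_def)
        then have ym: "y \<in> good x {..<m}" using down[OF m] by (auto simp: good_def)
        have y': "y' \<in> good x {..<m}" using IH[OF m z, of i] by (simp add: y'_def A_def)
        have "norm (F y - A y') = norm ((F y - A y) + (A y - A y'))" by simp
        also have "\<dots> \<le> tol (x m) + 3 * norm (y - y')"
          unfolding A_def by (intro norm_triangle_mono Fm[OF m y] approx_Lipschitz_upper admm ym y')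
        also have "\<dots> \<le> tol (x m) + 3 * ((3 ^ i - 1) * tol (x m))"
          using Suc by (simp add: y_def y'_def)
        also have "\<dots> \<le> (3 ^ Suc i - 1) * tol (x m)"
          using admissibleD(8)[OF a] by (simp add: algebra_simps)
        finally show ?case by (simp add: y_def y'_def)
      qed simp
      from this[of m] have d: "norm ((F ^^ m) z - (A ^^ m) z) \<le> 3 ^ m * tol (x m)"
        using admissibleD(8)[OF a] by (simp add: algebra_simps)
      have "radius (x m) + 3 ^ m * tol (x m) < norm ((A ^^ m) z - pole (x m))"
        unfolding A_def by (rule admissibleD(11)[OF a z])
      also have "\<dots> \<le> norm ((F ^^ m) z - (A ^^ m) z) + norm ((F ^^ m) z - pole (x m))"
        using norm_triangle_ineq4[of "(F ^^ m) z - pole (x m)" "(F ^^ m) z - (A ^^ m) z"] by simp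
      finally show ?thesis using d True by simp
    qed
  qed
qed

lemma approx_closure_orbit_good:
  assumes "\<And>k. k < n \<Longrightarrow> admissible x k (x k)" "z \<in> closure U"
  shows "(approx x n ^^ j) z \<in> good x {..<n}"
  using assms
proof (induction n arbitrary: z j rule: less_induct)
  case (less n)
  show ?case
  proof (rule closure_orbit_good)
    fix z assume z: "z \<in> good x {..<n}"
    show "norm (approx x n z - (2 * z + shift)) \<le> 1"
      using approx_doubling[OF less.prems(1) z] by simp
    show "norm (approx x n z - approx x m z) \<le> tol (x m)" if "m \<in> {..<n}" for m
      using approx_diff[OF less.prems(1) z] that by simp
  qed (use less in auto)
qed

lemma open_good: "open (good x {..<n})"
proof -
  have "good x {..<n} = (\<Inter>m\<in>{..<n}. {z. radius (x m) < norm (z - pole (x m))})"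
    by (auto simp: good_def)
  then show ?thesis by (auto intro!: open_INT open_Collect_less continuous_intros)
qed

lemma approx_isCont:
  assumes adm: "\<And>k. k < n \<Longrightarrow> admissible x k (x k)" and z: "z \<in> good x {..<n}"
  shows "isCont (approx x n) z"
proof -
  have "isCont (pert (x m)) z" if "m < n" for m
  proof -
    have "radius (x m) < norm (z - pole (x m))" using z that by (simp add: good_def)
    then have "z \<in> - {pole (x m)}" using admissibleD(6)[OF adm[OF that]] by auto
    then show ?thesis
      using holomorphic_on_imp_continuous_on[OF admissibleD(12)[OF adm[OF that]]]
      by (simp add: continuous_on_eq_continuous_at open_Compl)
  qed
  then show ?thesis unfolding approx_def[abs_def] by (intro continuous_intros) auto
qed

lemma approx_funpow_isCont:
  assumes adm: "\<And>k. k < n \<Longrightarrow> admissible x k (x k)"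
    and "\<And>i. i < j \<Longrightarrow> (approx x n ^^ i) z \<in> good x {..<n}"
  shows "isCont (approx x n ^^ j) z"
  using assms(2)
proof (induction j)
  case (Suc j)
  have "isCont (approx x n \<circ> (approx x n ^^ j)) z"
    by (intro continuous_at_compose Suc approx_isCont adm) (use Suc.prems in auto)
  then show ?case by (simp only: funpow.simps)
qed (simp add: id_def)

lemma approx_funpow_injective:
  assumes adm: "\<And>k. k < n \<Longrightarrow> admissible x k (x k)"
    and "\<And>i. i < j \<Longrightarrow> (approx x n ^^ i) z \<in> good x {..<n}" "\<And>i. i < j \<Longrightarrow> (approx x n ^^ i) w \<in> good x {..<n}"
  shows "norm (z - w) \<le> norm ((approx x n ^^ j) z - (approx x n ^^ j) w)"
  using assms(2,3)
proof (induction j)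
  case (Suc j)
  have "norm (z - w) \<le> norm ((approx x n ^^ j) z - (approx x n ^^ j) w)" using Suc by simp
  also have "\<dots> \<le> norm (approx x n ((approx x n ^^ j) z) - approx x n ((approx x n ^^ j) w))"
    by (rule approx_expanding[OF adm]) (use Suc.prems in auto)
  finally show ?case by simp
qed simp

text \<open>The orbit of a frontier point consists of good points, and goodness is an open condition, so points close to the frontier
  point have good orbits as well. By regularity some of them lie outside the closure of \<open>U\<close>.\<close>

lemma admissible_start_exists:
  assumes adm: "\<And>k. k < n \<Longrightarrow> admissible x k (x k)"
  obtains q where "q \<in> V n" "q \<notin> closure U" "norm q \<le> R + 1"
    "\<And>j. j < n \<Longrightarrow> (approx x n ^^ j) q \<in> good x {..<n}"
proof -
  obtain b where b: "b \<in> V n" "b \<in> frontier U" using V_frontier by blast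
  then have bK: "b \<in> closure U" by (simp add: frontier_def)
  have orb: "(approx x n ^^ j) b \<in> good x {..<n}" for j
    by (rule approx_closure_orbit_good[OF adm bK])
  have "\<forall>\<^sub>F q in nhds b. (approx x n ^^ j) q \<in> good x {..<n}" for j
  proof -
    have "isCont (approx x n ^^ j) b" by (rule approx_funpow_isCont[OF adm orb])
    then have "((approx x n ^^ j) \<longlongrightarrow> (approx x n ^^ j) b) (nhds b)"
      by (simp add: tendsto_nhds_iff isContD)
    then show ?thesis using open_good orb by (rule topological_tendstoD)
  qed
  then have "\<forall>\<^sub>F q in nhds b. \<forall>j\<in>{..<n}. (approx x n ^^ j) q \<in> good x {..<n}"
    by (intro eventually_ball_finite) auto
  moreover have "\<forall>\<^sub>F q in nhds b. q \<in> V n \<inter> ball b 1"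
    by (rule eventually_nhds_in_open) (use V_open b in auto)
  ultimately have "\<forall>\<^sub>F q in nhds b. (\<forall>j\<in>{..<n}. (approx x n ^^ j) q \<in> good x {..<n}) \<and> q \<in> V n \<inter> ball b 1"
    by (rule eventually_conj)
  then obtain T where T: "open T" "b \<in> T"
    "\<And>q. q \<in> T \<Longrightarrow> (\<forall>j\<in>{..<n}. (approx x n ^^ j) q \<in> good x {..<n}) \<and> q \<in> V n \<inter> ball b 1"
    unfolding eventually_nhds by blast
  have "b \<notin> interior (closure U)"
    using b(2) unfolding U_regular by (simp add: frontier_def interior_open U_open)
  then have "\<not> T \<subseteq> closure U" using T(1,2) interior_maximal by blast
  then obtain q where q: "q \<in> T" "q \<notin> closure U" by blast
  have "norm q \<le> norm b + norm (q - b)" by (metis add.commute diff_add_cancel norm_triangle_ineq)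
  also have "\<dots> \<le> R + 1"
    using T(3)[OF q(1)] R[OF bK] by (intro add_mono) (auto simp: dist_norm norm_minus_commute)
  finally show ?thesis using that[of q] T(3)[OF q(1)] q(2) by blast
qed

lemma small_tol_exists:
  assumes "finite A" "\<And>a. a \<in> A \<Longrightarrow> 0 < (t a :: real)" "0 < d"
  obtains \<gamma> where "0 < \<gamma>" "\<gamma> \<le> d" "\<And>a. a \<in> A \<Longrightarrow> \<gamma> \<le> t a"
proof (rule that[of "Min (insert d (t ` A))"])
  show "0 < Min (insert d (t ` A))" using assms by (subst Min_gr_iff) auto
qed (use assms in auto)

text \<open>Injectivity along good orbits separates the new pole from the compact \<open>n\<close>-th image of the closure of \<open>U\<close>. One third of the
  distance goes into the radius and one third into the tolerance. The new perturbation has to vanish on orbit points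
  from the discs \<open>copy j\<close> with \<open>j < n\<close>, which do not contain the pole.\<close>

lemma admissible_exists:
  assumes adm: "\<And>k. k < n \<Longrightarrow> admissible x k (x k)" shows "\<exists>r. admissible x n r"
proof -
  obtain q where q: "q \<in> V n" "q \<notin> closure U" "norm q \<le> R + 1"
    "\<And>j. j < n \<Longrightarrow> (approx x n ^^ j) q \<in> good x {..<n}"
    by (rule admissible_start_exists[OF adm]) (assumption, rule that)
  define p where "p = (approx x n ^^ n) q"
  let ?fK = "(approx x n ^^ n) ` closure U"
  have good: "(approx x n ^^ j) z \<in> good x {..<n}" if "z \<in> closure U" for z j
    by (rule approx_closure_orbit_good[OF adm that])
  have "continuous_on (closure U) (approx x n ^^ n)"
    by (intro continuous_at_imp_continuous_on ballI approx_funpow_isCont adm good)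
  then have cl: "closed ?fK" by (intro compact_imp_closed compact_continuous_image compact_closure)
  have "p \<notin> ?fK"
  proof
    assume "p \<in> ?fK"
    then obtain z where z: "z \<in> closure U" "p = (approx x n ^^ n) z" by blast
    have "norm (q - z) \<le> norm ((approx x n ^^ n) q - (approx x n ^^ n) z)"
      by (rule approx_funpow_injective[OF adm q(4) good[OF z(1)]])
    then have "q = z" using z(2) by (simp add: p_def)
    then show False using z(1) q(2) by simp
  qed
  from separate_point_closed[OF cl this]
  obtain d where d: "0 < d" "\<And>y. y \<in> ?fK \<Longrightarrow> d \<le> dist p y" by blast
  define \<delta> where "\<delta> = min 1 (d / 3)"
  have \<delta>: "0 < \<delta>" "\<delta> \<le> 1" "\<delta> \<le> d / 3" using d(1) by (auto simp: \<delta>_def)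
  obtain \<gamma> where \<gamma>: "0 < \<gamma>" "\<gamma> \<le> min (1/4) (d / 3 / 3 ^ n)" "\<And>m. m \<in> {..<n} \<Longrightarrow> \<gamma> \<le> tol (x m)"
    by (rule small_tol_exists[of "{..<n}" "\<lambda>m. tol (x m)" "min (1/4) (d / 3 / 3 ^ n)"])
      (use d(1) admissibleD(8)[OF adm] in \<open>auto\<close>)
  define W where "W = (\<Union>m\<in>{..<n}. (\<lambda>j. (approx x m ^^ j) (start (x m))) ` {..<m}) \<union> (\<lambda>j. (approx x n ^^ j) q) ` {..<n}"
  have pc: "p \<in> copy n" unfolding p_def by (rule start_orbit_in_copy[OF adm q(3,4)])
  have "\<exists>j<n. y \<in> copy j" if "y \<in> W" for y
    using that unfolding W_def
  proof (elim UnE UN_E imageE)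
    fix m j assume mj: "m \<in> {..<n}" "j \<in> {..<m}" "y = (approx x m ^^ j) (start (x m))"
    have a: "admissible x m (x m)" using adm mj by simp
    have "y \<in> copy j" unfolding mj(3)
      by (rule start_orbit_in_copy[OF _ admissibleD(3)[OF a] admissibleD(4)[OF a]]) (use adm mj in auto)
    then show ?thesis using mj by (intro exI[of _ j]) auto
  next
    fix j assume j: "j \<in> {..<n}" "y = (approx x n ^^ j) q"
    have "y \<in> copy j" unfolding j(2)
      by (rule start_orbit_in_copy[OF adm q(3,4)]) (use j in auto)
    then show ?thesis using j by (intro exI[of _ j]) auto
  qed
  then have pW: "p \<notin> W" using copy_separated[OF pc] by fastforce
  have fW: "finite W" by (simp add: W_def)
  have "0 < \<gamma> * (1/2) ^ Suc n" using \<gamma>(1) by simp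
  then obtain s where s: "s holomorphic_on - {p}" "is_pole s p" "\<And>w. w \<in> W \<Longrightarrow> s w = 0"
    "small_off s p \<delta> (\<gamma> * (1/2) ^ Suc n)"
    by (rule rational_pole_vanishing_on[OF fW pW \<delta>(1)]) (rule that)
  have W1: "s ((approx x m ^^ j) (start (x m))) = 0" if "m < n" "j < m" for m j
    by (rule s(3)) (use that in \<open>auto simp: W_def\<close>)
  have W2: "s ((approx x n ^^ j) q) = 0" if "j < n" for j
    by (rule s(3)) (use that in \<open>auto simp: W_def\<close>)
  have far: "\<delta> + 3 ^ n * \<gamma> < norm ((approx x n ^^ n) z - p)" if "z \<in> closure U" for z
  proof -
    have "3 ^ n * \<gamma> \<le> d / 3" using \<gamma>(2) by (simp add: field_simps)
    then have "\<delta> + 3 ^ n * \<gamma> < d" using \<delta>(3) d(1) by linarith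
    also have "d \<le> norm ((approx x n ^^ n) z - p)" using d(2)[of "(approx x n ^^ n) z"] that by (simp add: dist_norm norm_minus_commute)
    finally show ?thesis .
  qed
  have "admissible x n (Stage q p \<delta> \<gamma> s)"
    unfolding admissible_def stage.sel using q \<delta> \<gamma> s W1 W2 far p_def by auto
  then show ?thesis ..
qed

lemma admissible_sequence_exists: "\<exists>x. \<forall>n. admissible x n (x n)"
proof (rule dependent_wellorder_choice)
  show "admissible f n r = admissible g n r" if "\<And>m. m < n \<Longrightarrow> f m = g m" for r f g n
    by (rule admissible_cong[OF that])
  show "\<exists>r. admissible f n r" if "\<And>m. m < n \<Longrightarrow> admissible f m (f m)" for n f
    by (rule admissible_exists[OF that])
qed

end

section \<open>The limit function\<close>

locale admissible_stages = regular_domain_construction +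
  fixes x :: "nat \<Rightarrow> stage"
  assumes adm: "\<And>n. admissible x n (x n)"
begin

definition poles :: "complex set" where "poles = range (\<lambda>m. pole (x m))"

definition f :: "complex \<Rightarrow> complex" where "f z = 2 * z + shift + (\<Sum>k. pert (x k) z)"

text \<open>At its poles a nicely meromorphic function has the value \<open>0\<close>.\<close>

definition g :: "complex \<Rightarrow> complex" where "g z = (if z \<in> poles then 0 else f z)"

definition f_sphere :: "complex \<Rightarrow> riemann_sphere" where "f_sphere z = (if is_pole g z then Infty else Fin (g z))"

lemma pole_copy: "pole (x m) \<in> copy m"
  by (rule pole_in_copy[OF adm])

text \<open>The \<open>k\<close>-th pole lies in \<open>copy k\<close>, and these discs tend to infinity.\<close>

lemma poles_far_from_bounded:
  obtains N where "\<And>k z. k \<ge> N \<Longrightarrow> norm z \<le> \<rho> \<Longrightarrow> 1 < norm (z - pole (x k))"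
proof -
  obtain N where N: "\<rho> + 5 * S + 1 < 2 ^ N" using real_arch_pow[of 2 "\<rho> + 5 * S + 1"] by (auto simp only: one_less_numeral_iff semiring_norm)
  show ?thesis
  proof (rule that[of N])
    fix k :: nat and z :: complex assume kz: "N \<le> k" "norm z \<le> \<rho>"
    have "(2::real) ^ N \<le> 2 ^ k" by (rule power_increasing[OF kz(1)]) simp
    moreover have "2 ^ k - 5 * S \<le> norm (pole (x k))" by (rule copy_far[OF pole_copy])
    moreover have "norm (pole (x k)) - norm z \<le> norm (z - pole (x k))"
      using norm_triangle_ineq2[of "pole (x k)" z] by (simp add: norm_minus_commute)
    ultimately show "1 < norm (z - pole (x k))" using N kz(2) by linarith
  qed
qed

lemma pert_analytic: 
  assumes "z \<noteq> pole (x k)" shows "pert (x k) analytic_on {z}"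
proof (rule analytic_on_subset)
  have "open (- {pole (x k)})" by (rule open_Compl) simp
  then show "pert (x k) analytic_on - {pole (x k)}"
    using admissibleD(12)[OF adm[of k]] by (simp only: analytic_on_open)
qed (use assms in simp)

lemma summable_half_powers: "summable (\<lambda>k. (1/2) ^ Suc k :: real)"
  unfolding power_Suc by (intro summable_mult summable_geometric) simp

lemma pert_small_near:
  obtains N where "\<And>k. k \<ge> N \<Longrightarrow> pert (x k) holomorphic_on ball z0 1"
    "\<And>k z. k \<ge> N \<Longrightarrow> z \<in> ball z0 1 \<Longrightarrow> norm (pert (x k) z) \<le> (1/2) ^ Suc k"
proof -
  obtain N where N: "\<And>k z. k \<ge> N \<Longrightarrow> norm z \<le> norm z0 + 1 \<Longrightarrow> 1 < norm (z - pole (x k))"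
    by (rule poles_far_from_bounded[of "norm z0 + 1"]) (rule that)
  have b: "norm z \<le> norm z0 + 1" if "z \<in> ball z0 1" for z
    using that norm_triangle_ineq2[of z z0] by (simp add: dist_norm norm_minus_commute)
  show ?thesis
  proof (rule that[of N])
    fix k assume k: "N \<le> k"
    show "pert (x k) holomorphic_on ball z0 1"
    proof (rule holomorphic_on_subset[OF admissibleD(12)[OF adm]], rule subsetI)
      fix w assume "w \<in> ball z0 1"
      from N[OF k b[OF this]] show "w \<in> - {pole (x k)}" by auto
    qed
    fix z assume z: "z \<in> ball z0 1"
    have "norm (pert (x k) z) \<le> tol (x k) * (1/2) ^ Suc k"
      using pert_bound[OF adm[of k] order_refl, of z] N[OF k b[OF z]] admissibleD(7)[OF adm[of k]] by simp
    also have "\<dots> \<le> 1 * (1/2) ^ Suc k"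
      using admissibleD(9)[OF adm[of k]] by (intro mult_right_mono) auto
    finally show "norm (pert (x k) z) \<le> (1/2) ^ Suc k" by simp
  qed
qed

lemma summable_pert: "summable (\<lambda>k. pert (x k) z)"
proof -
  obtain N where "\<And>k w. k \<ge> N \<Longrightarrow> w \<in> ball z 1 \<Longrightarrow> norm (pert (x k) w) \<le> (1/2) ^ Suc k"
    by (rule pert_small_near[of z]) (rule that)
  then show ?thesis
    by (intro summable_comparison_test'[OF summable_half_powers, of N]) simp
qed

lemma f_analytic: 
  assumes "z \<notin> poles" shows "f analytic_on {z}"
proof -
  obtain N where N: "\<And>k. k \<ge> N \<Longrightarrow> pert (x k) holomorphic_on ball z 1"
    "\<And>k w. k \<ge> N \<Longrightarrow> w \<in> ball z 1 \<Longrightarrow> norm (pert (x k) w) \<le> (1/2) ^ Suc k"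
    by (rule pert_small_near[of z]) (rule that)
  have "(\<lambda>w. \<Sum>k. pert (x k) w) analytic_on {z}"
  proof (rule series_analytic_at(1)[OF _ N summable_half_powers])
    show "pert (x k) analytic_on {z}" for k
      by (rule pert_analytic) (use assms in \<open>auto simp: poles_def\<close>)
  qed
  moreover have "(\<lambda>w. 2 * w + shift) analytic_on {z}" by (intro analytic_intros)
  ultimately show ?thesis unfolding f_def[abs_def] by (rule analytic_on_add[rotated])
qed

lemma pole_separated: "m \<noteq> k \<Longrightarrow> 4 \<le> norm (pole (x m) - pole (x k))"
  by (rule copy_separated[OF pole_copy pole_copy])

text \<open>The series without its \<open>m\<close>-th term is analytic at the \<open>m\<close>-th pole.\<close>

lemma is_pole_f: "is_pole f (pole (x m))"
proof -
  define p where "p = pole (x m)"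
  define t where "t k z = (if k = m then 0 else pert (x k) z)" for k z
  obtain N where N: "\<And>k. k \<ge> N \<Longrightarrow> pert (x k) holomorphic_on ball p 1"
    "\<And>k z. k \<ge> N \<Longrightarrow> z \<in> ball p 1 \<Longrightarrow> norm (pert (x k) z) \<le> (1/2) ^ Suc k"
    by (rule pert_small_near[of p]) (rule that)
  have "(\<lambda>z. \<Sum>k. t k z) analytic_on {p}"
  proof (rule series_analytic_at(1)[OF _ _ _ summable_half_powers])
    show "t k analytic_on {p}" for k
    proof (cases "k = m")
      case False
      then have "p \<noteq> pole (x k)" using pole_separated[of m k] by (auto simp: p_def)
      then have "pert (x k) analytic_on {p}" by (rule pert_analytic)
      then show ?thesis using False by (simp add: t_def[abs_def])
    qed (simp add: t_def[abs_def])
    show "t k holomorphic_on ball p 1" if "N \<le> k" for k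
      using N(1)[OF that] by (cases "k = m") (simp_all add: t_def[abs_def])
    show "norm (t k z) \<le> (1/2) ^ Suc k" if "N \<le> k" "z \<in> ball p 1" for k z
      using N(2)[OF that] by (simp add: t_def)
  qed
  moreover have "(\<lambda>z. 2 * z + shift) analytic_on {p}" by (intro analytic_intros)
  ultimately have "(\<lambda>z. 2 * z + shift + (\<Sum>k. t k z)) analytic_on {p}" by (rule analytic_on_add[rotated])
  then have "(\<lambda>z. 2 * z + shift + (\<Sum>k. t k z)) \<midarrow>p\<rightarrow> 2 * p + shift + (\<Sum>k. t k p)"
    by (intro isContD analytic_at_imp_isCont)
  moreover have "filterlim (pert (x m)) at_infinity (at p)"
    using admissibleD(13)[OF adm[of m]] by (simp add: is_pole_def p_def)
  ultimately have "filterlim (\<lambda>z. (2 * z + shift + (\<Sum>k. t k z)) + pert (x m) z) at_infinity (at p)"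
    by (rule tendsto_add_filterlim_at_infinity)
  moreover have "(2 * z + shift + (\<Sum>k. t k z)) + pert (x m) z = f z" for z
  proof -
    have s: "(\<lambda>k. if k = m then pert (x m) z else 0) sums pert (x m) z"
      using sums_single[of m "\<lambda>_. pert (x m) z"] by simp
    have eq: "(\<lambda>k. t k z) = (\<lambda>k. pert (x k) z - (if k = m then pert (x m) z else 0))"
      by (auto simp: t_def)
    have "(\<lambda>k. t k z) sums ((\<Sum>k. pert (x k) z) - pert (x m) z)"
      unfolding eq by (rule sums_diff[OF summable_sums[OF summable_pert] s])
    then show ?thesis by (simp add: f_def sums_iff)
  qed
  ultimately show ?thesis unfolding is_pole_def p_def by simp
qed

lemma poles_discrete: obtains A where "open A" "z \<in> A" "\<And>w. w \<in> A \<Longrightarrow> w \<in> poles \<Longrightarrow> w = z"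
proof -
  obtain N where N: "\<And>k w. k \<ge> N \<Longrightarrow> norm w \<le> norm z + 1 \<Longrightarrow> 1 < norm (w - pole (x k))"
    by (rule poles_far_from_bounded[of "norm z + 1"]) (rule that)
  define X where "X = (\<lambda>k. pole (x k)) ` {..<N} - {z}"
  show ?thesis
  proof (rule that[of "ball z 1 - X"])
    show "open (ball z 1 - X)" by (intro open_Diff finite_imp_closed) (auto simp: X_def)
    show "z \<in> ball z 1 - X" by (simp add: X_def)
    fix w assume w: "w \<in> ball z 1 - X" "w \<in> poles"
    then obtain k where k: "w = pole (x k)" by (auto simp: poles_def)
    have "norm w \<le> norm z + 1"
      using w(1) norm_triangle_ineq2[of w z] by (simp add: dist_norm norm_minus_commute)
    then have "\<not> k \<ge> N" using N[of k w] k by auto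
    then show "w = z" using w(1) k by (auto simp: X_def)
  qed
qed

lemma g_analytic: assumes "z \<notin> poles" shows "g analytic_on {z}"
proof -
  obtain A where A: "open A" "z \<in> A" "\<And>w. w \<in> A \<Longrightarrow> w \<in> poles \<Longrightarrow> w = z"
    by (rule poles_discrete[of z]) (rule that)
  have ev: "\<forall>\<^sub>F w in nhds z. g w = f w"
    using eventually_nhds_in_open[OF A(1,2)] by eventually_elim (use A(3) assms in \<open>auto simp: g_def\<close>)
  show ?thesis by (rule iffD2[OF analytic_at_cong[OF ev refl] f_analytic[OF assms]])
qed

lemma is_pole_g: "is_pole g (pole (x m))"
proof -
  obtain A where A: "open A" "pole (x m) \<in> A" "\<And>w. w \<in> A \<Longrightarrow> w \<in> poles \<Longrightarrow> w = pole (x m)"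
    by (rule poles_discrete[of "pole (x m)"]) (rule that)
  have ev: "\<forall>\<^sub>F w in at (pole (x m)). f w = g w"
    using eventually_at_in_open[OF A(1,2)] by eventually_elim (use A(3) in \<open>auto simp: g_def\<close>)
  show ?thesis by (rule iffD1[OF is_pole_cong[OF ev refl] is_pole_f])
qed

lemma is_pole_g_iff: "is_pole g z \<longleftrightarrow> z \<in> poles"
  using is_pole_g analytic_at_imp_no_pole[OF g_analytic, of z] by (auto simp: poles_def)

lemma f_sphere_eq: "f_sphere z = (if z \<in> poles then Infty else Fin (f z))"
  by (simp add: f_sphere_def is_pole_g_iff g_def)

lemma g_nicely_meromorphic: "g nicely_meromorphic_on UNIV"
proof (rule nicely_meromorphic_onI_open[where pts = poles])
  show "g analytic_on UNIV - poles"
    by (subst analytic_on_analytic_at) (use g_analytic in auto)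
  show "is_pole g z \<and> g z = 0" if "z \<in> poles" for z
    using that by (simp add: is_pole_g_iff g_def)
  show "isolated_singularity_at g z" for z
  proof -
    obtain A where A: "open A" "z \<in> A" "\<And>w. w \<in> A \<Longrightarrow> w \<in> poles \<Longrightarrow> w = z"
      by (rule poles_discrete[of z]) (rule that)
    have "g analytic_on A - {z}"
      by (subst analytic_on_analytic_at) (use g_analytic A(3) in auto)
    then show ?thesis
      by (intro isolated_singularity_at_holomorphic[OF _ A(1,2)] analytic_imp_holomorphic)
  qed
qed simp

lemma f_sphere_meromorphic: "meromorphic_map f_sphere"
  unfolding meromorphic_map_def by (intro exI[of _ g] conjI g_nicely_meromorphic ext) (rule f_sphere_def)

text \<open>The poles are pairwise distinct, hence infinite in number.\<close>

lemma f_sphere_transcendental: "\<not> rational_map f_sphere"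
proof
  assume "rational_map f_sphere"
  then obtain p q where q: "q \<noteq> 0" "\<And>z. poly q z \<noteq> 0 \<Longrightarrow> f_sphere z = Fin (poly p z / poly q z)"
    unfolding rational_map_def by blast
  have "inj (\<lambda>m. pole (x m))"
  proof (rule injI)
    fix m k assume "pole (x m) = pole (x k)"
    then show "m = k" using pole_separated[of m k] by (cases "m = k") auto
  qed
  then have "infinite poles" unfolding poles_def by (rule range_inj_infinite)
  moreover have "poles \<subseteq> {z. poly q z = 0}"
    using q(2) by (force simp: f_sphere_eq)
  ultimately show False using poly_roots_finite[OF q(1)] finite_subset by blast
qed

lemma map_domain_f_sphere: "map_domain f_sphere = range Fin"
  by (simp add: map_domain_def f_sphere_transcendental)

lemma sphere_map_f_sphere: "z \<notin> poles \<Longrightarrow> sphere_map f_sphere (Fin z) = Fin (f z)"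
  by (simp add: f_sphere_eq)

lemma funpow_sphere_map_f_sphere:
  "(\<And>i. i < j \<Longrightarrow> (f ^^ i) z \<notin> poles) \<Longrightarrow> (sphere_map f_sphere ^^ j) (Fin z) = Fin ((f ^^ j) z)"
proof (induction j)
  case (Suc j)
  have "(sphere_map f_sphere ^^ Suc j) (Fin z) = sphere_map f_sphere ((sphere_map f_sphere ^^ j) (Fin z))" by simp
  also have "\<dots> = sphere_map f_sphere (Fin ((f ^^ j) z))" using Suc by simp
  also have "\<dots> = Fin (f ((f ^^ j) z))" by (rule sphere_map_f_sphere) (use Suc.prems in simp)
  finally show ?case by simp
qed simp

lemma good_not_pole: "z \<in> good x UNIV \<Longrightarrow> z \<notin> poles"
  using admissibleD(6)[OF adm] by (force simp: good_def poles_def dest: less_trans)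

lemma approx_tendsto: "(\<lambda>n. approx x n z) \<longlonglongrightarrow> f z"
  unfolding approx_def f_def by (intro tendsto_intros summable_LIMSEQ summable_pert)

lemma f_doubling: 
  assumes z: "z \<in> good x UNIV" shows "norm (f z - (2 * z + shift)) \<le> 1"
proof (rule Lim_norm_ubound)
  show "(\<lambda>n. approx x n z - (2 * z + shift)) \<longlonglongrightarrow> f z - (2 * z + shift)"
    by (intro tendsto_intros approx_tendsto)
  have "norm (approx x n z - (2 * z + shift)) \<le> 1/4" for n
    by (rule approx_doubling[OF adm]) (use z in \<open>auto simp: good_def\<close>)
  then show "\<forall>\<^sub>F n in sequentially. norm (approx x n z - (2 * z + shift)) \<le> 1"
    by (intro always_eventually allI) (rule order_trans, assumption, simp)
qed simp

lemma f_near_approx: 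
  assumes z: "z \<in> good x UNIV" shows "norm (f z - approx x m z) \<le> tol (x m)"
proof (rule Lim_norm_ubound)
  show "(\<lambda>n. approx x n z - approx x m z) \<longlonglongrightarrow> f z - approx x m z"
    by (intro tendsto_intros approx_tendsto)
  have "norm (approx x n z - approx x m z) \<le> tol (x m)" if "n \<ge> Suc m" for n
    by (rule approx_diff[OF adm]) (use z that in \<open>auto simp: good_def\<close>)
  then show "\<forall>\<^sub>F n in sequentially. norm (approx x n z - approx x m z) \<le> tol (x m)"
    by (rule eventually_sequentiallyI)
qed simp

lemma closure_orbit:
  assumes "z \<in> closure U" shows "(f ^^ j) z \<in> good x UNIV"
  by (rule closure_orbit_good[OF _ adm f_doubling f_near_approx approx_closure_orbit_good[OF adm] assms]) auto

lemma closure_orbit_in_copy: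
  assumes "z \<in> closure U" shows "(f ^^ j) z \<in> copy j"
  by (rule copyI) (use f_doubling closure_orbit[OF assms] R[OF assms] in auto)

lemma sphere_orbit_closure:
  assumes "z \<in> closure U" shows "(sphere_map f_sphere ^^ j) (Fin z) = Fin ((f ^^ j) z)"
  by (rule funpow_sphere_map_f_sphere) (rule good_not_pole[OF closure_orbit[OF assms]])

text \<open>All perturbations from the \<open>n\<close>-th on vanish along the first \<open>n\<close> points of this orbit.\<close>

lemma start_orbit:
  "j \<le> n \<Longrightarrow> (f ^^ j) (start (x n)) = (approx x n ^^ j) (start (x n))"
proof (induction j)
  case (Suc j)
  define y where "y = (approx x n ^^ j) (start (x n))"
  have "pert (x k) y = 0" if "k \<notin> {..<n}" for k
  proof (cases "k = n")
    case True
    then show ?thesis unfolding y_def using admissibleD(16)[OF adm[of n], of j] Suc.prems by simp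
  next
    case False
    then show ?thesis unfolding y_def using admissibleD(15)[OF adm[of k], of n j] that Suc.prems by simp
  qed
  then have "(\<Sum>k. pert (x k) y) = (\<Sum>k<n. pert (x k) y)" by (intro suminf_finite) auto
  then have "f y = approx x n y" by (simp add: f_def approx_def)
  then show ?case using Suc by (simp add: y_def)
qed simp

lemma start_orbit_not_pole:
  assumes j: "j < n" shows "(f ^^ j) (start (x n)) \<notin> poles"
proof
  define y where "y = (f ^^ j) (start (x n))"
  have y: "y = (approx x n ^^ j) (start (x n))" using start_orbit[of j n] j by (simp add: y_def)
  assume "(f ^^ j) (start (x n)) \<in> poles"
  then obtain k where k: "y = pole (x k)" by (auto simp: poles_def y_def)
  show False
  proof (cases "k < n")
    case True
    have "y \<in> good x {..<n}" unfolding y by (rule admissibleD(4)[OF adm j])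
    then have "radius (x k) < norm (y - pole (x k))" using True by (simp add: good_def)
    then show False using k admissibleD(6)[OF adm[of k]] by simp
  next
    case False
    have "y \<in> copy j" unfolding y
      by (rule start_orbit_in_copy[OF adm admissibleD(3)[OF adm] admissibleD(4)[OF adm]]) (use j in simp)
    then have "4 \<le> norm (y - pole (x k))" by (rule copy_separated[OF _ pole_copy]) (use j False in simp)
    then show False using k by simp
  qed
qed

lemma start_prepole: "(sphere_map f_sphere ^^ Suc n) (Fin (start (x n))) = Infty"
proof -
  have "(sphere_map f_sphere ^^ n) (Fin (start (x n))) = Fin ((f ^^ n) (start (x n)))"
    by (rule funpow_sphere_map_f_sphere) (rule start_orbit_not_pole)
  moreover have "(f ^^ n) (start (x n)) = pole (x n)"
    using start_orbit[of n n] admissibleD(5)[OF adm[of n]] by simp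
  ultimately show ?thesis by (simp add: f_sphere_eq poles_def)
qed

text \<open>An orbit through infinity does not continue under a transcendental map.\<close>

lemma start_not_fatou: "Fin (start (x n)) \<notin> fatou_set f_sphere"
proof
  assume "Fin (start (x n)) \<in> fatou_set f_sphere"
  then have "all_iterates_defined f_sphere (Fin (start (x n)))" by (rule fatou_setE) blast
  then have "(sphere_map f_sphere ^^ Suc n) (Fin (start (x n))) \<in> map_domain f_sphere"
    unfolding all_iterates_defined_def by blast
  then show False unfolding start_prepole map_domain_f_sphere by auto
qed

lemma frontier_not_fatou:
  assumes b: "b \<in> frontier U" shows "Fin b \<notin> fatou_set f_sphere"
proof
  assume bF: "Fin b \<in> fatou_set f_sphere"
  have "open {z. Fin z \<in> fatou_set f_sphere}" using open_fatou_set[of f_sphere] by (simp add: open_sphere_iff)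
  from V_basis[OF b this] bF obtain n where n: "V n \<subseteq> {z. Fin z \<in> fatou_set f_sphere}" by auto
  have "start (x n) \<in> {z. Fin z \<in> fatou_set f_sphere}"
    by (rule subsetD[OF n admissibleD(1)[OF adm]])
  then show False using start_not_fatou[of n] by simp
qed

lemma iterates_escape:
  assumes "0 < \<epsilon>"
  obtains N where "\<And>j z. j \<ge> N \<Longrightarrow> z \<in> closure U \<Longrightarrow> dist ((sphere_map f_sphere ^^ j) (Fin z)) Infty < \<epsilon>"
proof -
  have "((\<lambda>y. Fin y) \<longlongrightarrow> Infty) at_infinity" by (rule tendsto_Infty) (rule filterlim_ident)
  then have "\<forall>\<^sub>F y in at_infinity. dist (Fin y) Infty < \<epsilon>" using assms by (rule tendstoD)
  then obtain B where "\<forall>y. B \<le> norm y \<longrightarrow> dist (Fin y) Infty < \<epsilon>"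
    unfolding eventually_at_infinity ..
  then have B: "dist (Fin y) Infty < \<epsilon>" if "B \<le> norm y" for y using that by simp
  obtain N where N: "B + 5 * S < 2 ^ N" using real_arch_pow[of 2 "B + 5 * S"] by (auto simp only: one_less_numeral_iff semiring_norm)
  show ?thesis
  proof (rule that[of N])
    fix j z assume jz: "N \<le> j" "z \<in> closure U"
    have "(2::real) ^ N \<le> 2 ^ j" by (rule power_increasing[OF jz(1)]) simp
    moreover have "2 ^ j - 5 * S \<le> norm ((f ^^ j) z)" by (rule copy_far[OF closure_orbit_in_copy[OF jz(2)]])
    ultimately have "B \<le> norm ((f ^^ j) z)" using N by linarith
    then show "dist ((sphere_map f_sphere ^^ j) (Fin z)) Infty < \<epsilon>"
      unfolding sphere_orbit_closure[OF jz(2)] by (rule B)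
  qed
qed

text \<open>A sequence of iterates either repeats one iterate infinitely often, or its exponents tend to infinity, and then the whole
  sequence converges to infinity uniformly on \<open>U\<close>.\<close>

lemma normal_on_U: "normal_family_on (Fin ` U) (range (\<lambda>n. sphere_map f_sphere ^^ n))"
  unfolding normal_family_on_def
proof (intro allI impI)
  fix h :: "nat \<Rightarrow> riemann_sphere \<Rightarrow> riemann_sphere"
  assume "range h \<subseteq> range (\<lambda>n. sphere_map f_sphere ^^ n)"
  then have "\<forall>i. \<exists>k. h i = sphere_map f_sphere ^^ k" by blast
  from choice[OF this] obtain k where "\<forall>i. h i = sphere_map f_sphere ^^ k i" ..
  then have k: "h i = sphere_map f_sphere ^^ k i" for i by (rule spec)
  show "\<exists>r l. strict_mono r \<and> (\<forall>K. compact K \<longrightarrow> K \<subseteq> Fin ` U \<longrightarrow> uniform_limit K (h \<circ> r) l sequentially)"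
  proof (cases "\<exists>c. infinite {i. k i = c}")
    case True
    then obtain c where c: "infinite {i. k i = c}" by blast
    obtain r :: "nat \<Rightarrow> nat" where r: "strict_mono r" "\<And>n. k (r n) = c"
      using infinite_enumerate[OF c] unfolding mem_Collect_eq by blast
    have "h \<circ> r = (\<lambda>_. sphere_map f_sphere ^^ c)" by (simp add: fun_eq_iff k r(2))
    then show ?thesis using r(1)
      by (intro exI[of _ r] exI[of _ "sphere_map f_sphere ^^ c"]) (simp add: uniform_limit_const)
  next
    case False
    have fin: "finite {i. k i < N}" for N
    proof -
      have "{i. k i < N} = (\<Union>c<N. {i. k i = c})" by auto
      then show ?thesis using False by simp
    qed
    have "uniform_limit K h (\<lambda>_. Infty) sequentially" if K: "K \<subseteq> Fin ` U" for K
    proof (rule uniform_limitI)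
      fix e :: real assume "0 < e"
      then obtain N where N: "\<And>j z. j \<ge> N \<Longrightarrow> z \<in> closure U \<Longrightarrow> dist ((sphere_map f_sphere ^^ j) (Fin z)) Infty < e"
        by (rule iterates_escape) (rule that)
      have "\<forall>\<^sub>F i in sequentially. i \<notin> {i. k i < N}"
        using fin[of N] by (simp add: cofinite_eq_sequentially[symmetric] eventually_cofinite)
      then show "\<forall>\<^sub>F i in sequentially. \<forall>y\<in>K. dist (h i y) Infty < e"
      proof eventually_elim
        case (elim i)
        then have "k i \<ge> N" by simp
        then show ?case using K N closure_subset[of U] by (auto simp: k)
      qed
    qed
    then show ?thesis by (intro exI[of _ id] exI[of _ "\<lambda>_. Infty"]) (simp add: strict_mono_id)
  qed
qed

lemma U_subset_fatou: "Fin ` U \<subseteq> fatou_set f_sphere"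
proof (rule fatou_setI)
  show "open (Fin ` U)" using U_open by simp
  show "normal_family_on (Fin ` U) (range (\<lambda>n. sphere_map f_sphere ^^ n))" by (rule normal_on_U)
  show "all_iterates_defined f_sphere y" if y: "y \<in> Fin ` U" for y
  proof -
    obtain z where z: "y = Fin z" "z \<in> U" using y by (rule imageE)
    have "z \<in> closure U" by (rule subsetD[OF closure_subset z(2)])
    then have "(sphere_map f_sphere ^^ n) y \<in> map_domain f_sphere" for n
      unfolding map_domain_f_sphere z(1) by (subst sphere_orbit_closure) (assumption, rule rangeI)
    then show ?thesis unfolding all_iterates_defined_def by (rule allI)
  qed
qed

lemma frontier_Fin_image: "frontier (Fin ` U) \<subseteq> Fin ` frontier U"
proof -
  have "closed (Fin ` closure U)"
    by (intro compact_imp_closed compact_continuous_image continuous_on_Fin continuous_on_id compact_closure)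
  then have "closure (Fin ` U) \<subseteq> Fin ` closure U"
    by (rule closure_minimal[rotated]) (rule image_mono[OF closure_subset])
  moreover have "interior (Fin ` U) = Fin ` U" using U_open by (simp add: interior_open)
  ultimately show ?thesis using U_open by (auto simp: frontier_def interior_open)
qed

lemma U_fatou_component: "fatou_component f_sphere (Fin ` U)"
  unfolding fatou_component_def in_components_maximal
proof (intro conjI allI impI)
  show "Fin ` U \<noteq> {}" using U_ne by simp
  show "Fin ` U \<subseteq> fatou_set f_sphere" by (rule U_subset_fatou)
  show "connected (Fin ` U)" by (intro connected_continuous_image continuous_on_Fin continuous_on_id U_conn)
  fix C assume C: "C \<noteq> {} \<and> Fin ` U \<subseteq> C \<and> C \<subseteq> fatou_set f_sphere \<and> connected C"
  have "C \<inter> frontier (Fin ` U) = {}"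
    using C frontier_Fin_image frontier_not_fatou by blast
  moreover have "C \<inter> Fin ` U \<noteq> {}" using C U_ne by blast
  ultimately have "C - Fin ` U = {}" using connected_Int_frontier[of C "Fin ` U"] C by blast
  then show "C = Fin ` U" using C by blast
qed

end

text \<open>From a countable basis of the plane the sets meeting the frontier are kept; the others are replaced by the whole plane.\<close>

theorem regular_domain_is_fatou_component:
  assumes U: "U \<noteq> {}" "open U" "connected U" "bounded U" and reg: "regular_domain U"
  shows "\<exists>f. meromorphic_map f \<and> fatou_component f (Fin ` U)"
proof -
  obtain B :: "nat \<Rightarrow> complex set" where B: "\<And>n. open (B n)" "\<And>S. open S \<Longrightarrow> \<exists>k. S = \<Union>{B n |n. n \<in> k}"
    by (rule univ_second_countable_sequence) (rule that)
  define V where "V n = (if B n \<inter> frontier U = {} then UNIV else B n)" for n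
  have fr: "frontier U \<noteq> {}"
    using U by (metis frontier_eq_empty not_bounded_UNIV)
  obtain R where R: "\<And>z. z \<in> closure U \<Longrightarrow> norm z \<le> R"
    using bounded_closure[OF U(4)] unfolding bounded_iff by blast
  interpret C: regular_domain_construction U R V
  proof
    show "interior (closure U) = U" using reg by (simp add: regular_domain_def)
    show "open (V n)" for n using B(1) by (simp add: V_def)
    show "V n \<inter> frontier U \<noteq> {}" for n using fr by (simp add: V_def)
    show "\<exists>n. V n \<subseteq> T" if bT: "b \<in> frontier U" "open T" "b \<in> T" for b T
    proof -
      obtain k where "T = \<Union>{B n |n. n \<in> k}" using B(2)[OF bT(2)] by blast
      then obtain n where "b \<in> B n" "B n \<subseteq> T" using bT(3) by blast
      then show ?thesis using bT(1) by (intro exI[of _ n]) (auto simp: V_def)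
    qed
  qed (use U R in auto)
  obtain x where x: "\<And>n. C.admissible x n (x n)" using C.admissible_sequence_exists by blast
  interpret D: admissible_stages U R V x by unfold_locales (rule x)
  show ?thesis using D.f_sphere_meromorphic D.U_fatou_component by blast
qed

theorem theorem1p1:
  fixes U :: "complex set"
  assumes "U \<noteq> {}" and "open U" and "connected U" and "bounded U"
  shows "regular_domain U \<longleftrightarrow>
    (\<exists>f :: complex \<Rightarrow> riemann_sphere. meromorphic_map f \<and> fatou_component f (Fin ` U))"
proof
  assume "regular_domain U"
  then show "\<exists>f. meromorphic_map f \<and> fatou_component f (Fin ` U)"
    by (rule regular_domain_is_fatou_component[OF assms])
next
  assume "\<exists>f. meromorphic_map f \<and> fatou_component f (Fin ` U)"
  then obtain f where f: "meromorphic_map f" "fatou_component f (Fin ` U)" by (elim exE conjE) (rule that)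
  show "regular_domain U" by (rule bounded_fatou_component_regular[OF assms f])
qed

end
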